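(* Let $X\subseteq U$ be a fixed set of $|X|=m$ keys and let $h:U\to[n]$ be a random simple tabulation hash function. Assume $m\le n$. For all $t\ge0$, $$\Pr\bigl[|h(X)|\ge\mu_0+t\bigr]=\exp\!\left(-\Omega\!\left(\min\left\{\frac{t^2}{m^{3-1/c}/n},\ \frac{t}{m^{1-1/c}}\right\}\right)\right),$$ and $$\Pr\bigl[|h(X)|\le\mu_0-t\bigr]=\exp\!\left(-\Omega\!\left(\min\left\{\frac{t^2}{m^{3-1/c}/n},\ \frac{t}{m^{1-1/c}}\right\}\right)\right)+O\!\left(\frac{m^2}{nt^2}\right).$$
   Context: Simple tabulation hashing: the key universe is $U=[u]$, each key $x\in U$ is viewed as a vector $(x[0],\dots,x[c-1])$ of $c=O(1)$ characters from $\Sigma=[u^{1/c}]$; the range is $[n]=[2^r]$. $h(x)=h_0(x[0])\oplus\cdots\oplus h_{c-1}(x[c-1])$ with $h_0,\dots,h_{c-1}:\Sigma\to[2^r]$ independent fully random functions and $\oplus$ bitwise XOR. $\mu_0=n(1-(1-1/n)^m)$. Constants in $O(\cdot),\Omega(\cdot)$ may depend on $c$ only. *)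

theory Defs
  imports "HOL-Probability.Probability"
begin

text \<open>Simple tabulation hashing with c characters from the alphabet \<Sigma> = {0..<s}
  (so the key universe has size u = s^c) into the range [2^r].
  A key is a vector of c characters, represented extensionally.\<close>

definition tab_keys :: "nat \<Rightarrow> nat \<Rightarrow> (nat \<Rightarrow> nat) set" where
  "tab_keys c s = PiE {0..<c} (\<lambda>_. {0..<s})"

text \<open>The random choice: c independent fully random tables h_i : \<Sigma> \<Rightarrow> [2^r].\<close>
definition tab_tables :: "nat \<Rightarrow> nat \<Rightarrow> nat \<Rightarrow> (nat \<Rightarrow> nat \<Rightarrow> nat) set" where
  "tab_tables c s r = PiE {0..<c} (\<lambda>_. PiE {0..<s} (\<lambda>_. {0..<2^r}))"

definition tab_hash :: "nat \<Rightarrow> (nat \<Rightarrow> nat \<Rightarrow> nat) \<Rightarrow> (nat \<Rightarrow> nat) \<Rightarrow> nat" where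
  "tab_hash c T x = foldr (\<lambda>i acc. xor (T i (x i)) acc) [0..<c] 0"

definition tab_dist :: "nat \<Rightarrow> nat \<Rightarrow> nat \<Rightarrow> (nat \<Rightarrow> nat \<Rightarrow> nat) pmf" where
  "tab_dist c s r = pmf_of_set (tab_tables c s r)"

definition mu0 :: "nat \<Rightarrow> nat \<Rightarrow> real" where
  "mu0 n m = real n * (1 - (1 - 1 / real n) ^ m)"

end

theory Submission
  imports Defs
begin

text \<open>Let \<open>N\<close> be the number of empty bins and \<open>N\<^sub>0 = n (1 - 1/n)\<^sup>m\<close>. The keys are
  split into groups of size at most \<open>m\<^bsup>1 - 1/c\<^esup>\<close> that share a table entry not used by earlier
  groups, so the hash values of a group, given those of the earlier groups, are a fixed set
  translated by a uniform shift. This bounds \<open>N\<close> from both sides by a deterministic quantity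
  close to \<open>N\<^sub>0\<close> plus a martingale with bounded increments and variance (Bernstein), where the upper
  bound has an additional term counting colliding pairs inside groups (Chebyshev).

  For small \<open>t\<close> this is not enough, because the bound has leading constant 1 while the group
  argument only locates the mean of \<open>N\<close> up to \<open>m\<^bsup>2 - 1/c\<^esup> / n\<close>. In that range the one-sided Chebyshev
  inequality is used, which needs \<open>N\<^sub>0 \<le> E N \<le> N\<^sub>0 + O(m / n)\<close>. The mean is computed by adding keys one at
  a time: swapping the values \<open>0\<close> and \<open>a\<close> of a new key \<open>x\<close> by a functional over the field with two
  elements shows that \<open>x\<close> hits a still empty bin with probability at most \<open>1/n\<close>, with a
  defect that occurs only if \<open>x\<close> is a linear combination of the keys it collides with. Such
  dependencies are rare since zero-sum sets of \<open>2j\<close> keys number only \<open>O(m\<^sup>j)\<close>, by Khintchine's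
  inequality for decoupled Rademacher chaos.\<close>

section \<open>Linear algebra over the field with two elements\<close>

text \<open>The two tails differ because collisions inside a group only shrink its image. They can
  only raise \<open>N\<close>, so they affect the upper bound alone, and since just their variance
  is controlled they cost the polynomial term. This asymmetry fixes how well the mean must be known.
  For small \<open>N\<close> nothing is added to the exponential, which is below 1 for every
  positive t (nonempty \<open>X\<close>), so \<open>N\<^sub>0 \<le> E N\<close> must hold without
  any error; the swap provides this because its defect has a fixed sign. For large \<open>N\<close>
  an excess of order m / n is harmless: when t is of that order, the polynomial term is already at
  least 1. Conditioning is replaced by symmetry. XORing \<open>a\<close> into all table entries of a
  set \<open>\<Lambda>\<close> is a bijection of the tables; it moves exactly the keys that read an
  odd number of entries of \<open>\<Lambda>\<close>. Averaging over \<open>a\<close> resamples these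
  and freezes the rest. A hash value is thus uniform given the values of other keys as soon as some
  \<open>\<Lambda>\<close> is odd on its key and even on theirs, and by duality that means the key
  is outside their span.\<close>

lemma odd_card_sym_diff:
  assumes "finite A" "finite B"
  shows "odd (card (sym_diff A B)) \<longleftrightarrow> (odd (card A) \<noteq> odd (card B))"
proof -
  have 1: "card (sym_diff A B) = card (A - B) + card (B - A)"
    by (rule card_Un_disjoint) (use assms in auto)
  have 2: "card A = card (A - B) + card (A \<inter> B)"
    using card_Int_Diff[OF assms(1), of B] by simp
  have 3: "card B = card (B - A) + card (A \<inter> B)"
    using card_Int_Diff[OF assms(2), of A] by (simp add: Int_commute)
  show ?thesis unfolding 1 2 3 by auto
qed

lemma odd_card_Int_sym_diff:
  assumes "finite A" "finite B"
  shows "odd (card (\<Lambda> \<inter> sym_diff A B)) \<longleftrightarrow> (odd (card (\<Lambda> \<inter> A)) \<noteq> odd (card (\<Lambda> \<inter> B)))"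
proof -
  have "\<Lambda> \<inter> sym_diff A B = sym_diff (\<Lambda> \<inter> A) (\<Lambda> \<inter> B)" by auto
  then show ?thesis using odd_card_sym_diff[of "\<Lambda> \<inter> A" "\<Lambda> \<inter> B"] assms by simp
qed

lemma odd_card_sym_diff_Int:
  assumes "finite v"
  shows "odd (card (sym_diff A B \<inter> v)) \<longleftrightarrow> (odd (card (A \<inter> v)) \<noteq> odd (card (B \<inter> v)))"
proof -
  have "sym_diff A B \<inter> v = sym_diff (A \<inter> v) (B \<inter> v)" by auto
  then show ?thesis using odd_card_sym_diff[of "A \<inter> v" "B \<inter> v"] assms by simp
qed

text \<open>Finite sets play the role of vectors over the field with two elements, with symmetric
  difference as addition; a set \<open>\<Lambda>\<close> acts as the linear functional sending \<open>v\<close> to the parity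
  of \<open>\<Lambda> \<inter> v\<close>.\<close>

definition xsum :: "('k \<Rightarrow> 'p set) \<Rightarrow> 'k set \<Rightarrow> 'p set" where
  "xsum f D = {p. odd (card {y \<in> D. p \<in> f y})}"

lemma xsum_empty [simp]: "xsum f {} = {}"
  by (simp add: xsum_def)

lemma xsum_insert:
  assumes "finite D" "z \<notin> D"
  shows "xsum f (insert z D) = sym_diff (xsum f D) (f z)"
proof -
  have "{y \<in> insert z D. p \<in> f y} = (if p \<in> f z then insert z {y \<in> D. p \<in> f y} else {y \<in> D. p \<in> f y})"
    for p using assms by auto
  then show ?thesis using assms by (auto simp: xsum_def)
qed

lemma xsum_sym_diff:
  assumes "finite D" "finite E"
  shows "xsum f (sym_diff D E) = sym_diff (xsum f D) (xsum f E)"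
proof -
  have "{y \<in> sym_diff D E. p \<in> f y} = sym_diff {y \<in> D. p \<in> f y} {y \<in> E. p \<in> f y}" for p
    by auto
  then have "odd (card {y \<in> sym_diff D E. p \<in> f y}) \<longleftrightarrow>
      (odd (card {y \<in> D. p \<in> f y}) \<noteq> odd (card {y \<in> E. p \<in> f y}))" for p
    using odd_card_sym_diff[of "{y \<in> D. p \<in> f y}" "{y \<in> E. p \<in> f y}"] assms by simp
  then show ?thesis unfolding xsum_def by auto
qed

lemma finite_xsum:
  assumes "finite D" "\<And>y. y \<in> D \<Longrightarrow> finite (f y)"
  shows "finite (xsum f D)"
proof (rule finite_subset)
  show "xsum f D \<subseteq> \<Union> (f ` D)"
  proof
    fix p assume "p \<in> xsum f D"
    then have "card {y \<in> D. p \<in> f y} \<noteq> 0" by (auto simp: xsum_def intro: odd_pos)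
    then show "p \<in> \<Union> (f ` D)" by (auto simp: card_eq_0_iff)
  qed
qed (use assms in auto)

lemma odd_card_Int_xsum:
  assumes "finite D" "\<And>y. y \<in> D \<Longrightarrow> finite (f y)"
  shows "odd (card (\<Lambda> \<inter> xsum f D)) \<longleftrightarrow> odd (card {y \<in> D. odd (card (\<Lambda> \<inter> f y))})"
  using assms
proof (induction D rule: finite_induct)
  case (insert z D)
  let ?O = "\<lambda>D. {y \<in> D. odd (card (\<Lambda> \<inter> f y))}"
  have eq: "?O (insert z D) = (if odd (card (\<Lambda> \<inter> f z)) then insert z (?O D) else ?O D)"
    by auto
  have "odd (card (?O (insert z D))) \<longleftrightarrow> (odd (card (?O D)) \<noteq> odd (card (\<Lambda> \<inter> f z)))"
    unfolding eq using insert.hyps by auto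
  moreover have "odd (card (\<Lambda> \<inter> xsum f (insert z D))) \<longleftrightarrow>
      (odd (card (\<Lambda> \<inter> xsum f D)) \<noteq> odd (card (\<Lambda> \<inter> f z)))"
    unfolding xsum_insert[OF insert.hyps]
    by (rule odd_card_Int_sym_diff) (use insert in \<open>auto intro: finite_xsum\<close>)
  moreover have "odd (card (\<Lambda> \<inter> xsum f D)) \<longleftrightarrow> odd (card (?O D))"
    using insert by blast
  ultimately show ?case by blast
qed simp

text \<open>Duality of span and annihilator. If the functional found for \<open>Y\<close> is odd on
  the new vector \<open>f z\<close>, the induction hypothesis is used again for \<open>v\<close>
  plus \<open>f z\<close>: either a representation is found and gains \<open>z\<close>, or the
  second functional works alone, or the sum of both functionals does.\<close>

lemma span_or_separated:
  fixes f :: "'k \<Rightarrow> 'p set"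
  assumes "finite Y" "\<And>y. y \<in> Y \<Longrightarrow> finite (f y)" "finite v"
  shows "(\<exists>D\<subseteq>Y. xsum f D = v) \<or>
    (\<exists>\<Lambda>. odd (card (\<Lambda> \<inter> v)) \<and> (\<forall>y\<in>Y. even (card (\<Lambda> \<inter> f y))))"
  using assms
proof (induction Y arbitrary: v rule: finite_induct)
  case empty
  show ?case
  proof (cases "v = {}")
    case False
    then obtain p where "p \<in> v" by auto
    then have "odd (card ({p} \<inter> v))" by simp
    then show ?thesis by blast
  qed simp
next
  case (insert z Y)
  let ?sep = "\<lambda>\<Lambda> v Y. odd (card (\<Lambda> \<inter> v)) \<and> (\<forall>y\<in>Y. even (card (\<Lambda> \<inter> f y)))"
  have fz: "finite (f z)" using insert by auto
  consider D where "D \<subseteq> Y" "xsum f D = v" | \<Lambda> where "?sep \<Lambda> v Y"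
    using insert.IH[of v] insert.prems by blast
  then show ?case
  proof cases
    case 1
    then show ?thesis by blast
  next
    case L1: 2
    show ?thesis
    proof (cases "even (card (\<Lambda> \<inter> f z))")
      case True
      then show ?thesis using L1 by blast
    next
      case oddz: False
      consider D where "D \<subseteq> Y" "xsum f D = sym_diff v (f z)" | \<Lambda>' where "?sep \<Lambda>' (sym_diff v (f z)) Y"
        using insert.IH[of "sym_diff v (f z)"] insert.prems fz by blast
      then show ?thesis
      proof cases
        case 1
        have D: "finite D" "z \<notin> D"
          using finite_subset[OF 1(1) insert.hyps(1)] 1(1) insert.hyps(2) by blast+
        have "xsum f (insert z D) = v" unfolding xsum_insert[OF D] 1(2) by blast
        moreover have "insert z D \<subseteq> insert z Y" using 1(1) by auto
        ultimately show ?thesis by (intro disjI1 exI[of _ "insert z D"] conjI)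
      next
        case L2: 2
        have ne: "odd (card (\<Lambda>' \<inter> v)) \<noteq> odd (card (\<Lambda>' \<inter> f z))"
          by (rule odd_card_Int_sym_diff[OF insert.prems(2) fz, of \<Lambda>', THEN iffD1]) (use L2 in blast)
        show ?thesis
        proof (cases "even (card (\<Lambda>' \<inter> f z))")
          case True
          then show ?thesis using ne L2 by blast
        next
          case False
          have flip: "odd (card (sym_diff \<Lambda> \<Lambda>' \<inter> u)) \<longleftrightarrow> (odd (card (\<Lambda> \<inter> u)) \<noteq> odd (card (\<Lambda>' \<inter> u)))"
            if "finite u" for u
            using that by (rule odd_card_sym_diff_Int)
          have "odd (card (sym_diff \<Lambda> \<Lambda>' \<inter> v))"
            using flip[OF insert.prems(2)] L1 ne False by blast
          moreover have "even (card (sym_diff \<Lambda> \<Lambda>' \<inter> f y))" if "y \<in> insert z Y" for y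
          proof (cases "y = z")
            case True
            then show ?thesis using flip[OF fz] False oddz by blast
          next
            case False
            then have "y \<in> Y" using that by simp
            then show ?thesis using flip[OF insert.prems(1)[OF that]] L1 L2 by blast
          qed
          ultimately show ?thesis by (intro disjI2 exI[of _ "sym_diff \<Lambda> \<Lambda>'"] conjI ballI)
        qed
      qed
    qed
  qed
qed

section \<open>Keys as vectors, and translations of the tables\<close>

lemma xor_nat_less_power:
  fixes a b :: nat
  assumes "a < 2 ^ r" "b < 2 ^ r"
  shows "xor a b < 2 ^ r"
proof -
  have "xor a b = take_bit r (xor a b)"
    using assms by (simp add: take_bit_nat_eq_self)
  also have "\<dots> < 2 ^ r" by (rule take_bit_nat_less_exp)
  finally show ?thesis .
qed

lemma xor_nat_cancel [simp]: "xor a (xor a b) = (b::nat)"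
  by (simp add: xor.assoc[symmetric])

lemma xor_nat_eq_iff: "xor a b = (d::nat) \<longleftrightarrow> b = xor a d"
  by (metis xor_nat_cancel)

text \<open>The set of table entries that a key reads; as a vector over the field with two elements,
  so that sums of keys record which entries are read an odd number of times.\<close>

definition vec :: "nat \<Rightarrow> (nat \<Rightarrow> nat) \<Rightarrow> (nat \<times> nat) set" where
  "vec c x = (\<lambda>i. (i, x i)) ` {0..<c}"

lemma finite_vec [simp]: "finite (vec c x)"
  by (simp add: vec_def)

lemma mem_vec_iff [simp]: "(i, \<alpha>) \<in> vec c x \<longleftrightarrow> i < c \<and> x i = \<alpha>"
  by (auto simp: vec_def)

lemma inj_on_vec: "inj_on (vec c) (tab_keys c s)"
proof (rule inj_onI)
  fix x y assume a: "x \<in> tab_keys c s" "y \<in> tab_keys c s" "vec c x = vec c y"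
  have "x i = y i" if "i < c" for i
  proof -
    have "(i, x i) \<in> vec c y" using that a(3)[symmetric] by simp
    then show ?thesis by simp
  qed
  then show "x = y" using a(1,2) unfolding tab_keys_def by (intro PiE_ext) auto
qed

locale tabulation =
  fixes c s r :: nat
  assumes c_pos: "1 \<le> c"
begin

abbreviation n :: nat where "n \<equiv> 2 ^ r"

abbreviation \<Omega> where "\<Omega> \<equiv> tab_tables c s r"

abbreviation U where "U \<equiv> tab_keys c s"

abbreviation h where "h \<equiv> tab_hash c"

abbreviation par :: "(nat \<times> nat) set \<Rightarrow> (nat \<Rightarrow> nat) \<Rightarrow> bool" where
  "par \<Lambda> x \<equiv> odd (card (\<Lambda> \<inter> vec c x))"

definition E :: "((nat \<Rightarrow> nat \<Rightarrow> nat) \<Rightarrow> real) \<Rightarrow> real" where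
  "E f = (\<Sum>T\<in>\<Omega>. f T) / card \<Omega>"

definition P :: "((nat \<Rightarrow> nat \<Rightarrow> nat) \<Rightarrow> bool) \<Rightarrow> real" where
  "P Q = E (\<lambda>T. of_bool (Q T))"

text \<open>\<open>\<Lambda>\<close> may reach outside the tables, as in \<open>par_all\<close>; the
  restriction keeps the result extensional, hence in \<open>\<Omega>\<close>.\<close>

definition shift :: "nat \<Rightarrow> (nat \<times> nat) set \<Rightarrow> (nat \<Rightarrow> nat \<Rightarrow> nat) \<Rightarrow> nat \<Rightarrow> nat \<Rightarrow> nat" where
  "shift a \<Lambda> T = (\<lambda>i\<in>{0..<c}. \<lambda>\<alpha>\<in>{0..<s}. if (i, \<alpha>) \<in> \<Lambda> then xor a (T i \<alpha>) else T i \<alpha>)"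

lemma finite_tables [simp]: "finite \<Omega>"
  unfolding tab_tables_def by (intro finite_PiE) auto

lemma tables_ne [simp]: "\<Omega> \<noteq> {}"
  by (auto simp: tab_tables_def PiE_eq_empty_iff)

lemma card_tables_pos: "0 < card \<Omega>"
  by (simp add: card_gt_0_iff)

lemma finite_keys [simp]: "finite U"
  unfolding tab_keys_def by (intro finite_PiE) auto

lemma finite_keys_subset: "X \<subseteq> U \<Longrightarrow> finite X"
  by (rule finite_subset) auto

lemma E_const [simp]: "E (\<lambda>_. k) = k"
  using card_tables_pos by (simp add: E_def)

lemma E_mono: "(\<And>T. T \<in> \<Omega> \<Longrightarrow> f T \<le> g T) \<Longrightarrow> E f \<le> E g"
  unfolding E_def by (intro divide_right_mono sum_mono) auto

lemma E_cong: "(\<And>T. T \<in> \<Omega> \<Longrightarrow> f T = g T) \<Longrightarrow> E f = E g"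
  unfolding E_def by simp

lemma E_add: "E (\<lambda>T. f T + g T) = E f + E g"
  by (simp add: E_def sum.distrib add_divide_distrib)

lemma E_diff: "E (\<lambda>T. f T - g T) = E f - E g"
  by (simp add: E_def sum_subtractf diff_divide_distrib)

lemma E_cmult: "E (\<lambda>T. k * f T) = k * E f"
  by (simp add: E_def sum_distrib_left)

lemma E_sum: "E (\<lambda>T. \<Sum>i\<in>I. f i T) = (\<Sum>i\<in>I. E (f i))"
  unfolding E_def by (subst sum.swap) (simp add: sum_divide_distrib)

lemma E_nonneg: "(\<And>T. T \<in> \<Omega> \<Longrightarrow> 0 \<le> f T) \<Longrightarrow> 0 \<le> E f"
  unfolding E_def by (intro divide_nonneg_nonneg sum_nonneg) auto

lemma P_mono: "(\<And>T. T \<in> \<Omega> \<Longrightarrow> Q T \<Longrightarrow> R T) \<Longrightarrow> P Q \<le> P R"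
  unfolding P_def by (intro E_mono) auto

lemma P_cong: "(\<And>T. T \<in> \<Omega> \<Longrightarrow> Q T \<longleftrightarrow> R T) \<Longrightarrow> P Q = P R"
  unfolding P_def by (intro E_cong) auto

lemma P_nonneg: "0 \<le> P Q"
  unfolding P_def by (intro E_nonneg) auto

lemma P_le_1: "P Q \<le> 1"
  using E_mono[of "\<lambda>T. of_bool (Q T)" "\<lambda>_. 1"] by (simp add: P_def)

lemma P_disj: "P (\<lambda>T. Q T \<or> R T) \<le> P Q + P R"
  unfolding P_def E_add[symmetric] by (intro E_mono) auto

lemma P_split: "P Q = P (\<lambda>T. Q T \<and> R T) + P (\<lambda>T. Q T \<and> \<not> R T)"
  unfolding P_def E_add[symmetric] by (intro E_cong) auto

lemma P_bex_le:
  assumes "finite I"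
  shows "P (\<lambda>T. \<exists>i\<in>I. Q i T) \<le> (\<Sum>i\<in>I. P (Q i))"
  unfolding P_def E_sum[symmetric]
proof (rule E_mono)
  fix T
  show "of_bool (\<exists>i\<in>I. Q i T) \<le> (\<Sum>i\<in>I. of_bool (Q i T) :: real)"
  proof (cases "\<exists>i\<in>I. Q i T")
    case True
    then obtain i where i: "i \<in> I" "Q i T" by auto
    have "of_bool (Q i T) \<le> (\<Sum>i\<in>I. of_bool (Q i T) :: real)"
      by (rule member_le_sum) (use i assms in auto)
    then show ?thesis using i True by simp
  qed (simp add: sum_nonneg)
qed

lemma prob_eq_P: "measure_pmf.prob (tab_dist c s r) {T. Q T} = P Q"
  unfolding tab_dist_def
  by (simp add: measure_pmf_of_set P_def E_def sum.If_cases of_bool_def Int_def)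

lemma P_markov:
  assumes "0 < k" "\<And>T. T \<in> \<Omega> \<Longrightarrow> 0 \<le> f T" "\<And>T. T \<in> \<Omega> \<Longrightarrow> Q T \<Longrightarrow> k \<le> f T"
  shows "P Q \<le> E f / k"
proof -
  have "k * P Q \<le> E f"
    unfolding P_def E_cmult[symmetric] by (intro E_mono) (use assms in auto)
  then show ?thesis using assms(1) by (simp add: field_simps)
qed

lemma shift_in_tables:
  assumes "T \<in> \<Omega>" "a < n"
  shows "shift a \<Lambda> T \<in> \<Omega>"
proof -
  have "T i \<alpha> < n" if "i < c" "\<alpha> < s" for i \<alpha>
    using assms(1) that unfolding tab_tables_def by (auto simp: PiE_iff)
  then show ?thesis
    unfolding shift_def tab_tables_def using assms(2)
    by (auto intro!: restrict_PiE_iff[THEN iffD2] xor_nat_less_power)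
qed

lemma shift_shift:
  assumes "T \<in> \<Omega>"
  shows "shift a \<Lambda> (shift a \<Lambda> T) = T"
proof (rule ext, rule ext)
  fix i \<alpha>
  show "shift a \<Lambda> (shift a \<Lambda> T) i \<alpha> = T i \<alpha>"
    using assms unfolding shift_def tab_tables_def
    by (auto simp: restrict_def PiE_iff extensional_def)
qed

lemma bij_betw_shift: "a < n \<Longrightarrow> bij_betw (shift a \<Lambda>) \<Omega> \<Omega>"
  by (rule bij_betw_byWitness[where f' = "shift a \<Lambda>"]) (auto simp: shift_shift shift_in_tables)

lemma E_shift: "a < n \<Longrightarrow> E (\<lambda>T. f (shift a \<Lambda> T)) = E f"
  unfolding E_def using sum.reindex_bij_betw[OF bij_betw_shift, of a f \<Lambda>] by simp

text \<open>Stands in for conditional expectation: for fixed \<open>T\<close>, the inner average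
  applies a uniform translation to the keys on which \<open>\<Lambda>\<close> is odd and leaves all
  others alone.\<close>

lemma E_average: "E f = E (\<lambda>T. (\<Sum>a<n. f (shift a \<Lambda> T)) / n)"
proof -
  have "E (\<lambda>T. (\<Sum>a<n. f (shift a \<Lambda> T)) / n) = (\<Sum>a<n. E (\<lambda>T. f (shift a \<Lambda> T))) / n"
    using E_cmult[of "1 / n" "\<lambda>T. \<Sum>a<n. f (shift a \<Lambda> T)"] by (simp add: E_sum)
  then show ?thesis by (simp add: E_shift)
qed

text \<open>Each entry of \<open>x\<close> lying in \<open>\<Lambda>\<close> contributes one
  \<open>a\<close>, and equal summands cancel in pairs, so only the parity survives.\<close>

lemma hash_shift:
  assumes "x \<in> U"
  shows "h (shift a \<Lambda> T) x = (if par \<Lambda> x then xor a (h T x) else h T x)"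
proof -
  have xs: "x i < s" if "i < c" for i
    using assms that unfolding tab_keys_def by (auto simp: PiE_iff)
  have "foldr (\<lambda>i. xor (shift a \<Lambda> T i (x i))) is 0 =
      (if odd (card {i \<in> set is. (i, x i) \<in> \<Lambda>}) then xor a (foldr (\<lambda>i. xor (T i (x i))) is 0)
       else foldr (\<lambda>i. xor (T i (x i))) is 0)"
    if "distinct is" "set is \<subseteq> {0..<c}" for "is"
    using that
  proof (induction "is")
    case (Cons j js)
    have "{i \<in> set (j # js). (i, x i) \<in> \<Lambda>} =
        (if (j, x j) \<in> \<Lambda> then insert j {i \<in> set js. (i, x i) \<in> \<Lambda>} else {i \<in> set js. (i, x i) \<in> \<Lambda>})"
      by auto
    moreover have "shift a \<Lambda> T j (x j) = (if (j, x j) \<in> \<Lambda> then xor a (T j (x j)) else T j (x j))"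
      using Cons.prems xs[of j] by (simp add: shift_def)
    ultimately show ?case using Cons by (simp add: xor.assoc xor.left_commute[of _ a])
  qed simp
  from this[of "[0..<c]"] have "h (shift a \<Lambda> T) x =
      (if odd (card {i \<in> {0..<c}. (i, x i) \<in> \<Lambda>}) then xor a (h T x) else h T x)"
    by (simp add: tab_hash_def)
  moreover have "card {i \<in> {0..<c}. (i, x i) \<in> \<Lambda>} = card (\<Lambda> \<inter> vec c x)"
    by (rule bij_betw_same_card[where f = "\<lambda>i. (i, x i)"])
      (auto simp: bij_betw_def inj_on_def vec_def)
  ultimately show ?thesis by simp
qed

lemma hash_less:
  assumes "x \<in> U" "T \<in> \<Omega>"
  shows "h T x < n"
proof -
  have "T i (x i) < n" if "i < c" for i
    using assms that unfolding tab_keys_def tab_tables_def by (auto simp: PiE_iff)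
  then have "foldr (\<lambda>i. xor (T i (x i))) is 0 < n" if "set is \<subseteq> {0..<c}" for "is"
    using that by (induction "is") (auto intro: xor_nat_less_power)
  from this[of "[0..<c]"] show ?thesis by (simp add: tab_hash_def)
qed

lemma hash_image_subset: "X \<subseteq> U \<Longrightarrow> T \<in> \<Omega> \<Longrightarrow> h T ` X \<subseteq> {..<n}"
  using hash_less by auto

text \<open>Every key reads exactly one entry at position 0. This functional gives the oddness of
  linear dependencies and the symmetry between bins.\<close>

lemma par_all: "\<exists>\<Lambda>. \<forall>x. par \<Lambda> x"
proof (intro exI allI)
  fix x
  have "{0} \<times> UNIV \<inter> vec c x = {(0, x 0)}" using c_pos by auto
  then show "par ({0} \<times> UNIV) x" by simp
qed

end

section \<open>The martingale\<close>

lemma exp_le_quadratic: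
  fixes x :: real
  assumes "\<bar>x\<bar> \<le> 1"
  shows "exp x \<le> 1 + x + x\<^sup>2"
proof (cases "0 \<le> x")
  case True
  then show ?thesis using assms exp_bound[of x] by simp
next
  case False
  define y where "y = - x"
  have y: "0 \<le> y" using False by (simp add: y_def)
  \<comment> \<open>It suffices that \<open>1 - y + y\<^sup>2\<close> times \<open>exp y\<close> is
    at least 1; the quadratic Taylor bound for \<open>exp y\<close> turns this into a polynomial
    with nonnegative terms.\<close>
  have "1 \<le> 1 + y\<^sup>2 / 2 + y ^ 3 / 2 + y ^ 4 / 2" using y by simp
  also have "\<dots> = (1 - y + y\<^sup>2) * (1 + y + y\<^sup>2 / 2)"
    by (simp add: field_simps power2_eq_square power3_eq_cube power4_eq_xxxx)
  also have "\<dots> \<le> (1 - y + y\<^sup>2) * exp y"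
  proof (rule mult_left_mono)
    show "1 + y + y\<^sup>2 / 2 \<le> exp y" using exp_lower_Taylor_quadratic[OF y] by simp
    have "1 - y + y\<^sup>2 = (1 - y / 2)\<^sup>2 + 3 / 4 * y\<^sup>2" by (simp add: power2_eq_square algebra_simps)
    then show "0 \<le> 1 - y + y\<^sup>2" by simp
  qed
  finally have "exp (- y) \<le> 1 - y + y\<^sup>2" by (simp add: exp_minus field_simps)
  then show ?thesis by (simp add: y_def)
qed

lemma one_minus_power_le:
  fixes u :: real
  assumes "0 \<le> u" "u \<le> 1"
  shows "(1 - u) ^ k \<le> 1 - k * u + (k * u)\<^sup>2"
proof (induction k)
  case (Suc k)
  have "(1 - u) ^ Suc k \<le> (1 - k * u + (k * u)\<^sup>2) * (1 - u)"
    unfolding power_Suc2 using Suc assms by (intro mult_right_mono) auto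
  also have "\<dots> = 1 - Suc k * u + (Suc k * u)\<^sup>2 - ((k + 1) * u\<^sup>2 + k\<^sup>2 * u ^ 3)"
    by (simp add: algebra_simps power2_eq_square power3_eq_cube)
  also have "\<dots> \<le> 1 - Suc k * u + (Suc k * u)\<^sup>2"
  proof -
    have "0 \<le> (k + 1) * u\<^sup>2 + k\<^sup>2 * u ^ 3" using assms by (intro add_nonneg_nonneg mult_nonneg_nonneg) auto
    then show "1 - Suc k * u + (Suc k * u)\<^sup>2 - ((k + 1) * u\<^sup>2 + k\<^sup>2 * u ^ 3) \<le> 1 - Suc k * u + (Suc k * u)\<^sup>2"
      by linarith
  qed
  finally show ?case .
qed simp

text \<open>Every element other than the chosen preimage of its value collides with that preimage,
  which injects the surplus into the ordered colliding pairs.\<close>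

lemma card_le_card_image_plus_collisions:
  assumes "finite G"
  shows "card G \<le> card (f ` G) + card {(x, y). x \<in> G \<and> y \<in> G \<and> x \<noteq> y \<and> f x = f y}"
proof -
  let ?C = "{(x, y). x \<in> G \<and> y \<in> G \<and> x \<noteq> y \<and> f x = f y}"
  let ?rep = "\<lambda>v. inv_into G f v"
  let ?B = "?rep ` f ` G"
  have B: "?B \<subseteq> G" by (auto intro: inv_into_into)
  have "card (G - ?B) \<le> card ?C"
  proof (rule card_inj_on_le[where f = "\<lambda>x. (x, ?rep (f x))"])
    show "inj_on (\<lambda>x. (x, ?rep (f x))) (G - ?B)" by (auto simp: inj_on_def)
    show "(\<lambda>x. (x, ?rep (f x))) ` (G - ?B) \<subseteq> ?C"
      by (auto simp: f_inv_into_f intro: inv_into_into)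
    show "finite ?C" by (rule finite_subset[of _ "G \<times> G"]) (use assms in auto)
  qed
  moreover have "card ?B \<le> card (f ` G)" using assms by (intro card_image_le) auto
  moreover have "card G = card ?B + card (G - ?B)"
    using card_Diff_subset[OF finite_subset[OF B assms] B] card_mono[OF assms B] by simp
  ultimately show ?thesis by linarith
qed

text \<open>Pigeonhole: if every nonempty group exceeded this size, each projection of
  \<open>X\<close> would have fewer than \<open>m powr (1 / c)\<close> values, yet \<open>X\<close>
  lies in the product of its \<open>c\<close> projections. This is the origin of the exponent
  \<open>1 - 1 / c\<close>.\<close>

lemma exists_small_group:
  assumes "1 \<le> c" "X \<subseteq> tab_keys c s" "X \<noteq> {}"
  shows "\<exists>i<c. \<exists>\<alpha>. {x \<in> X. x i = \<alpha>} \<noteq> {} \<and>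
    card {x \<in> X. x i = \<alpha>} \<le> real (card X) powr (1 - 1 / real c)"
proof (rule ccontr)
  assume neg: "\<not> ?thesis"
  have finU: "finite (tab_keys c s)" unfolding tab_keys_def by (intro finite_PiE) auto
  have fin: "finite X" using assms(2) finU finite_subset by blast
  define m where "m = real (card X)"
  have m: "0 < m" using assms(3) fin by (simp add: m_def card_gt_0_iff)
  define V where "V i = (\<lambda>x. x i) ` X" for i :: nat
  have Vfin: "finite (V i)" for i using fin by (simp add: V_def)
  have Vlt: "real (card (V i)) < m powr (1 / c)" if "i < c" for i
  proof -
    have "card X = (\<Sum>\<alpha>\<in>V i. card {x \<in> X. x i = \<alpha>})"
      using sum.group[OF fin Vfin, of "\<lambda>x. x i" i "\<lambda>_. 1::nat"]
      by (simp add: V_def)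
    then have "m = (\<Sum>\<alpha>\<in>V i. real (card {x \<in> X. x i = \<alpha>}))" unfolding m_def by simp
    also have "\<dots> > (\<Sum>\<alpha>\<in>V i. m powr (1 - 1 / c))"
    proof (rule sum_strict_mono)
      show "finite (V i)" "V i \<noteq> {}" using Vfin assms(3) by (auto simp: V_def)
      fix \<alpha> assume "\<alpha> \<in> V i"
      then have "{x \<in> X. x i = \<alpha>} \<noteq> {}" by (auto simp: V_def)
      then show "m powr (1 - 1 / c) < real (card {x \<in> X. x i = \<alpha>})"
        using neg that unfolding m_def by (meson linorder_not_le)
    qed
    finally have "card (V i) * m powr (1 - 1 / c) < m" by simp
    also have "m = m powr (1 / c) * m powr (1 - 1 / c)" using m by (simp add: powr_add[symmetric])
    finally show ?thesis using m by simp
  qed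
  have "X \<subseteq> PiE {0..<c} V"
    using assms(2) by (auto simp: tab_keys_def V_def PiE_iff)
  then have "card X \<le> card (PiE {0..<c} V)" by (rule card_mono[rotated]) (auto intro: finite_PiE Vfin)
  also have "\<dots> = (\<Prod>i<c. card (V i))" by (simp add: card_PiE atLeast0LessThan)
  finally have "m \<le> (\<Prod>i<c. real (card (V i)))" unfolding m_def by (simp flip: of_nat_prod)
  also have "\<dots> < (\<Prod>i<c. m powr (1 / c))"
    by (rule prod_mono_strict[of 0]) (use Vlt assms(1) m in \<open>auto intro: less_imp_le\<close>)
  also have "\<dots> = m" using m assms(1) by (simp add: powr_realpow[symmetric] powr_powr)
  finally show False by simp
qed

section \<open>Overlap of a fixed set with a random translate\<close>

lemma card_xor_image_Int:
  fixes H A :: "nat set"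
  assumes "finite H" "finite A"
  shows "real (card (xor a ` H \<inter> A)) = (\<Sum>u\<in>H. \<Sum>v\<in>A. of_bool (a = xor u v))"
proof -
  have "xor a ` H \<inter> A = xor a ` {u \<in> H. xor a u \<in> A}" by auto
  moreover have "inj_on (xor a) {u \<in> H. xor a u \<in> A}" by (auto simp: inj_on_def xor_nat_eq_iff)
  ultimately have "real (card (xor a ` H \<inter> A)) = real (card {u \<in> H. xor a u \<in> A})"
    by (simp add: card_image)
  also have "\<dots> = (\<Sum>u\<in>H. of_bool (xor a u \<in> A))"
    using assms by (simp add: of_bool_def sum.If_cases Int_def)
  also have "\<dots> = (\<Sum>u\<in>H. \<Sum>v\<in>A. of_bool (a = xor u v))"
  proof (rule sum.cong[OF refl])
    fix u
    have "(a = xor u v) = (xor a u = v)" for v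
      by (metis xor_nat_cancel xor.commute)
    then show "of_bool (xor a u \<in> A) = (\<Sum>v\<in>A. of_bool (a = xor u v) :: real)"
      using assms by (simp add: of_bool_def)
  qed
  finally show ?thesis .
qed

text \<open>Double counting: each pair of a point of \<open>H\<close> and a point of
  \<open>A\<close> is matched by exactly one translation.\<close>

lemma sum_card_xor_image_Int:
  fixes H A :: "nat set"
  assumes "H \<subseteq> {..<2 ^ r}" "A \<subseteq> {..<2 ^ r}"
  shows "(\<Sum>a<2 ^ r. real (card (xor a ` H \<inter> A))) = card H * card A"
proof -
  have fin: "finite H" "finite A" using assms finite_subset by auto
  have "(\<Sum>a<2 ^ r. real (card (xor a ` H \<inter> A))) =
      (\<Sum>u\<in>H. \<Sum>v\<in>A. \<Sum>a<2 ^ r. of_bool (a = xor u v))"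
    unfolding card_xor_image_Int[OF fin]
    by (subst sum.swap, rule sum.cong[OF refl], subst sum.swap, rule refl)
  also have "\<dots> = (\<Sum>u\<in>H. \<Sum>v\<in>A. 1)"
  proof (intro sum.cong refl)
    fix u v assume "u \<in> H" "v \<in> A"
    then have "xor u v < 2 ^ r" using assms by (intro xor_nat_less_power) auto
    then show "(\<Sum>a<2 ^ r. of_bool (a = xor u v)) = (1::real)"
      by (simp add: of_bool_def)
  qed
  finally show ?thesis by simp
qed

context
  fixes H A :: "nat set" and r m k :: nat and d :: "nat \<Rightarrow> real"
  assumes H: "H \<subseteq> {..<2 ^ r}" "card H \<le> k" and A: "A \<subseteq> {..<2 ^ r}" "card A \<le> m"
  defines "d \<equiv> \<lambda>a. card H * card A / 2 ^ r - card (xor a ` H \<inter> A)"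
begin

lemma card_Int_le: "card (xor a ` H \<inter> A) \<le> card H"
proof -
  have "finite H" using H finite_subset by auto
  then have "card (xor a ` H \<inter> A) \<le> card (xor a ` H)" by (intro card_mono) auto
  also have "\<dots> \<le> card H" by (rule card_image_le) fact
  finally show ?thesis .
qed

lemma sum_shift_deviation: "(\<Sum>a<2 ^ r. d a) = 0"
  unfolding d_def sum_subtractf sum_card_xor_image_Int[OF H(1) A(1)] by simp

lemma abs_shift_deviation_le: "\<bar>d a\<bar> \<le> k"
proof -
  have "card A \<le> 2 ^ r" using card_mono[OF _ A(1)] by simp
  then have "real (card A) / 2 ^ r \<le> 1" by simp
  then have "card H * (card A / 2 ^ r) \<le> real (card H) * 1" by (intro mult_left_mono) auto
  then have "card H * card A / 2 ^ r \<le> real (card H)" by simp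
  moreover have "0 \<le> card H * card A / (2 ^ r :: real)" by simp
  moreover have "real (card (xor a ` H \<inter> A)) \<le> card H" using card_Int_le by simp
  ultimately show ?thesis unfolding d_def using H(2) by linarith
qed

text \<open>The squared mean is dropped, one factor of the squared overlap is bounded by
  \<open>card H\<close>, and the other is summed exactly. This gains a factor of up to
  \<open>m / 2 ^ r\<close> over what the uniform bound \<open>k\<close> would give.\<close>

lemma sum_square_shift_deviation_le: "(\<Sum>a<2 ^ r. (d a)\<^sup>2) \<le> k\<^sup>2 * m"
proof -
  let ?I = "\<lambda>a. real (card (xor a ` H \<inter> A))" and ?e = "card H * card A / (2 ^ r :: real)"
  have "(\<Sum>a<2 ^ r. (d a)\<^sup>2) = (\<Sum>a<2 ^ r. ?e\<^sup>2 - 2 * ?e * ?I a + (?I a)\<^sup>2)"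
    unfolding d_def by (simp add: power2_diff algebra_simps)
  also have "\<dots> = 2 ^ r * ?e\<^sup>2 - 2 * ?e * (card H * card A) + (\<Sum>a<2 ^ r. (?I a)\<^sup>2)"
    unfolding sum.distrib sum_subtractf sum_distrib_left[symmetric]
      sum_card_xor_image_Int[OF H(1) A(1)] by simp
  also have "2 ^ r * ?e\<^sup>2 - 2 * ?e * (card H * card A) = - (2 ^ r * ?e\<^sup>2)"
    by (simp add: field_simps power2_eq_square)
  also have "- (2 ^ r * ?e\<^sup>2) + (\<Sum>a<2 ^ r. (?I a)\<^sup>2) \<le> (\<Sum>a<2 ^ r. (?I a)\<^sup>2)" by simp
  also have "\<dots> \<le> (\<Sum>a<2 ^ r. card H * ?I a)"
    unfolding power2_eq_square by (intro sum_mono mult_right_mono) (use card_Int_le in auto)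
  also have "\<dots> = card H * (real (card H) * card A)"
    unfolding sum_distrib_left[symmetric] sum_card_xor_image_Int[OF H(1) A(1)] by simp
  also have "\<dots> \<le> k * (real k * m)"
    using H(2) A(2) by (intro mult_mono) auto
  finally show ?thesis by (simp add: power2_eq_square)
qed

lemma sum_exp_shift_deviation_le:
  fixes l :: real
  assumes "\<bar>l\<bar> * k \<le> 1"
  shows "(\<Sum>a<2 ^ r. exp (l * d a)) / 2 ^ r \<le> exp (l\<^sup>2 * (k\<^sup>2 * m / 2 ^ r))"
proof -
  have "(\<Sum>a<2 ^ r. exp (l * d a)) \<le> (\<Sum>a<2 ^ r. 1 + l * d a + l\<^sup>2 * (d a)\<^sup>2)"
  proof (rule sum_mono)
    fix a
    have "\<bar>l * d a\<bar> \<le> \<bar>l\<bar> * k"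
      unfolding abs_mult by (intro mult_left_mono abs_shift_deviation_le) auto
    then have "\<bar>l * d a\<bar> \<le> 1" using assms by simp
    from exp_le_quadratic[OF this] show "exp (l * d a) \<le> 1 + l * d a + l\<^sup>2 * (d a)\<^sup>2"
      by (simp add: power_mult_distrib)
  qed
  also have "\<dots> = 2 ^ r + l\<^sup>2 * (\<Sum>a<2 ^ r. (d a)\<^sup>2)"
    unfolding sum.distrib sum_distrib_left[symmetric] sum_shift_deviation by simp
  also have "\<dots> \<le> 2 ^ r + l\<^sup>2 * (k\<^sup>2 * m)"
    using sum_square_shift_deviation_le by (intro add_left_mono mult_left_mono) auto
  finally have "(\<Sum>a<2 ^ r. exp (l * d a)) / 2 ^ r \<le> (2 ^ r + l\<^sup>2 * (k\<^sup>2 * m)) / 2 ^ r"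
    by (intro divide_right_mono) auto
  also have "\<dots> = 1 + l\<^sup>2 * (k\<^sup>2 * m / 2 ^ r)" by (simp add: field_simps)
  also have "\<dots> \<le> exp (l\<^sup>2 * (k\<^sup>2 * m / 2 ^ r))" by (rule exp_ge_add_one_self)
  finally show ?thesis .
qed

end

section \<open>Assembling the groups into a martingale\<close>

context tabulation
begin

definition empty_bins :: "(nat \<Rightarrow> nat) set \<Rightarrow> (nat \<Rightarrow> nat \<Rightarrow> nat) \<Rightarrow> real" where
  "empty_bins X T = real n - card (h T ` X)"

definition collisions :: "((nat \<Rightarrow> nat) \<times> (nat \<Rightarrow> nat)) set \<Rightarrow> (nat \<Rightarrow> nat \<Rightarrow> nat) \<Rightarrow> real" where
  "collisions R T = card {(x, y). (x, y) \<in> R \<and> h T x = h T y}"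

lemma hash_shift_image_fixed:
  assumes "X \<subseteq> U" "\<And>x. x \<in> X \<Longrightarrow> \<not> par \<Lambda> x"
  shows "h (shift a \<Lambda> T) ` X = h T ` X"
  using assms by (auto simp: hash_shift subset_iff image_iff)

lemma hash_shift_image_moved:
  assumes "X \<subseteq> U" "\<And>x. x \<in> X \<Longrightarrow> par \<Lambda> x"
  shows "h (shift a \<Lambda> T) ` X = xor a ` (h T ` X)"
  unfolding image_image using assms by (auto simp: hash_shift subset_iff image_iff)

text \<open>\<open>S\<close> is the terminal value of the martingale and \<open>R\<close> the set of pairs inside a group.\<close>

definition decomposition :: "real \<Rightarrow> nat \<Rightarrow> (nat \<Rightarrow> nat) set \<Rightarrow> real \<Rightarrow> ((nat \<Rightarrow> nat \<Rightarrow> nat) \<Rightarrow> real)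
    \<Rightarrow> ((nat \<Rightarrow> nat) \<times> (nat \<Rightarrow> nat)) set \<Rightarrow> bool" where
  "decomposition M m X L S R \<longleftrightarrow>
    R \<subseteq> {(x, y). x \<in> X \<and> y \<in> X \<and> x \<noteq> y} \<and> card R \<le> M * card X \<and>
    L \<le> n * (1 - 1 / n) ^ card X \<and> n * (1 - 1 / n) ^ card X - M * card X / n \<le> L \<and>
    (\<forall>T\<in>\<Omega>. L - S T \<le> empty_bins X T \<and> empty_bins X T \<le> L + collisions R T - S T) \<and>
    (\<forall>l. \<bar>l\<bar> * M \<le> 1 \<longrightarrow> E (\<lambda>T. exp (l * S T)) \<le> exp (l\<^sup>2 * (M * card X * m / n))) \<and>
    E (\<lambda>T. (S T)\<^sup>2) \<le> M * card X * m / n \<and>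
    (\<forall>a \<Lambda>. \<forall>T\<in>\<Omega>. (\<forall>x\<in>X. \<not> par \<Lambda> x) \<longrightarrow> S (shift a \<Lambda> T) = S T)" for M :: real

text \<open>The group \<open>G\<close> peeled off is the last one, so the entry it shares is unread
  by the remaining keys \<open>Z\<close>. The parameter \<open>m\<close> is separate from
  \<open>card X\<close> so that increments have uniform bounds while \<open>X\<close> shrinks. The
  last clause of \<open>decomposition\<close>, invariance of \<open>S\<close> under shifts that are
  even on \<open>X\<close>, lets the shift for \<open>G\<close> act on the new increment
  alone.\<close>

lemma martingale_decomposition:
  fixes M :: real and m :: nat
  assumes "X \<subseteq> U" "card X \<le> m" "m \<le> n" "real m powr (1 - 1 / real c) \<le> M"
  shows "\<exists>L S R. decomposition M m X L S R"
  using assms(1,2)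
proof (induction "card X" arbitrary: X rule: less_induct)
  case less
  have finX: "finite X" by (rule finite_keys_subset) fact
  have M0: "0 \<le> M" using assms(4) powr_ge_zero order_trans by blast
  show ?case
  proof (cases "X = {}")
    case True
    then show ?thesis
      by (intro exI[of _ "real n"] exI[of _ "\<lambda>_. 0"] exI[of _ "{}"])
        (simp add: decomposition_def empty_bins_def collisions_def)
  next
    case False
    obtain i \<alpha> where i: "i < c" and ne: "{x \<in> X. x i = \<alpha>} \<noteq> {}"
      and small: "card {x \<in> X. x i = \<alpha>} \<le> real (card X) powr (1 - 1 / real c)"
      using exists_small_group[OF c_pos less.prems(1) False] by blast
    define G where "G = {x \<in> X. x i = \<alpha>}"
    define Z where "Z = X - G"
    define \<Lambda>0 where "\<Lambda>0 = {(i, \<alpha>)}"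
    have G: "G \<subseteq> X" "finite G" "G \<noteq> {}" and Z: "Z \<subseteq> X" "finite Z"
      using ne finX by (auto simp: G_def Z_def)
    have XGZ: "X = Z \<union> G" "Z \<inter> G = {}" by (auto simp: Z_def G_def)
    have cardX: "card X = card Z + card G"
      unfolding XGZ(1) using card_Un_disjoint[OF Z(2) G(2) XGZ(2)] .
    have parG: "par \<Lambda>0 x" if "x \<in> G" for x
      using that i by (simp add: \<Lambda>0_def G_def)
    have parZ: "\<not> par \<Lambda>0 x" if "x \<in> Z" for x
      using that by (simp add: \<Lambda>0_def Z_def G_def)
    have GM: "real (card G) \<le> M"
    proof -
      have "real (card G) \<le> real (card X) powr (1 - 1 / real c)" using small by (simp add: G_def)
      also have "\<dots> \<le> real m powr (1 - 1 / real c)"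
        using less.prems(2) c_pos by (intro powr_mono2) auto
      finally show ?thesis using assms(4) by simp
    qed
    have ZU: "Z \<subseteq> U" and GU: "G \<subseteq> U" using Z G less.prems by auto
    have "card Z < card X" using cardX G by (simp add: card_gt_0_iff)
    note IH = less.hyps[OF this ZU]
    have "card Z \<le> m" using cardX less.prems(2) by simp
    from IH[OF this] obtain L S R where dec: "decomposition M m Z L S R" by blast
    have R: "R \<subseteq> {(x, y). x \<in> Z \<and> y \<in> Z \<and> x \<noteq> y}" "card R \<le> M * card Z"
      and L: "L \<le> n * (1 - 1 / n) ^ card Z" "n * (1 - 1 / n) ^ card Z - M * card Z / n \<le> L"
      and sq: "E (\<lambda>T. (S T)\<^sup>2) \<le> M * card Z * m / n"
      using dec unfolding decomposition_def by blast+
    have N: "L - S T \<le> empty_bins Z T" "empty_bins Z T \<le> L + collisions R T - S T"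
      if "T \<in> \<Omega>" for T
      using dec that unfolding decomposition_def by blast+
    have mgf: "E (\<lambda>T. exp (l * S T)) \<le> exp (l\<^sup>2 * (M * card Z * m / n))" if "\<bar>l\<bar> * M \<le> 1" for l
      using dec that unfolding decomposition_def by blast
    have inv: "S (shift a \<Lambda> T) = S T" if "T \<in> \<Omega>" "\<forall>x\<in>Z. \<not> par \<Lambda> x" for a \<Lambda> T
      using dec that unfolding decomposition_def by blast
    \<comment> \<open>The expected proportion of empty bins that stay empty if the keys of
      \<open>G\<close> get distinct values.\<close>
    define \<theta> where "\<theta> = 1 - card G / real n"
    have Gn: "card G \<le> n" using cardX less.prems(2) assms(3) by linarith
    have \<theta>: "0 \<le> \<theta>" "\<theta> \<le> 1" using Gn by (simp_all add: \<theta>_def)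
    \<comment> \<open>The martingale increment: expected minus actual overlap of the new group with
      the occupied bins.\<close>
    define D where "D T = card (h T ` G) * card (h T ` Z) / real n - card (h T ` G \<inter> h T ` Z)" for T
    define S' where "S' T = S T * \<theta> + D T" for T
    define R' where "R' = R \<union> {(x, y). x \<in> G \<and> y \<in> G \<and> x \<noteq> y}"
    let ?GG = "{(x, y). x \<in> G \<and> y \<in> G \<and> x \<noteq> y}"
    have finR: "finite R" by (rule finite_subset[of _ "Z \<times> Z"]) (use R Z in auto)
    have finGG: "finite ?GG" by (rule finite_subset[of _ "G \<times> G"]) (use G in auto)
    have disj: "R \<inter> ?GG = {}" using R XGZ by auto
    have bounds: "L * \<theta> - S' T \<le> empty_bins X T \<and> empty_bins X T \<le> L * \<theta> + collisions R' T - S' T"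
      if T: "T \<in> \<Omega>" for T
    proof -
      let ?g = "real (card (h T ` G))"
      have "card (h T ` X) + card (h T ` G \<inter> h T ` Z) = card (h T ` G) + card (h T ` Z)"
        unfolding XGZ(1) image_Un using card_Un_Int[of "h T ` G" "h T ` Z"] G Z
        by (simp add: Un_commute)
      then have "real (card (h T ` X)) = ?g + card (h T ` Z) - card (h T ` G \<inter> h T ` Z)"
        by linarith
      moreover have "empty_bins Z T * (1 - ?g / n) - D T =
          n - (?g + card (h T ` Z) - card (h T ` G \<inter> h T ` Z))"
        by (simp add: empty_bins_def D_def field_simps)
      \<comment> \<open>Exact recursion by inclusion-exclusion. It contains the random image size of
        \<open>G\<close>; replacing this by \<open>card G\<close> makes the factor deterministic and
        can only lower the result.\<close>
      ultimately have step: "empty_bins X T = empty_bins Z T * (1 - ?g / n) - D T"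
        by (simp add: empty_bins_def)
      have gG: "?g \<le> card G" using G card_image_le by auto
      have Zn: "card (h T ` Z) \<le> n"
        using card_mono[OF _ hash_image_subset[OF ZU T]] by simp
      have N0: "0 \<le> empty_bins Z T" "empty_bins Z T \<le> n"
        using Zn unfolding empty_bins_def by (simp_all add: of_nat_le_iff[symmetric] del: of_nat_le_iff)
      have pairs: "collisions R' T = collisions R T + card {(x, y). x \<in> G \<and> y \<in> G \<and> x \<noteq> y \<and> h T x = h T y}"
      proof -
        have "{(x, y). (x, y) \<in> R' \<and> h T x = h T y} = {(x, y). (x, y) \<in> R \<and> h T x = h T y} \<union>
            {(x, y). x \<in> G \<and> y \<in> G \<and> x \<noteq> y \<and> h T x = h T y}"
          by (auto simp: R'_def)
        moreover have "finite {(x, y). (x, y) \<in> R \<and> h T x = h T y}"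
          by (rule finite_subset[OF _ finR]) auto
        moreover have "finite {(x, y). x \<in> G \<and> y \<in> G \<and> x \<noteq> y \<and> h T x = h T y}"
          by (rule finite_subset[OF _ finGG]) auto
        moreover have "{(x, y). (x, y) \<in> R \<and> h T x = h T y} \<inter>
            {(x, y). x \<in> G \<and> y \<in> G \<and> x \<noteq> y \<and> h T x = h T y} = {}"
          using disj by auto
        ultimately show ?thesis unfolding collisions_def by (simp add: card_Un_disjoint)
      qed
      \<comment> \<open>The price of that replacement in the upper bound: each value lost inside
        \<open>G\<close> is charged to a colliding pair of \<open>R'\<close>.\<close>
      have lost: "card G - ?g \<le> card {(x, y). x \<in> G \<and> y \<in> G \<and> x \<noteq> y \<and> h T x = h T y}"
        using card_le_card_image_plus_collisions[OF G(2), of "h T"] by linarith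
      have "(L - S T) * \<theta> \<le> empty_bins Z T * \<theta>" using N(1)[OF T] \<theta> by (intro mult_right_mono)
      also have "\<dots> \<le> empty_bins Z T * (1 - ?g / n)"
        using N0 gG unfolding \<theta>_def by (intro mult_left_mono) (auto intro: divide_right_mono)
      finally have low: "L * \<theta> - S' T \<le> empty_bins X T"
        unfolding step S'_def by (simp add: algebra_simps)
      have "empty_bins Z T * (1 - ?g / n) = empty_bins Z T * \<theta> + empty_bins Z T / n * (card G - ?g)"
        by (simp add: \<theta>_def field_simps)
      also have "empty_bins Z T * \<theta> \<le> (L + collisions R T - S T) * \<theta>"
        using N(2)[OF T] \<theta> by (intro mult_right_mono)
      also have "empty_bins Z T / n * (card G - ?g) \<le> 1 * (card G - ?g)"
        using N0 gG by (intro mult_right_mono) auto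
      also have "(L + collisions R T - S T) * \<theta> = L * \<theta> + collisions R T * \<theta> - S T * \<theta>"
        by (simp add: algebra_simps)
      also have "collisions R T * \<theta> \<le> collisions R T"
        using \<theta> mult_left_le[of \<theta> "collisions R T"] by (simp add: collisions_def)
      finally have "empty_bins X T \<le> L * \<theta> + collisions R' T - S' T"
        unfolding step S'_def pairs using lost by simp
      then show ?thesis using low by simp
    qed
    \<comment> \<open>Only the image of \<open>G\<close> is translated, so averaging over
      \<open>a\<close> leaves \<open>S T\<close> fixed and centers the increment.\<close>
    have S'shift: "S' (shift a \<Lambda>0 T) = S T * \<theta> +
        (card (h T ` G) * card (h T ` Z) / real n - card (xor a ` (h T ` G) \<inter> h T ` Z))"
      if "T \<in> \<Omega>" for a T
    proof -
      have "h (shift a \<Lambda>0 T) ` Z = h T ` Z" by (rule hash_shift_image_fixed) (use ZU parZ in auto)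
      moreover have "h (shift a \<Lambda>0 T) ` G = xor a ` (h T ` G)"
        by (rule hash_shift_image_moved) (use GU parG in auto)
      moreover have "card (xor a ` (h T ` G)) = card (h T ` G)"
        by (intro card_image) (auto simp: inj_on_def xor_nat_eq_iff)
      moreover have "S (shift a \<Lambda>0 T) = S T" using inv[OF that] parZ by auto
      ultimately show ?thesis by (simp add: S'_def D_def)
    qed
    have HA: "h T ` G \<subseteq> {..<2 ^ r}" "card (h T ` G) \<le> card G"
      "h T ` Z \<subseteq> {..<2 ^ r}" "card (h T ` Z) \<le> m" if "T \<in> \<Omega>" for T
      using hash_image_subset[OF GU that] hash_image_subset[OF ZU that] card_image_le[OF G(2), of "h T"]
        card_image_le[OF Z(2), of "h T"] cardX less.prems(2) by auto
    \<comment> \<open>Since \<open>card G \<le> M\<close>, the variance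
      \<open>(card G)\<^sup>2 * m / n\<close> of one increment is at most
      \<open>M * card G * m / n\<close>, which adds up over disjoint groups.\<close>
    have var_step: "M * card Z * m / n + (card G)\<^sup>2 * m / n \<le> M * card X * m / n"
    proof -
      have "real (card G) * card G \<le> M * card G" using GM by (intro mult_right_mono) auto
      then have "M * card Z + real (card G) * card G \<le> M * card X"
        unfolding cardX by (simp add: algebra_simps)
      then have "(M * card Z + real (card G) * card G) * m / n \<le> M * card X * m / n"
        by (intro divide_right_mono mult_right_mono) auto
      then show ?thesis by (simp add: algebra_simps power2_eq_square add_divide_distrib)
    qed
    have mgf': "E (\<lambda>T. exp (l * S' T)) \<le> exp (l\<^sup>2 * (M * card X * m / n))" if l: "\<bar>l\<bar> * M \<le> 1" for l
    proof -
      let ?v = "(card G)\<^sup>2 * m / 2 ^ r :: real"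
      have lG: "\<bar>l\<bar> * card G \<le> 1" using l mult_left_mono[OF GM, of "\<bar>l\<bar>"] by simp
      have "E (\<lambda>T. exp (l * S' T)) = E (\<lambda>T. (\<Sum>a<n. exp (l * S' (shift a \<Lambda>0 T))) / n)"
        by (rule E_average)
      also have "\<dots> \<le> E (\<lambda>T. exp (l\<^sup>2 * ?v) * exp (l * \<theta> * S T))"
      proof (rule E_mono)
        fix T assume T: "T \<in> \<Omega>"
        have "(\<Sum>a<n. exp (l * S' (shift a \<Lambda>0 T))) / n = exp (l * \<theta> * S T) *
          ((\<Sum>a<n. exp (l * (card (h T ` G) * card (h T ` Z) / 2 ^ r
              - card (xor a ` (h T ` G) \<inter> h T ` Z)))) / 2 ^ r)"
          by (simp add: S'shift[OF T] distrib_left exp_add sum_distrib_left mult_ac)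
        also have "\<dots> \<le> exp (l * \<theta> * S T) * exp (l\<^sup>2 * ?v)"
          by (intro mult_left_mono sum_exp_shift_deviation_le[OF HA[OF T] lG]) auto
        finally show "(\<Sum>a<n. exp (l * S' (shift a \<Lambda>0 T))) / n \<le> exp (l\<^sup>2 * ?v) * exp (l * \<theta> * S T)"
          by (simp add: mult.commute)
      qed
      also have "\<dots> = exp (l\<^sup>2 * ?v) * E (\<lambda>T. exp (l * \<theta> * S T))" by (rule E_cmult)
      also have "\<dots> \<le> exp (l\<^sup>2 * ?v) * exp (l\<^sup>2 * (M * card Z * m / n))"
      proof (rule mult_left_mono)
        \<comment> \<open>Rescaling by \<open>\<theta>\<close> can only shrink the parameter, so it
          stays admissible for the induction hypothesis.\<close>
        have l\<theta>: "\<bar>l * \<theta>\<bar> \<le> \<bar>l\<bar>" using \<theta> by (simp add: abs_mult mult_left_le)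
        then have "\<bar>l * \<theta>\<bar> * M \<le> 1" using l mult_right_mono[OF l\<theta> M0] by linarith
        then have "E (\<lambda>T. exp (l * \<theta> * S T)) \<le> exp ((l * \<theta>)\<^sup>2 * (M * card Z * m / n))" by (rule mgf)
        also have "(l * \<theta>)\<^sup>2 \<le> l\<^sup>2" using l\<theta> by (simp add: abs_le_square_iff)
        then have "exp ((l * \<theta>)\<^sup>2 * (M * card Z * m / n)) \<le> exp (l\<^sup>2 * (M * card Z * m / n))"
          using M0 by (simp add: mult_right_mono divide_right_mono)
        finally show "E (\<lambda>T. exp (l * \<theta> * S T)) \<le> exp (l\<^sup>2 * (M * card Z * m / n))" .
      qed simp
      also have "\<dots> = exp (l\<^sup>2 * (M * card Z * m / n + (card G)\<^sup>2 * m / n))"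
        by (simp add: exp_add[symmetric] algebra_simps)
      also have "\<dots> \<le> exp (l\<^sup>2 * (M * card X * m / n))"
        using mult_left_mono[OF var_step, of "l\<^sup>2"] by simp
      finally show ?thesis .
    qed
    have sq': "E (\<lambda>T. (S' T)\<^sup>2) \<le> M * card X * m / n"
    proof -
      have "E (\<lambda>T. (S' T)\<^sup>2) = E (\<lambda>T. (\<Sum>a<n. (S' (shift a \<Lambda>0 T))\<^sup>2) / n)" by (rule E_average)
      also have "\<dots> \<le> E (\<lambda>T. (S T)\<^sup>2 + (card G)\<^sup>2 * m / n)"
      proof (rule E_mono)
        fix T assume T: "T \<in> \<Omega>"
        let ?d = "\<lambda>a. card (h T ` G) * card (h T ` Z) / 2 ^ r - card (xor a ` (h T ` G) \<inter> h T ` Z)"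
        have "(\<Sum>a<n. (S' (shift a \<Lambda>0 T))\<^sup>2) = (\<Sum>a<n. (S T * \<theta>)\<^sup>2 + 2 * (S T * \<theta>) * ?d a + (?d a)\<^sup>2)"
          by (rule sum.cong) (simp_all add: S'shift[OF T] power2_sum)
        also have "\<dots> = n * (S T * \<theta>)\<^sup>2 + 2 * (S T * \<theta>) * (\<Sum>a<n. ?d a) + (\<Sum>a<n. (?d a)\<^sup>2)"
          unfolding sum.distrib sum_distrib_left[symmetric] by simp
        also have "\<dots> \<le> n * (S T)\<^sup>2 + (card G)\<^sup>2 * m"
        proof -
          have "(S T * \<theta>)\<^sup>2 \<le> (S T)\<^sup>2"
            using \<theta> by (simp add: abs_le_square_iff[symmetric] abs_mult mult_left_le)
          then have "n * (S T * \<theta>)\<^sup>2 \<le> n * (S T)\<^sup>2" by (intro mult_left_mono) auto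
          moreover have "(\<Sum>a<n. (?d a)\<^sup>2) \<le> (card G)\<^sup>2 * m"
            using sum_square_shift_deviation_le[OF HA[OF T]] .
          ultimately show ?thesis unfolding sum_shift_deviation[OF HA[OF T]] by linarith
        qed
        finally have "(\<Sum>a<n. (S' (shift a \<Lambda>0 T))\<^sup>2) / n \<le> (n * (S T)\<^sup>2 + (card G)\<^sup>2 * m) / n"
          by (intro divide_right_mono) auto
        then show "(\<Sum>a<n. (S' (shift a \<Lambda>0 T))\<^sup>2) / n \<le> (S T)\<^sup>2 + (card G)\<^sup>2 * m / n"
          by (simp add: add_divide_distrib)
      qed
      also have "\<dots> = E (\<lambda>T. (S T)\<^sup>2) + (card G)\<^sup>2 * m / n" by (simp add: E_add)
      finally show ?thesis using sq var_step by linarith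
    qed
    have R'sub: "R' \<subseteq> {(x, y). x \<in> X \<and> y \<in> X \<and> x \<noteq> y}" using R Z G by (auto simp: R'_def)
    have R'card: "card R' \<le> M * card X"
    proof -
      have "card ?GG \<le> card (G \<times> G)" by (rule card_mono) (use G in auto)
      then have "real (card ?GG) \<le> card G * card G"
        by (simp add: card_cartesian_product flip: of_nat_mult)
      also have "\<dots> \<le> M * card G" using GM by (simp add: mult_right_mono)
      finally show ?thesis
        using card_Un_le[of R ?GG] R(2) unfolding R'_def cardX by (simp add: algebra_simps)
    qed
    have q: "0 \<le> 1 - 1 / real n" "1 - 1 / real n \<le> 1" by auto
    have L1: "L * \<theta> \<le> n * (1 - 1 / n) ^ card X"
    proof -
      \<comment> \<open>Bernoulli's inequality: removing a whole group at once understates what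
        remains, so \<open>L\<close> never exceeds the ideal mean.\<close>
      have "\<theta> \<le> (1 - 1 / n) ^ card G"
        using Bernoulli_inequality[of "- 1 / real n" "card G"] by (simp add: \<theta>_def)
      then have "n * (1 - 1 / n) ^ card Z * \<theta> \<le> n * (1 - 1 / n) ^ card Z * (1 - 1 / n) ^ card G"
        using q by (intro mult_left_mono) auto
      moreover have "L * \<theta> \<le> n * (1 - 1 / n) ^ card Z * \<theta>" using L \<theta> by (intro mult_right_mono)
      ultimately show ?thesis unfolding cardX power_add mult.assoc[symmetric] by linarith
    qed
    have L2: "n * (1 - 1 / n) ^ card X - M * card X / n \<le> L * \<theta>"
    proof -
      let ?q = "1 - 1 / real n"
      \<comment> \<open>The understatement is second order in \<open>card G / n\<close>; multiplied
        by \<open>n\<close> it is at most \<open>M * card G / n\<close>, again additive over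
        groups.\<close>
      have "?q ^ card G - \<theta> \<le> (card G / n)\<^sup>2"
        using one_minus_power_le[of "1 / real n" "card G"] by (simp add: \<theta>_def)
      then have "n * ?q ^ card Z * (?q ^ card G - \<theta>) \<le> n * ?q ^ card Z * (card G / n)\<^sup>2"
        using q by (intro mult_left_mono) auto
      also have "\<dots> \<le> n * 1 * (card G / n)\<^sup>2"
        using q by (intro mult_mono) (auto intro: power_le_one)
      also have "\<dots> = real (card G) * card G / n" by (simp add: power2_eq_square)
      also have "\<dots> \<le> M * card G / n" using GM by (intro divide_right_mono mult_right_mono) auto
      finally have 1: "n * ?q ^ card X - n * ?q ^ card Z * \<theta> \<le> M * card G / n"
        unfolding cardX power_add by (simp add: algebra_simps)
      have "(n * ?q ^ card Z - M * card Z / n) * \<theta> \<le> L * \<theta>" using L \<theta> by (intro mult_right_mono)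
      moreover have "M * card Z / n * \<theta> \<le> M * card Z / n"
        using \<theta> M0 by (intro mult_left_le) auto
      ultimately have 2: "n * ?q ^ card Z * \<theta> - M * card Z / n \<le> L * \<theta>"
        unfolding left_diff_distrib by linarith
      have "M * card X / n = M * card Z / n + M * card G / n"
        unfolding cardX by (simp add: algebra_simps add_divide_distrib)
      then show ?thesis using 1 2 by linarith
    qed
    have inv': "S' (shift a \<Lambda> T) = S' T" if T: "T \<in> \<Omega>" and "\<forall>x\<in>X. \<not> par \<Lambda> x" for a \<Lambda> T
    proof -
      have "h (shift a \<Lambda> T) ` Z = h T ` Z" by (rule hash_shift_image_fixed) (use ZU Z that in auto)
      moreover have "h (shift a \<Lambda> T) ` G = h T ` G" by (rule hash_shift_image_fixed) (use GU G that in auto)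
      moreover have "S (shift a \<Lambda> T) = S T" using inv[OF T] that Z by auto
      ultimately show ?thesis by (simp add: S'_def D_def)
    qed
    have "decomposition M m X (L * \<theta>) S' R'"
      unfolding decomposition_def using R'sub R'card L1 L2 bounds mgf' sq' inv' by blast
    then show ?thesis by blast
  qed
qed

end

section \<open>Zero-sum sets of keys\<close>

lemma power_le_fact_exp:
  fixes x :: real
  assumes "0 \<le> x"
  shows "x ^ k \<le> fact k * exp x"
proof -
  have "(\<Sum>i\<in>{k}. x ^ i /\<^sub>R fact i) \<le> (\<Sum>i. x ^ i /\<^sub>R fact i)"
    by (rule sum_le_suminf) (use assms summable_exp_generic[of x] in auto)
  then have "x ^ k / fact k \<le> exp x" by (simp add: exp_def field_simps)
  then show ?thesis by (simp add: field_simps)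
qed

lemma even_power_le_fact_exp:
  fixes x :: real
  shows "x ^ (2 * j) \<le> fact (2 * j) * (exp x + exp (- x))"
proof -
  have "x ^ (2 * j) = \<bar>x\<bar> ^ (2 * j)" by (simp add: power_mult)
  also have "\<dots> \<le> fact (2 * j) * exp \<bar>x\<bar>" by (rule power_le_fact_exp) simp
  also have "\<dots> \<le> fact (2 * j) * (exp x + exp (- x))"
    by (intro mult_left_mono) (auto simp: abs_if)
  finally show ?thesis .
qed

text \<open>A vector of Rademacher signs, encoded by the set \<open>B\<close> of negative
  coordinates; uniform signs become a sum over \<open>Pow A\<close>.\<close>

definition flip :: "'a set \<Rightarrow> 'a \<Rightarrow> real" where
  "flip B \<alpha> = (if \<alpha> \<in> B then - 1 else 1)"

lemma sum_Pow_exp_signs: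
  fixes t :: "'a \<Rightarrow> real"
  assumes "finite A"
  shows "(\<Sum>B\<in>Pow A. exp (\<Sum>\<alpha>\<in>A. flip B \<alpha> * t \<alpha>)) = (\<Prod>\<alpha>\<in>A. exp (- t \<alpha>) + exp (t \<alpha>))"
  unfolding prod_add[OF assms]
proof (rule sum.cong[OF refl])
  fix B assume "B \<in> Pow A"
  then have B: "B \<subseteq> A" "finite B" using assms finite_subset by auto
  have "(\<Sum>\<alpha>\<in>A. flip B \<alpha> * t \<alpha>) = (\<Sum>\<alpha>\<in>A - B. flip B \<alpha> * t \<alpha>) + (\<Sum>\<alpha>\<in>B. flip B \<alpha> * t \<alpha>)"
    using B assms by (intro sum.subset_diff) auto
  also have "(\<Sum>\<alpha>\<in>A - B. flip B \<alpha> * t \<alpha>) = (\<Sum>\<alpha>\<in>A - B. t \<alpha>)" by (simp add: flip_def)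
  also have "(\<Sum>\<alpha>\<in>B. flip B \<alpha> * t \<alpha>) = (\<Sum>\<alpha>\<in>B. - t \<alpha>)" by (simp add: flip_def)
  finally show "exp (\<Sum>\<alpha>\<in>A. flip B \<alpha> * t \<alpha>) = (\<Prod>\<alpha>\<in>B. exp (- t \<alpha>)) * (\<Prod>\<alpha>\<in>A - B. exp (t \<alpha>))"
    using B assms by (simp add: exp_add exp_sum mult.commute)
qed

text \<open>After normalizing the sum of squares to 1, an even power is bounded by
  \<open>exp x + exp (- x)\<close> up to a factorial, and the exponentials factor over coordinates.
  The 6 is 3 for each of the two exponentials, 3 being a bound for \<open>exp 1\<close>.\<close>

lemma khintchine_even:
  fixes t :: "'a \<Rightarrow> real"
  assumes "finite A" "0 < j"
  shows "(\<Sum>B\<in>Pow A. (\<Sum>\<alpha>\<in>A. flip B \<alpha> * t \<alpha>) ^ (2 * j))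
    \<le> 2 ^ card A * (6 * fact (2 * j)) * (\<Sum>\<alpha>\<in>A. (t \<alpha>)\<^sup>2) ^ j"
proof (cases "(\<Sum>\<alpha>\<in>A. (t \<alpha>)\<^sup>2) = 0")
  case True
  then have "t \<alpha> = 0" if "\<alpha> \<in> A" for \<alpha>
    using that assms(1) by (simp add: sum_nonneg_eq_0_iff)
  then show ?thesis using assms(2) by (simp add: zero_power)
next
  case False
  define v where "v = (\<Sum>\<alpha>\<in>A. (t \<alpha>)\<^sup>2)"
  have v: "0 < v" using False sum_nonneg[of A "\<lambda>\<alpha>. (t \<alpha>)\<^sup>2"] by (auto simp: v_def less_le)
  define z where "z \<alpha> = t \<alpha> / sqrt v" for \<alpha>
  have z: "(\<Sum>\<alpha>\<in>A. (z \<alpha>)\<^sup>2) = 1"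
    using v by (simp add: z_def power_divide sum_divide_distrib[symmetric] v_def[symmetric])
  have z1: "\<bar>z \<alpha>\<bar> \<le> 1" if "\<alpha> \<in> A" for \<alpha>
  proof -
    have "(z \<alpha>)\<^sup>2 \<le> (\<Sum>\<alpha>\<in>A. (z \<alpha>)\<^sup>2)" by (rule member_le_sum) (use that assms in auto)
    then show ?thesis using z by (simp add: abs_square_le_1)
  qed
  have prod_le: "(\<Prod>\<alpha>\<in>A. exp (- w \<alpha>) + exp (w \<alpha>)) \<le> 2 ^ card A * 3"
    if w: "\<And>\<alpha>. \<alpha> \<in> A \<Longrightarrow> \<bar>w \<alpha>\<bar> \<le> 1" "(\<Sum>\<alpha>\<in>A. (w \<alpha>)\<^sup>2) = 1" for w :: "'a \<Rightarrow> real"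
  proof -
    have "(\<Prod>\<alpha>\<in>A. exp (- w \<alpha>) + exp (w \<alpha>)) \<le> (\<Prod>\<alpha>\<in>A. 2 * exp ((w \<alpha>)\<^sup>2))"
    proof (rule prod_mono, intro conjI)
      fix \<alpha> assume "\<alpha> \<in> A"
      then have "exp (- w \<alpha>) + exp (w \<alpha>) \<le> 2 * (1 + (w \<alpha>)\<^sup>2)"
        using exp_le_quadratic[of "w \<alpha>"] exp_le_quadratic[of "- w \<alpha>"] w(1) by simp
      also have "\<dots> \<le> 2 * exp ((w \<alpha>)\<^sup>2)" by (intro mult_left_mono exp_ge_add_one_self) simp
      finally show "exp (- w \<alpha>) + exp (w \<alpha>) \<le> 2 * exp ((w \<alpha>)\<^sup>2)" .
    qed (simp add: add_nonneg_nonneg)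
    also have "\<dots> = 2 ^ card A * exp 1"
      using assms(1) w(2) by (simp add: prod.distrib exp_sum[symmetric])
    also have "\<dots> \<le> 2 ^ card A * 3" using exp_le by (intro mult_left_mono) auto
    finally show ?thesis .
  qed
  have "(\<Sum>B\<in>Pow A. (\<Sum>\<alpha>\<in>A. flip B \<alpha> * z \<alpha>) ^ (2 * j)) \<le>
      (\<Sum>B\<in>Pow A. fact (2 * j) * (exp (\<Sum>\<alpha>\<in>A. flip B \<alpha> * z \<alpha>) + exp (\<Sum>\<alpha>\<in>A. flip B \<alpha> * (- z \<alpha>))))"
    using even_power_le_fact_exp by (intro sum_mono) (simp add: sum_negf)
  also have "\<dots> = fact (2 * j) * ((\<Prod>\<alpha>\<in>A. exp (- z \<alpha>) + exp (z \<alpha>)) + (\<Prod>\<alpha>\<in>A. exp (- (- z \<alpha>)) + exp (- z \<alpha>)))"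
    unfolding sum_distrib_left[symmetric] sum.distrib sum_Pow_exp_signs[OF assms(1)] ..
  also have "\<dots> \<le> fact (2 * j) * (2 ^ card A * 3 + 2 ^ card A * 3)"
    using prod_le[of z] prod_le[of "\<lambda>\<alpha>. - z \<alpha>"] z z1 by (intro mult_left_mono add_mono) auto
  finally have *: "(\<Sum>B\<in>Pow A. (\<Sum>\<alpha>\<in>A. flip B \<alpha> * z \<alpha>) ^ (2 * j)) \<le> 2 ^ card A * (6 * fact (2 * j))"
    by (simp add: mult_ac)
  have "(\<Sum>\<alpha>\<in>A. flip B \<alpha> * t \<alpha>) ^ (2 * j) = (\<Sum>\<alpha>\<in>A. flip B \<alpha> * z \<alpha>) ^ (2 * j) * v ^ j" for B
  proof -
    have "(\<Sum>\<alpha>\<in>A. flip B \<alpha> * t \<alpha>) = (\<Sum>\<alpha>\<in>A. flip B \<alpha> * z \<alpha>) * sqrt v"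
      using v by (simp add: z_def sum_distrib_right)
    then show ?thesis using v by (simp add: power_mult_distrib power_mult)
  qed
  then have "(\<Sum>B\<in>Pow A. (\<Sum>\<alpha>\<in>A. flip B \<alpha> * t \<alpha>) ^ (2 * j)) =
      (\<Sum>B\<in>Pow A. (\<Sum>\<alpha>\<in>A. flip B \<alpha> * z \<alpha>) ^ (2 * j)) * v ^ j"
    by (simp add: sum_distrib_right)
  also have "\<dots> \<le> 2 ^ card A * (6 * fact (2 * j)) * v ^ j"
    using * v by (intro mult_right_mono) auto
  finally show ?thesis by (simp add: v_def)
qed

lemma power_mean_weighted:
  fixes w y :: "'a \<Rightarrow> real"
  assumes "finite I" "I \<noteq> {}" "(\<Sum>i\<in>I. w i) = 1" "\<And>i. i \<in> I \<Longrightarrow> 0 \<le> w i" "\<And>i. i \<in> I \<Longrightarrow> 0 \<le> y i"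
  shows "(\<Sum>i\<in>I. w i * y i) ^ j \<le> (\<Sum>i\<in>I. w i * y i ^ j)"
proof -
  have "convex_on {0::real..} (\<lambda>x. x ^ j)"
    by (cases "even j") (auto intro: convex_power_odd convex_on_subset[OF convex_power_even])
  from convex_on_sum[OF assms(1,2) this assms(3,4), of y] show ?thesis
    using assms(5) by simp
qed

text \<open>For finite \<open>\<Lambda>\<close> this is -1 to the power
  \<open>card (\<Lambda> \<inter> vec c x)\<close>: a product of one independent Rademacher sign per
  position when \<open>\<Lambda>\<close> is uniform. The product over \<open>\<Lambda>\<close> is
  the form that factors over entries in \<open>card_zero_sum_subsets_le\<close>.\<close>

definition character_sign :: "nat \<Rightarrow> (nat \<times> nat) set \<Rightarrow> (nat \<Rightarrow> nat) \<Rightarrow> real" where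
  "character_sign c \<Lambda> x = (\<Prod>p\<in>\<Lambda>. if p \<in> vec c x then - 1 else 1)"

lemma sum_Pow_Suc_product:
  fixes f :: "(nat \<times> nat) set \<Rightarrow> real"
  shows "(\<Sum>\<Lambda>\<in>Pow ({..<Suc c} \<times> {..<s}). f \<Lambda>) =
    (\<Sum>\<Lambda>\<in>Pow ({..<c} \<times> {..<s}). \<Sum>B\<in>Pow {..<s}. f (\<Lambda> \<union> {c} \<times> B))"
proof -
  let ?g = "\<lambda>(\<Lambda>, B). \<Lambda> \<union> {c} \<times> B" and ?k = "\<lambda>\<Lambda>. (\<Lambda> \<inter> {..<c} \<times> UNIV, {\<alpha>. (c, \<alpha>) \<in> \<Lambda>})"
  have "bij_betw ?g (Pow ({..<c} \<times> {..<s}) \<times> Pow {..<s}) (Pow ({..<Suc c} \<times> {..<s}))"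
  proof (rule bij_betw_byWitness[where f' = ?k])
    show "\<forall>p\<in>Pow ({..<c} \<times> {..<s}) \<times> Pow {..<s}. ?k (?g p) = p" by auto
    show "\<forall>\<Lambda>\<in>Pow ({..<Suc c} \<times> {..<s}). ?g (?k \<Lambda>) = \<Lambda>"
      by (auto simp: less_Suc_eq subset_iff)
  qed (auto simp: less_Suc_eq)
  from sum.reindex_bij_betw[OF this, of f] show ?thesis
    by (simp add: sum.cartesian_product case_prod_unfold)
qed

lemma character_sign_Suc:
  assumes "\<Lambda> \<subseteq> {..<c} \<times> {..<s}" "B \<subseteq> {..<s}"
  shows "character_sign (Suc c) (\<Lambda> \<union> {c} \<times> B) x = character_sign c \<Lambda> x * flip B (x c)"
proof -
  have fin: "finite \<Lambda>" "finite B" using assms finite_subset[of \<Lambda> "{..<c} \<times> {..<s}"] finite_subset[of B] by auto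
  have "character_sign (Suc c) (\<Lambda> \<union> {c} \<times> B) x =
      (\<Prod>p\<in>\<Lambda>. if p \<in> vec (Suc c) x then - 1 else 1) * (\<Prod>p\<in>{c} \<times> B. if p \<in> vec (Suc c) x then - 1 else 1)"
    unfolding character_sign_def using assms fin by (intro prod.union_disjoint) auto
  also have "(\<Prod>p\<in>\<Lambda>. if p \<in> vec (Suc c) x then - 1 else 1) = character_sign c \<Lambda> x"
    unfolding character_sign_def using assms by (intro prod.cong) (auto simp: vec_def)
  also have "(\<Prod>p\<in>{c} \<times> B. if p \<in> vec (Suc c) x then - 1 else 1) =
      (\<Prod>\<alpha>\<in>B. if \<alpha> = x c then - 1 else (1::real))"
    by (rule prod.reindex_bij_witness[of _ "\<lambda>\<alpha>. (c, \<alpha>)" snd]) auto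
  also have "\<dots> = flip B (x c)" using fin by (simp add: flip_def prod.delta)
  finally show ?thesis .
qed

text \<open>Induction on the positions. With the signs of the first \<open>c\<close> positions
  fixed, the sum over \<open>X\<close> is a signed sum of group sums indexed by the last character,
  so Khintchine's inequality costs one constant per position. With no positions left, distinctness
  of the keys forces \<open>card X \<le> 1\<close>.\<close>

lemma character_sign_moment:
  assumes "0 < j" "finite X" "\<And>x i. x \<in> X \<Longrightarrow> i < c \<Longrightarrow> x i < s"
    "\<And>x y. x \<in> X \<Longrightarrow> y \<in> X \<Longrightarrow> (\<And>i. i < c \<Longrightarrow> x i = y i) \<Longrightarrow> x = y"
  shows "(\<Sum>\<Lambda>\<in>Pow ({..<c} \<times> {..<s}). (\<Sum>x\<in>X. character_sign c \<Lambda> x) ^ (2 * j))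
    \<le> 2 ^ (c * s) * (6 * fact (2 * j)) ^ c * real (card X) ^ j"
  using assms(2-)
proof (induction c arbitrary: X)
  case 0
  have "card X \<le> 1"
    using 0 by (auto simp: card_le_Suc0_iff_eq)
  then consider "card X = 0" | "card X = 1" by linarith
  then show ?case using assms(1) 0(1) by cases (auto simp: character_sign_def zero_power)
next
  case (Suc c)
  define K :: real where "K = 6 * fact (2 * j)"
  show ?case
  proof (cases "X = {}")
    case True
    then show ?thesis using assms(1) by (simp add: zero_power)
  next
    case False
    define G where "G \<alpha> = {x \<in> X. x c = \<alpha>}" for \<alpha>
    define A where "A = (\<lambda>x. x c) ` X"
    have A: "finite A" "A \<noteq> {}" "A \<subseteq> {..<s}" using Suc.prems False by (auto simp: A_def)
    have Gfin: "finite (G \<alpha>)" for \<alpha> using Suc.prems by (simp add: G_def)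
    have Gpos: "0 < card (G \<alpha>)" if "\<alpha> \<in> A" for \<alpha>
      using that Gfin[of \<alpha>] by (auto simp: A_def G_def card_gt_0_iff)
    have Xpos: "0 < card X" using False Suc.prems by (simp add: card_gt_0_iff)
    have group: "(\<Sum>x\<in>X. f x) = (\<Sum>\<alpha>\<in>A. \<Sum>x\<in>G \<alpha>. f x)" for f :: "(nat \<Rightarrow> nat) \<Rightarrow> real"
      unfolding G_def using Suc.prems A by (intro sum.group[symmetric]) (auto simp: A_def)
    have IH: "(\<Sum>\<Lambda>\<in>Pow ({..<c} \<times> {..<s}). (\<Sum>x\<in>G \<alpha>. character_sign c \<Lambda> x) ^ (2 * j))
        \<le> 2 ^ (c * s) * K ^ c * real (card (G \<alpha>)) ^ j" for \<alpha>
      unfolding K_def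
    proof (rule Suc.IH)
      fix x y assume "x \<in> G \<alpha>" "y \<in> G \<alpha>" and eq: "\<And>i. i < c \<Longrightarrow> x i = y i"
      then have xy: "x \<in> X" "y \<in> X" "x c = y c" by (auto simp: G_def)
      show "x = y" by (rule Suc.prems(3)[OF xy(1,2)]) (use eq xy(3) in \<open>auto simp: less_Suc_eq\<close>)
    qed (use Suc.prems Gfin in \<open>auto simp: G_def\<close>)
    have inner: "(\<Sum>B\<in>Pow {..<s}. (\<Sum>x\<in>X. character_sign (Suc c) (\<Lambda> \<union> {c} \<times> B) x) ^ (2 * j))
        \<le> 2 ^ s * K * (real (card X) ^ j * (\<Sum>\<alpha>\<in>A. card (G \<alpha>) / card X *
            ((\<Sum>x\<in>G \<alpha>. character_sign c \<Lambda> x) ^ (2 * j) / real (card (G \<alpha>)) ^ j)))"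
      if \<Lambda>: "\<Lambda> \<in> Pow ({..<c} \<times> {..<s})" for \<Lambda>
    proof -
      define t where "t \<alpha> = (\<Sum>x\<in>G \<alpha>. character_sign c \<Lambda> x)" for \<alpha>
      have t0: "t \<alpha> = 0" if "\<alpha> \<notin> A" for \<alpha>
      proof -
        have "G \<alpha> = {}" using that by (auto simp: A_def G_def)
        then show ?thesis by (simp add: t_def)
      qed
      have "(\<Sum>x\<in>X. character_sign (Suc c) (\<Lambda> \<union> {c} \<times> B) x) = (\<Sum>\<alpha><s. flip B \<alpha> * t \<alpha>)"
        if B: "B \<in> Pow {..<s}" for B
      proof -
        have "(\<Sum>x\<in>X. character_sign (Suc c) (\<Lambda> \<union> {c} \<times> B) x) =
            (\<Sum>x\<in>X. character_sign c \<Lambda> x * flip B (x c))"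
          using character_sign_Suc[of \<Lambda> c s B] \<Lambda> B by simp
        also have "\<dots> = (\<Sum>\<alpha>\<in>A. flip B \<alpha> * t \<alpha>)"
          unfolding group by (auto simp: t_def sum_distrib_left G_def mult.commute intro!: sum.cong)
        also have "\<dots> = (\<Sum>\<alpha><s. flip B \<alpha> * t \<alpha>)"
          by (rule sum.mono_neutral_left) (use A t0 in auto)
        finally show ?thesis .
      qed
      then have "(\<Sum>B\<in>Pow {..<s}. (\<Sum>x\<in>X. character_sign (Suc c) (\<Lambda> \<union> {c} \<times> B) x) ^ (2 * j)) =
          (\<Sum>B\<in>Pow {..<s}. (\<Sum>\<alpha><s. flip B \<alpha> * t \<alpha>) ^ (2 * j))" by simp
      also have "\<dots> \<le> 2 ^ s * K * (\<Sum>\<alpha><s. (t \<alpha>)\<^sup>2) ^ j"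
        using khintchine_even[OF _ assms(1), of "{..<s}" t] by (simp add: K_def)
      also have "(\<Sum>\<alpha><s. (t \<alpha>)\<^sup>2) = (\<Sum>\<alpha>\<in>A. (t \<alpha>)\<^sup>2)"
        by (rule sum.mono_neutral_right) (use A t0 in auto)
      \<comment> \<open>Jensen is applied with weights proportional to group sizes: the factor
        \<open>card (G \<alpha>) ^ j\<close> from the induction hypothesis then cancels, and exactly
        \<open>card X ^ j\<close> remains.\<close>
      also have "(\<Sum>\<alpha>\<in>A. (t \<alpha>)\<^sup>2) = card X * (\<Sum>\<alpha>\<in>A. card (G \<alpha>) / card X * ((t \<alpha>)\<^sup>2 / card (G \<alpha>)))"
        unfolding sum_distrib_left using Gpos Xpos by (intro sum.cong) auto
      also have "\<dots> ^ j = real (card X) ^ j * (\<Sum>\<alpha>\<in>A. card (G \<alpha>) / card X * ((t \<alpha>)\<^sup>2 / card (G \<alpha>))) ^ j"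
        by (simp add: power_mult_distrib)
      also have "(\<Sum>\<alpha>\<in>A. card (G \<alpha>) / card X * ((t \<alpha>)\<^sup>2 / card (G \<alpha>))) ^ j \<le>
          (\<Sum>\<alpha>\<in>A. card (G \<alpha>) / card X * ((t \<alpha>)\<^sup>2 / card (G \<alpha>)) ^ j)"
      proof (rule power_mean_weighted)
        show "(\<Sum>\<alpha>\<in>A. card (G \<alpha>) / real (card X)) = 1"
          using group[of "\<lambda>_. 1"] Xpos by (simp add: sum_divide_distrib[symmetric])
      qed (use A in auto)
      finally have "(\<Sum>B\<in>Pow {..<s}. (\<Sum>x\<in>X. character_sign (Suc c) (\<Lambda> \<union> {c} \<times> B) x) ^ (2 * j)) \<le>
          2 ^ s * K * (real (card X) ^ j * (\<Sum>\<alpha>\<in>A. card (G \<alpha>) / card X * ((t \<alpha>)\<^sup>2 / card (G \<alpha>)) ^ j))"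
        by (simp add: mult_left_mono K_def)
      then show ?thesis by (simp add: t_def power_divide power_mult)
    qed
    have "(\<Sum>\<Lambda>\<in>Pow ({..<Suc c} \<times> {..<s}). (\<Sum>x\<in>X. character_sign (Suc c) \<Lambda> x) ^ (2 * j)) \<le>
        (\<Sum>\<Lambda>\<in>Pow ({..<c} \<times> {..<s}). 2 ^ s * K * (real (card X) ^ j * (\<Sum>\<alpha>\<in>A. card (G \<alpha>) / card X *
            ((\<Sum>x\<in>G \<alpha>. character_sign c \<Lambda> x) ^ (2 * j) / real (card (G \<alpha>)) ^ j))))"
      unfolding sum_Pow_Suc_product using inner by (rule sum_mono)
    also have "\<dots> = 2 ^ s * K * (real (card X) ^ j * (\<Sum>\<alpha>\<in>A. card (G \<alpha>) / card X *
        ((\<Sum>\<Lambda>\<in>Pow ({..<c} \<times> {..<s}). (\<Sum>x\<in>G \<alpha>. character_sign c \<Lambda> x) ^ (2 * j)) / real (card (G \<alpha>)) ^ j)))"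
      unfolding sum_distrib_left sum_divide_distrib by (rule sum.swap)
    also have "\<dots> \<le> 2 ^ s * K * (real (card X) ^ j * (\<Sum>\<alpha>\<in>A. card (G \<alpha>) / card X * (2 ^ (c * s) * K ^ c)))"
    proof (intro mult_left_mono sum_mono)
      fix \<alpha> assume "\<alpha> \<in> A"
      then show "(\<Sum>\<Lambda>\<in>Pow ({..<c} \<times> {..<s}). (\<Sum>x\<in>G \<alpha>. character_sign c \<Lambda> x) ^ (2 * j)) / real (card (G \<alpha>)) ^ j
          \<le> 2 ^ (c * s) * K ^ c"
        using IH[of \<alpha>] Gpos[of \<alpha>] by (simp add: pos_divide_le_eq)
    qed (auto simp: K_def)
    also have "(\<Sum>\<alpha>\<in>A. card (G \<alpha>) / card X * (2 ^ (c * s) * K ^ c)) = 2 ^ (c * s) * K ^ c"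
      using group[of "\<lambda>_. 1"] Xpos
      by (simp add: sum_distrib_right[symmetric] sum_divide_distrib[symmetric])
    finally show ?thesis by (simp add: K_def power_add mult_ac)
  qed
qed

text \<open>Expanding the moment of order \<open>2 * j\<close> over tuples of keys and summing over
  \<open>\<Lambda>\<close>, a tuple gets weight \<open>2 ^ (c * s)\<close> if every entry is read an
  even number of times and 0 otherwise. Enumerations of zero-sum sets have full weight, so the
  moment bounds their number.\<close>

lemma card_zero_sum_subsets_le:
  assumes "0 < j" "X \<subseteq> tab_keys c s"
  shows "card {F. F \<subseteq> X \<and> card F = 2 * j \<and> xsum (vec c) F = {}} \<le> (6 * fact (2 * j)) ^ c * real (card X) ^ j"
proof -
  have "finite (tab_keys c s)" unfolding tab_keys_def by (intro finite_PiE) auto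
  then have finX: "finite X" using assms(2) finite_subset by blast
  let ?V = "{..<c} \<times> {..<s}" and ?W = "PiE {..<2 * j} (\<lambda>_. X)"
  let ?Z = "{F. F \<subseteq> X \<and> card F = 2 * j \<and> xsum (vec c) F = {}}"
  let ?f = "\<lambda>g p. \<Prod>l<2 * j. if p \<in> vec c (g l) then - 1 else (1::real)"
  have cardV: "card ?V = c * s" by (simp add: card_cartesian_product)
  have f1: "?f g p = 1 \<or> ?f g p = - 1" for g p
  proof -
    have "\<bar>?f g p\<bar> = 1" unfolding abs_prod by (rule prod.neutral) auto
    then show ?thesis by linarith
  qed
  define wt where "wt g = (\<Sum>\<Lambda>\<in>Pow ?V. \<Prod>l<2 * j. character_sign c \<Lambda> (g l))" for g
  have wt: "wt g = (\<Prod>p\<in>?V. ?f g p + 1)" for g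
  proof -
    have "wt g = (\<Sum>\<Lambda>\<in>Pow ?V. prod (?f g) \<Lambda>)"
      unfolding wt_def character_sign_def by (subst prod.swap) (rule refl)
    then show ?thesis by (subst prod_add) auto
  qed
  have wt_nonneg: "0 \<le> wt g" for g
    unfolding wt
  proof (rule prod_nonneg)
    fix p
    show "0 \<le> ?f g p + 1" using f1[of p g] by (elim disjE) simp_all
  qed
  have "\<exists>g\<in>?W. g ` {..<2 * j} = F \<and> wt g = 2 ^ (c * s)" if F: "F \<in> ?Z" for F
  proof -
    have finF: "finite F" using F finX finite_subset by blast
    then obtain b where b: "bij_betw b {..<2 * j} F"
      using F ex_bij_betw_nat_finite[of F] by (auto simp: atLeast0LessThan)
    let ?g = "restrict b {..<2 * j}"
    have g: "bij_betw ?g {..<2 * j} F" by (rule bij_betw_cong[THEN iffD1, rotated, OF b]) simp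
    have "?f ?g p = 1" for p
    proof -
      have "?f ?g p = (\<Prod>x\<in>F. if p \<in> vec c x then - 1 else 1)"
        using prod.reindex_bij_betw[OF g, of "\<lambda>x. if p \<in> vec c x then - 1 else (1::real)"] by simp
      also have "\<dots> = (- 1) ^ card {x \<in> F. p \<in> vec c x}"
        using finF by (simp add: prod.If_cases Int_def)
      also have "\<dots> = 1"
      proof -
        have "even (card {x \<in> F. p \<in> vec c x})" using F unfolding xsum_def by blast
        then show ?thesis by simp
      qed
      finally show ?thesis .
    qed
    then have "wt ?g = 2 ^ (c * s)" unfolding wt by (simp add: cardV)
    moreover have "?g \<in> ?W" using b F by (auto simp: bij_betw_def)
    moreover have "?g ` {..<2 * j} = F" using g by (simp add: bij_betw_def)
    ultimately show ?thesis by blast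
  qed
  note ex = this
  \<comment> \<open>One enumeration per set suffices, since all other tuples have nonnegative
    weight.\<close>
  define e where "e F = (SOME g. g \<in> ?W \<and> g ` {..<2 * j} = F \<and> wt g = 2 ^ (c * s))" for F
  have e: "e F \<in> ?W \<and> e F ` {..<2 * j} = F \<and> wt (e F) = 2 ^ (c * s)" if "F \<in> ?Z" for F
    unfolding e_def by (rule someI_ex[OF ex[OF that, unfolded Bex_def]])
  have inj: "inj_on e ?Z"
  proof (rule inj_onI)
    fix F F' assume F: "F \<in> ?Z" "F' \<in> ?Z" "e F = e F'"
    have "F = e F ` {..<2 * j}" using e[OF F(1)] by blast
    also have "\<dots> = F'" unfolding F(3) using e[OF F(2)] by blast
    finally show "F = F'" .
  qed
  have finW: "finite ?W" by (intro finite_PiE) (use finX in auto)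
  have "card ?Z * 2 ^ (c * s) = (\<Sum>g\<in>e ` ?Z. wt g)"
    using e by (simp add: sum.reindex[OF inj])
  also have "\<dots> \<le> (\<Sum>g\<in>?W. wt g)"
    by (rule sum_mono2[OF finW]) (use e wt_nonneg in auto)
  also have "\<dots> = (\<Sum>\<Lambda>\<in>Pow ?V. \<Sum>g\<in>?W. \<Prod>l<2 * j. character_sign c \<Lambda> (g l))"
    unfolding wt_def by (rule sum.swap)
  also have "\<dots> = (\<Sum>\<Lambda>\<in>Pow ?V. (\<Sum>x\<in>X. character_sign c \<Lambda> x) ^ (2 * j))"
  proof (rule sum.cong[OF refl])
    fix \<Lambda>
    have "(\<Prod>l<2 * j. \<Sum>x\<in>X. character_sign c \<Lambda> x) = (\<Sum>g\<in>?W. \<Prod>l<2 * j. character_sign c \<Lambda> (g l))"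
      by (rule prod_sum_PiE) (use finX in auto)
    then show "(\<Sum>g\<in>?W. \<Prod>l<2 * j. character_sign c \<Lambda> (g l)) = (\<Sum>x\<in>X. character_sign c \<Lambda> x) ^ (2 * j)"
      by simp
  qed
  also have "\<dots> \<le> 2 ^ (c * s) * (6 * fact (2 * j)) ^ c * real (card X) ^ j"
  proof (rule character_sign_moment[OF assms(1) finX])
    show "x i < s" if "x \<in> X" "i < c" for x i
      using that assms(2) by (auto simp: tab_keys_def PiE_iff)
    show "x = y" if "x \<in> X" "y \<in> X" "\<And>i. i < c \<Longrightarrow> x i = y i" for x y
      using that assms(2) unfolding tab_keys_def by (intro PiE_ext[of x "{0..<c}" "\<lambda>_. {0..<s}" y]) auto
  qed
  finally have "card ?Z * 2 ^ (c * s) \<le> ((6 * fact (2 * j)) ^ c * real (card X) ^ j) * 2 ^ (c * s)"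
    by (simp add: mult_ac)
  then show ?thesis by simp
qed

section \<open>The expected number of empty bins\<close>

context tabulation
begin

definition spanned :: "(nat \<Rightarrow> nat) \<Rightarrow> (nat \<Rightarrow> nat) set \<Rightarrow> bool" where
  "spanned x Y \<longleftrightarrow> (\<exists>D\<subseteq>Y. xsum (vec c) D = vec c x)"

lemma spanned_mono: "spanned x Y \<Longrightarrow> Y \<subseteq> Z \<Longrightarrow> spanned x Z"
  unfolding spanned_def by blast

lemma separating_functional:
  assumes "finite Y" "\<not> spanned x Y"
  shows "\<exists>\<Lambda>. par \<Lambda> x \<and> (\<forall>y\<in>Y. \<not> par \<Lambda> y)"
  using span_or_separated[OF assms(1), of "vec c" "vec c x"] assms(2) unfolding spanned_def by auto

lemma par_xsum:
  assumes "finite D" "xsum (vec c) D = vec c x"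
  shows "par \<Lambda> x \<longleftrightarrow> odd (card {y \<in> D. par \<Lambda> y})"
  using odd_card_Int_xsum[OF assms(1), of "vec c" \<Lambda>] assms(2) by simp

lemma odd_card_if_xsum_eq_vec:
  assumes "finite D" "xsum (vec c) D = vec c x"
  shows "odd (card D)"
proof -
  obtain \<Lambda> where "\<forall>y. par \<Lambda> y" using par_all by blast
  then show ?thesis using par_xsum[OF assms, of \<Lambda>] by simp
qed

text \<open>A dependency has odd size, and one of size 1 is trivial because \<open>vec c\<close> is
  injective on keys.\<close>

lemma xsum_eq_vec_cases:
  assumes "D \<subseteq> U" "x \<in> U" "xsum (vec c) D = vec c x"
  shows "D = {x} \<or> 3 \<le> card D"
proof (cases "card D = 1")
  case True
  then obtain y where y: "D = {y}" by (auto simp: card_1_singleton_iff)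
  have "vec c y = xsum (vec c) (insert y {})" by (subst xsum_insert) auto
  also have "\<dots> = vec c x" using assms(3) y by simp
  finally have "vec c y = vec c x" .
  then have "y = x" by (rule inj_onD[OF inj_on_vec[of c s]]) (use y assms in auto)
  then show ?thesis using y by simp
next
  case False
  have "odd (card D)" by (rule odd_card_if_xsum_eq_vec[OF finite_keys_subset[OF assms(1)] assms(3)])
  then have "3 \<le> card D" using False by (auto elim!: oddE)
  then show ?thesis ..
qed

lemma xsum_covers:
  assumes "xsum (vec c) D = vec c x" "i < c"
  shows "\<exists>y\<in>D. y i = x i"
proof -
  have "(i, x i) \<in> xsum (vec c) D" using assms by simp
  then have "card {y \<in> D. (i, x i) \<in> vec c y} \<noteq> 0" by (auto simp: xsum_def intro: odd_pos)
  then show ?thesis by (auto simp: card_eq_0_iff)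
qed

text \<open>Each bit of the hash function is itself a linear functional, supported on the entries
  with that bit set; linear dependencies between keys therefore pass to hash values.\<close>

lemma bit_hash: "bit (h T x) k \<longleftrightarrow> par {(i, \<alpha>). bit (T i \<alpha>) k} x"
proof -
  have "bit (foldr (\<lambda>i. xor (T i (x i))) is 0) k \<longleftrightarrow> odd (card {i \<in> set is. bit (T i (x i)) k})"
    if "distinct is" for "is"
    using that
  proof (induction "is")
    case (Cons j js)
    have "{i \<in> set (j # js). bit (T i (x i)) k} =
        (if bit (T j (x j)) k then insert j {i \<in> set js. bit (T i (x i)) k}
         else {i \<in> set js. bit (T i (x i)) k})"
      by auto
    then show ?case using Cons by (simp add: bit_xor_iff)
  qed simp
  from this[of "[0..<c]"] have "bit (h T x) k \<longleftrightarrow> odd (card {i \<in> {0..<c}. bit (T i (x i)) k})"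
    by (simp add: tab_hash_def)
  moreover have "card {i \<in> {0..<c}. bit (T i (x i)) k} = card ({(i, \<alpha>). bit (T i \<alpha>) k} \<inter> vec c x)"
    by (rule bij_betw_same_card[where f = "\<lambda>i. (i, x i)"])
      (auto simp: bij_betw_def inj_on_def vec_def)
  ultimately show ?thesis by simp
qed

text \<open>The XOR of an odd number of equal values is that value, checked bit by bit.\<close>

lemma hash_eq_if_xsum_eq_vec:
  assumes "finite D" "xsum (vec c) D = vec c x" "\<And>y. y \<in> D \<Longrightarrow> h T y = a"
  shows "h T x = a"
proof (rule bit_eqI)
  fix k
  have "{y \<in> D. par {(i, \<alpha>). bit (T i \<alpha>) k} y} = (if bit a k then D else {})"
    using assms(3) bit_hash[of T _ k] by auto
  then show "bit (h T x) k = bit a k"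
    using par_xsum[OF assms(1,2), of "{(i, \<alpha>). bit (T i \<alpha>) k}"] odd_card_if_xsum_eq_vec[OF assms(1,2)]
    unfolding bit_hash by simp
qed

lemma P_eq_card: "P Q = card {T \<in> \<Omega>. Q T} / card \<Omega>"
  unfolding P_def E_def by (simp add: of_bool_def sum.If_cases Int_def)

lemma P_sum_cases:
  assumes "finite I" "\<And>T. T \<in> \<Omega> \<Longrightarrow> Q T \<Longrightarrow> g T \<in> I"
  shows "P Q = (\<Sum>a\<in>I. P (\<lambda>T. Q T \<and> g T = a))"
  unfolding P_def E_sum[symmetric]
proof (rule E_cong)
  fix T assume T: "T \<in> \<Omega>"
  show "of_bool (Q T) = (\<Sum>a\<in>I. of_bool (Q T \<and> g T = a) :: real)"
    using assms T by (cases "Q T") (auto simp: of_bool_def)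
qed

text \<open>Analogue of the Kempe chain argument for proper colourings: given the tables modulo \<open>a\<close>,
  the keys that can still collide with the value \<open>0\<close> are those with hash value in \<open>{0, a}\<close>; a
  functional that separates \<open>x\<close> from them swaps the values \<open>0\<close> and \<open>a\<close> of \<open>x\<close> and keeps theirs.\<close>

lemma P_swap_zero:
  assumes x: "x \<in> U" and X: "X \<subseteq> U" and a: "a < n" "a \<noteq> 0"
  shows "P (\<lambda>T. h T x = 0 \<and> 0 \<notin> h T ` X) =
    P (\<lambda>T. h T x = a \<and> 0 \<notin> h T ` X \<and> \<not> spanned x {y \<in> X. h T y = a})"
proof -
  have finX: "finite X" by (rule finite_keys_subset) fact
  \<comment> \<open>The pair of values \<open>0\<close> and \<open>a\<close> is closed under XOR
    with \<open>a\<close>, so \<open>Y0\<close> is unchanged by \<open>\<phi>\<close>. Hence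
    \<open>\<phi>\<close> selects the same functional the second time and is an involution, although
    the functional depends on \<open>T\<close>.\<close>
  define Y0 where "Y0 T = {y \<in> X. h T y \<in> {0, a}}" for T
  define \<Lambda> where "\<Lambda> Y = (SOME \<Lambda>. par \<Lambda> x \<and> (\<forall>y\<in>Y. \<not> par \<Lambda> y))" for Y
  define \<phi> where "\<phi> T = shift a (\<Lambda> (Y0 T)) T" for T
  have \<Lambda>: "par (\<Lambda> Y) x" "\<And>y. y \<in> Y \<Longrightarrow> \<not> par (\<Lambda> Y) y" if "finite Y" "\<not> spanned x Y" for Y
    using someI_ex[OF separating_functional[OF that]] unfolding \<Lambda>_def by blast+
  have finY: "finite (Y0 T)" for T using finX by (simp add: Y0_def)
  have xor0: "xor a v \<in> {0, a} \<longleftrightarrow> v \<in> {0, a}" for v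
    using xor_nat_eq_iff[of a v] by auto
  have Y0\<phi>: "Y0 (\<phi> T) = Y0 T" for T
  proof -
    have "h (\<phi> T) y \<in> {0, a} \<longleftrightarrow> h T y \<in> {0, a}" if "y \<in> X" for y
    proof -
      have "h (\<phi> T) y = xor a (h T y) \<or> h (\<phi> T) y = h T y"
        using hash_shift[of y a "\<Lambda> (Y0 T)" T] subsetD[OF X that] unfolding \<phi>_def by presburger
      then show ?thesis using xor0[of "h T y"] by (elim disjE) (simp_all only:)
    qed
    then show ?thesis unfolding Y0_def by blast
  qed
  have \<phi>\<phi>: "\<phi> (\<phi> T) = T" if "T \<in> \<Omega>" for T
    using that Y0\<phi>[of T] shift_shift[of T a "\<Lambda> (Y0 T)"] unfolding \<phi>_def by simp
  have \<phi>\<Omega>: "\<phi> T \<in> \<Omega>" if "T \<in> \<Omega>" for T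
    using that a by (simp add: \<phi>_def shift_in_tables)
  have \<phi>x: "h (\<phi> T) x = xor a (h T x)" if "\<not> spanned x (Y0 T)" for T
    using \<Lambda>(1)[OF finY that] x by (simp add: \<phi>_def hash_shift)
  have \<phi>X: "0 \<notin> h (\<phi> T) ` X" if "\<not> spanned x (Y0 T)" "0 \<notin> h T ` X" for T
  proof
    assume "0 \<in> h (\<phi> T) ` X"
    then obtain y where y: "y \<in> X" "h (\<phi> T) y = 0" by auto
    then have "y \<in> Y0 (\<phi> T)" by (simp add: Y0_def)
    then have "\<not> par (\<Lambda> (Y0 T)) y" using \<Lambda>(2)[OF finY that(1)] Y0\<phi> by simp
    then have "h (\<phi> T) y = h T y" using y X by (auto simp: \<phi>_def hash_shift)
    then show False using y that(2) by force
  qed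
  have Y0a: "Y0 T = {y \<in> X. h T y = a}" if "0 \<notin> h T ` X" for T
    using that by (auto simp: Y0_def)
  let ?S0 = "{T \<in> \<Omega>. h T x = 0 \<and> 0 \<notin> h T ` X}"
  let ?S1 = "{T \<in> \<Omega>. h T x = a \<and> 0 \<notin> h T ` X \<and> \<not> spanned x {y \<in> X. h T y = a}}"
  \<comment> \<open>When \<open>x\<close> hashes to \<open>0\<close> and no other key does, a
    spanning set in \<open>Y0\<close> would consist of keys with value \<open>a\<close> and force
    \<open>x\<close> to \<open>a\<close>. So the span condition constrains only the event with value
    \<open>a\<close>.\<close>
  have ns: "\<not> spanned x (Y0 T)" if T: "T \<in> ?S0" for T
  proof
    assume "spanned x (Y0 T)"
    then obtain D where D: "D \<subseteq> Y0 T" "xsum (vec c) D = vec c x" by (auto simp: spanned_def)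
    have "h T x = a"
      by (rule hash_eq_if_xsum_eq_vec[of D]) (use D finY finite_subset T Y0a in blast)+
    then show False using T a by simp
  qed
  have "bij_betw \<phi> ?S0 ?S1"
  proof (rule bij_betw_byWitness[where f' = \<phi>])
    show "\<phi> ` ?S0 \<subseteq> ?S1"
    proof safe
      fix T assume T: "T \<in> \<Omega>" "h T x = 0" "0 \<notin> h T ` X"
      then have nsp: "\<not> spanned x (Y0 T)" using ns by simp
      show "\<phi> T \<in> \<Omega>" using T \<phi>\<Omega> by simp
      show "h (\<phi> T) x = a" using \<phi>x[OF nsp] T by simp
      show "False" if "0 = h (\<phi> T) y" "y \<in> X" for y
        using that \<phi>X[OF nsp T(3)] by force
      show "False" if "spanned x {y \<in> X. h (\<phi> T) y = a}"
        using that nsp Y0a[OF \<phi>X[OF nsp T(3)]] Y0\<phi> by simp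
    qed
    show "\<phi> ` ?S1 \<subseteq> ?S0"
    proof safe
      fix T assume T: "T \<in> \<Omega>" "a = h T x" "0 \<notin> h T ` X"
        and sp: "\<not> spanned x {y \<in> X. h T y = h T x}"
      have nsp: "\<not> spanned x (Y0 T)" using sp T(2) Y0a[OF T(3)] by simp
      show "\<phi> T \<in> \<Omega>" using T \<phi>\<Omega> by simp
      show "h (\<phi> T) x = 0" using \<phi>x[OF nsp] T by simp
      show "False" if "0 = h (\<phi> T) y" "y \<in> X" for y
        using that \<phi>X[OF nsp T(3)] by force
    qed
  qed (use \<phi>\<phi> in auto)
  then have "card ?S0 = card ?S1" by (rule bij_betw_same_card)
  then show ?thesis unfolding P_eq_card by simp
qed

text \<open>The event that bin \<open>0\<close> is still empty is split by the value of
  \<open>x\<close>, and the swap makes all \<open>n\<close> parts equal up to the spanned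
  configurations. These enter with a minus sign only, whence the exact lower bound on the
  mean.\<close>

lemma P_hits_zero:
  assumes x: "x \<in> U" and X: "X \<subseteq> U"
  shows "n * P (\<lambda>T. h T x = 0 \<and> 0 \<notin> h T ` X) = P (\<lambda>T. 0 \<notin> h T ` X)
    - P (\<lambda>T. (0 \<notin> h T ` X \<and> h T x \<noteq> 0) \<and> spanned x {y \<in> X. h T y = h T x})"
proof -
  let ?q = "P (\<lambda>T. h T x = 0 \<and> 0 \<notin> h T ` X)"
  have "P (\<lambda>T. 0 \<notin> h T ` X) = P (\<lambda>T. 0 \<notin> h T ` X \<and> h T x = 0) + P (\<lambda>T. 0 \<notin> h T ` X \<and> h T x \<noteq> 0)"
    by (rule P_split)
  also have "P (\<lambda>T. 0 \<notin> h T ` X \<and> h T x = 0) = ?q" by (rule P_cong) auto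
  also have "P (\<lambda>T. 0 \<notin> h T ` X \<and> h T x \<noteq> 0) =
      P (\<lambda>T. (0 \<notin> h T ` X \<and> h T x \<noteq> 0) \<and> spanned x {y \<in> X. h T y = h T x}) +
      P (\<lambda>T. (0 \<notin> h T ` X \<and> h T x \<noteq> 0) \<and> \<not> spanned x {y \<in> X. h T y = h T x})"
    by (rule P_split)
  also have "P (\<lambda>T. (0 \<notin> h T ` X \<and> h T x \<noteq> 0) \<and> \<not> spanned x {y \<in> X. h T y = h T x}) =
      (\<Sum>a\<in>{1..<n}. P (\<lambda>T. ((0 \<notin> h T ` X \<and> h T x \<noteq> 0) \<and> \<not> spanned x {y \<in> X. h T y = h T x}) \<and> h T x = a))"
    by (rule P_sum_cases) (use hash_less[OF x] in \<open>auto simp: Suc_le_eq\<close>)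
  also have "\<dots> = (\<Sum>a\<in>{1..<n}. ?q)"
  proof (rule sum.cong[OF refl])
    fix a assume "a \<in> {1..<n}"
    then have a: "a < n" "a \<noteq> 0" by auto
    show "P (\<lambda>T. ((0 \<notin> h T ` X \<and> h T x \<noteq> 0) \<and> \<not> spanned x {y \<in> X. h T y = h T x}) \<and> h T x = a) = ?q"
      unfolding P_swap_zero[OF x X a] by (rule P_cong) (use a in auto)
  qed
  also have "\<dots> = (real n - 1) * ?q" by (simp add: of_nat_diff)
  finally show ?thesis by (simp add: algebra_simps)
qed

definition avoid :: "(nat \<Rightarrow> nat) set \<Rightarrow> real" where
  "avoid X = P (\<lambda>T. 0 \<notin> h T ` X)"

text \<open>Removing \<open>x\<close> from \<open>X\<close> allows the full key set in place of the
  keys inserted before \<open>x\<close>, independently of the insertion order.\<close>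

definition spanned_by_colliders :: "(nat \<Rightarrow> nat) \<Rightarrow> (nat \<Rightarrow> nat) set \<Rightarrow> real" where
  "spanned_by_colliders x X = P (\<lambda>T. spanned x {y \<in> X - {x}. h T y = h T x})"

lemma avoid_insert:
  assumes "x \<in> U" "X \<subseteq> U" "x \<notin> X"
  shows "avoid X * (1 - 1 / n) \<le> avoid (insert x X)"
    and "avoid (insert x X) \<le> avoid X * (1 - 1 / n) + spanned_by_colliders x X / n"
proof -
  let ?q = "P (\<lambda>T. h T x = 0 \<and> 0 \<notin> h T ` X)"
  let ?e = "P (\<lambda>T. (0 \<notin> h T ` X \<and> h T x \<noteq> 0) \<and> spanned x {y \<in> X. h T y = h T x})"
  have "avoid X = P (\<lambda>T. 0 \<notin> h T ` X \<and> h T x = 0) + P (\<lambda>T. 0 \<notin> h T ` X \<and> h T x \<noteq> 0)"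
    unfolding avoid_def by (rule P_split)
  moreover have "P (\<lambda>T. 0 \<notin> h T ` X \<and> h T x = 0) = ?q" by (rule P_cong) auto
  moreover have "P (\<lambda>T. 0 \<notin> h T ` X \<and> h T x \<noteq> 0) = avoid (insert x X)"
    unfolding avoid_def by (rule P_cong) auto
  moreover have "n * ?q = avoid X - ?e" using P_hits_zero[OF assms(1,2)] by (simp add: avoid_def)
  ultimately have eq: "avoid (insert x X) = avoid X * (1 - 1 / n) + ?e / n"
    by (simp add: field_simps)
  have "?e \<le> spanned_by_colliders x X"
    unfolding spanned_by_colliders_def by (rule P_mono) (use assms(3) in \<open>auto elim: spanned_mono\<close>)
  then have "?e / n \<le> spanned_by_colliders x X / n" by (intro divide_right_mono) auto
  then show "avoid (insert x X) \<le> avoid X * (1 - 1 / n) + spanned_by_colliders x X / n"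
    unfolding eq by simp
  show "avoid X * (1 - 1 / n) \<le> avoid (insert x X)"
    unfolding eq using P_nonneg by simp
qed

lemma avoid_bounds:
  assumes "X \<subseteq> U"
  shows "(1 - 1 / n) ^ card X \<le> avoid X"
    and "avoid X \<le> (1 - 1 / n) ^ card X + (\<Sum>x\<in>X. spanned_by_colliders x X) / n"
proof -
  let ?q = "1 - 1 / real n"
  have q: "0 \<le> ?q" "?q \<le> 1" by auto
  have "?q ^ card Y \<le> avoid Y \<and> avoid Y \<le> ?q ^ card Y + (\<Sum>x\<in>Y. spanned_by_colliders x X) / n"
    if "Y \<subseteq> X" for Y
    using finite_keys_subset[OF subset_trans[OF that assms]] that
  proof (induction Y rule: finite_induct)
    case empty
    have "avoid {} = 1" using E_const[of 1] by (simp add: avoid_def P_def)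
    then show ?case by simp
  next
    case (insert x Y)
    have xU: "x \<in> U" "Y \<subseteq> U" using insert.prems assms by auto
    have "?q ^ card Y * ?q \<le> avoid Y * ?q" using insert q by (intro mult_right_mono) auto
    then have 1: "?q ^ card (insert x Y) \<le> avoid (insert x Y)"
      using avoid_insert(1)[OF xU insert.hyps(2)] insert.hyps by (simp add: mult.commute)
    have "avoid Y * ?q \<le> (?q ^ card Y + (\<Sum>x\<in>Y. spanned_by_colliders x X) / n) * ?q"
      using insert q by (intro mult_right_mono) auto
    also have "\<dots> \<le> ?q ^ card Y * ?q + (\<Sum>x\<in>Y. spanned_by_colliders x X) / n"
      unfolding distrib_right using q
      by (intro add_left_mono mult_left_le divide_nonneg_nonneg sum_nonneg)
        (auto simp: spanned_by_colliders_def P_nonneg)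
    finally have 2: "avoid Y * ?q \<le> ?q ^ card Y * ?q + (\<Sum>x\<in>Y. spanned_by_colliders x X) / n" .
    have "spanned_by_colliders x Y \<le> spanned_by_colliders x X"
      unfolding spanned_by_colliders_def using insert.prems
      by (intro P_mono) (auto elim!: spanned_mono)
    then have "spanned_by_colliders x Y / n \<le> spanned_by_colliders x X / n"
      by (intro divide_right_mono) auto
    then have "avoid (insert x Y) \<le> ?q ^ card (insert x Y) + (\<Sum>x\<in>insert x Y. spanned_by_colliders x X) / n"
      using avoid_insert(2)[OF xU insert.hyps(2)] 2 insert.hyps
      by (simp add: mult.commute add_divide_distrib)
    then show ?case using 1 by simp
  qed
  from this[OF subset_refl] show "?q ^ card X \<le> avoid X"
    and "avoid X \<le> ?q ^ card X + (\<Sum>x\<in>X. spanned_by_colliders x X) / n" by auto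
qed

text \<open>All bins are equally likely to be empty: a shift along a functional that is odd on every
  key translates all hash values at once and moves bin \<open>0\<close> to bin
  \<open>v\<close>.\<close>

lemma E_empty_bins:
  assumes "X \<subseteq> U"
  shows "E (empty_bins X) = n * avoid X"
proof -
  obtain \<Lambda> where \<Lambda>: "\<And>x. par \<Lambda> x" using par_all by blast
  have "E (empty_bins X) = E (\<lambda>T. \<Sum>v<n. of_bool (v \<notin> h T ` X))"
  proof (rule E_cong)
    fix T assume T: "T \<in> \<Omega>"
    have sub: "h T ` X \<subseteq> {..<n}" by (rule hash_image_subset) fact+
    have "(\<Sum>v<n. of_bool (v \<notin> h T ` X)) = real (card ({..<n} - h T ` X))"
      by (simp add: of_bool_def sum.If_cases Int_def set_diff_eq)
    also have "\<dots> = real (n - card (h T ` X))"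
      using sub finite_subset[OF sub] by (simp add: card_Diff_subset)
    also have "\<dots> = empty_bins X T"
      using card_mono[OF _ sub] by (simp add: empty_bins_def of_nat_diff)
    finally show "empty_bins X T = (\<Sum>v<n. of_bool (v \<notin> h T ` X))" by simp
  qed
  also have "\<dots> = (\<Sum>v<n. P (\<lambda>T. v \<notin> h T ` X))" unfolding P_def by (rule E_sum)
  also have "\<dots> = (\<Sum>v<n. avoid X)"
  proof (rule sum.cong[OF refl])
    fix v assume v: "v \<in> {..<n}"
    have "P (\<lambda>T. v \<notin> h T ` X) = P (\<lambda>T. v \<notin> h (shift v \<Lambda> T) ` X)"
      unfolding P_def using E_shift[of v "\<lambda>T. of_bool (v \<notin> h T ` X)" \<Lambda>] v by simp
    also have "\<dots> = avoid X"
      unfolding avoid_def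
    proof (rule P_cong)
      fix T
      have "h (shift v \<Lambda> T) ` X = xor v ` (h T ` X)"
        by (rule hash_shift_image_moved) (use assms \<Lambda> in auto)
      moreover have "v \<in> xor v ` W \<longleftrightarrow> 0 \<in> W" for W :: "nat set"
      proof -
        have "xor v w = v \<longleftrightarrow> w = 0" for w unfolding xor_nat_eq_iff[of v w v] by simp
        moreover have "v \<in> xor v ` W \<longleftrightarrow> (\<exists>w\<in>W. xor v w = v)"
          unfolding image_iff eq_commute[of v] ..
        ultimately show ?thesis by simp
      qed
      ultimately show "v \<notin> h (shift v \<Lambda> T) ` X \<longleftrightarrow> 0 \<notin> h T ` X" by simp
    qed
    finally show "P (\<lambda>T. v \<notin> h T ` X) = avoid X" .
  qed
  finally show ?thesis by simp
qed


text \<open>A functional odd on \<open>x\<close> and even on \<open>Y\<close> makes the hash of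
  \<open>x\<close> uniform while freezing everything \<open>Q\<close> and \<open>g\<close> depend
  on; exactly one of the \<open>n\<close> shifts hits the target.\<close>

lemma P_hash_eq_outside_span:
  assumes x: "x \<in> U" and Y: "Y \<subseteq> U" and ns: "\<not> spanned x Y"
    and Q: "\<And>T T'. (\<And>y. y \<in> Y \<Longrightarrow> h T y = h T' y) \<Longrightarrow> Q T \<longleftrightarrow> Q T'"
    and g: "\<And>T T'. (\<And>y. y \<in> Y \<Longrightarrow> h T y = h T' y) \<Longrightarrow> g T = g T'" "\<And>T. T \<in> \<Omega> \<Longrightarrow> g T < n"
  shows "P (\<lambda>T. Q T \<and> h T x = g T) = P Q / n"
proof -
  obtain \<Lambda> where \<Lambda>: "par \<Lambda> x" "\<And>y. y \<in> Y \<Longrightarrow> \<not> par \<Lambda> y"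
    using separating_functional[OF finite_keys_subset[OF Y] ns] by blast
  have "P (\<lambda>T. Q T \<and> h T x = g T) =
      E (\<lambda>T. (\<Sum>a<n. of_bool (Q (shift a \<Lambda> T) \<and> h (shift a \<Lambda> T) x = g (shift a \<Lambda> T))) / n)"
    unfolding P_def by (rule E_average)
  also have "\<dots> = E (\<lambda>T. 1 / n * of_bool (Q T))"
  proof (rule E_cong)
    fix T assume T: "T \<in> \<Omega>"
    have fixY: "h (shift a \<Lambda> T) y = h T y" if "y \<in> Y" for a y
      using hash_shift[of y a \<Lambda> T] \<Lambda>(2)[OF that] subsetD[OF Y that] by simp
    have QT: "Q (shift a \<Lambda> T) \<longleftrightarrow> Q T" for a by (rule Q) (rule fixY)
    have gT: "g (shift a \<Lambda> T) = g T" for a by (rule g(1)) (rule fixY)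
    have hx: "h (shift a \<Lambda> T) x = g T \<longleftrightarrow> a = xor (h T x) (g T)" for a
    proof -
      have "h (shift a \<Lambda> T) x = xor (h T x) a" using hash_shift[OF x, of a \<Lambda> T] \<Lambda>(1) by (simp add: xor.commute)
      then show ?thesis using xor_nat_eq_iff by simp
    qed
    have "xor (h T x) (g T) < n" using hash_less[OF x T] g(2)[OF T] by (rule xor_nat_less_power)
    then have "(\<Sum>a<n. of_bool (Q T \<and> a = xor (h T x) (g T))) = (of_bool (Q T) :: real)"
      by (cases "Q T") (auto simp: of_bool_def)
    then show "(\<Sum>a<n. of_bool (Q (shift a \<Lambda> T) \<and> h (shift a \<Lambda> T) x = g (shift a \<Lambda> T))) / n =
        1 / n * (of_bool (Q T) :: real)"
      unfolding QT gT hx by simp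
  qed
  also have "\<dots> = P Q / n" unfolding E_cmult P_def by simp
  finally show ?thesis .
qed

section \<open>Independent key sets and the union bound over dependencies\<close>

definition independent :: "(nat \<Rightarrow> nat) set \<Rightarrow> bool" where
  "independent F \<longleftrightarrow> (\<forall>y\<in>F. \<not> spanned y (F - {y}))"

lemma independent_subset:
  assumes "independent F" "G \<subseteq> F"
  shows "independent G"
  unfolding independent_def
proof (intro ballI notI)
  fix y assume "y \<in> G" "spanned y (G - {y})"
  moreover have "G - {y} \<subseteq> F - {y}" using assms(2) by auto
  ultimately show False using assms spanned_mono unfolding independent_def by blast
qed

definition collide :: "(nat \<Rightarrow> nat) set \<Rightarrow> (nat \<Rightarrow> nat \<Rightarrow> nat) \<Rightarrow> bool" where
  "collide F T \<longleftrightarrow> (\<forall>y\<in>F. \<forall>z\<in>F. h T y = h T z)"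

lemma P_collide_insert:
  assumes "insert x F \<subseteq> U" "F \<noteq> {}" "\<not> spanned x F"
  shows "P (collide (insert x F)) = P (collide F) / n"
proof -
  obtain y where y: "y \<in> F" using assms(2) by blast
  have "P (collide (insert x F)) = P (\<lambda>T. collide F T \<and> h T x = h T y)"
  proof (rule P_cong)
    fix T
    show "collide (insert x F) T \<longleftrightarrow> collide F T \<and> h T x = h T y"
      using y unfolding collide_def by (metis insert_iff)
  qed
  also have "\<dots> = P (collide F) / n"
  proof (rule P_hash_eq_outside_span)
    show "collide F T \<longleftrightarrow> collide F T'" if "\<And>y. y \<in> F \<Longrightarrow> h T y = h T' y" for T T'
      using that unfolding collide_def by simp
  qed (use assms y hash_less in auto)
  finally show ?thesis .
qed

lemma P_collide_independent:
  assumes "finite F" "F \<noteq> {}" "F \<subseteq> U" "independent F"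
  shows "P (collide F) \<le> 1 / real n ^ (card F - 1)"
  using assms
proof (induction F rule: finite_ne_induct)
  case (singleton x)
  then show ?case using P_le_1 by simp
next
  case (insert x F)
  have "\<not> spanned x F" using insert.prems(2) insert.hyps(3) unfolding independent_def by auto
  then have "P (collide (insert x F)) = P (collide F) / n"
    using insert by (intro P_collide_insert) auto
  also have "\<dots> \<le> (1 / real n ^ (card F - 1)) / n"
  proof (rule divide_right_mono)
    have "independent F" using insert.prems(2) by (rule independent_subset) auto
    then show "P (collide F) \<le> 1 / real n ^ (card F - 1)" using insert by auto
  qed simp
  also have "\<dots> = 1 / real n ^ (Suc (card F - 1))" by simp
  also have "Suc (card F - 1) = card (insert x F) - 1"
    using insert.hyps by (simp add: card_gt_0_iff)
  finally show ?case .
qed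

definition covers :: "(nat \<Rightarrow> nat) set \<Rightarrow> (nat \<Rightarrow> nat) \<Rightarrow> bool" where
  "covers F x \<longleftrightarrow> (\<forall>i<c. \<exists>y\<in>F. y i = x i)"

lemma card_covered_le:
  assumes "finite F" "card F \<le> c"
  shows "card {x \<in> U. covers F x} \<le> c ^ c"
proof -
  have "{x \<in> U. covers F x} \<subseteq> PiE {0..<c} (\<lambda>i. (\<lambda>y. y i) ` F)"
  proof
    fix x assume x: "x \<in> {x \<in> U. covers F x}"
    have "x i \<in> (\<lambda>y. y i) ` F" if i: "i < c" for i
    proof -
      obtain y where "y \<in> F" "y i = x i" using x i unfolding covers_def by blast
      then show ?thesis by (metis imageI)
    qed
    then show "x \<in> PiE {0..<c} (\<lambda>i. (\<lambda>y. y i) ` F)"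
      using x unfolding tab_keys_def by (simp add: PiE_iff)
  qed
  then have "card {x \<in> U. covers F x} \<le> card (PiE {0..<c} (\<lambda>i. (\<lambda>y. y i) ` F))"
    by (rule card_mono[rotated]) (use assms in \<open>auto intro: finite_PiE\<close>)
  also have "\<dots> = (\<Prod>i\<in>{0..<c}. card ((\<lambda>y. y i) ` F))" by (simp add: card_PiE)
  also have "\<dots> \<le> (\<Prod>i\<in>{0..<c}. c)"
    using assms card_image_le[OF assms(1)] by (intro prod_mono) (auto intro: order_trans)
  finally show ?thesis by simp
qed

text \<open>A minimal dependency of \<open>x\<close> contains at most \<open>c\<close> keys that together carry every character of
  \<open>x\<close>. These determine \<open>x\<close> up to \<open>c\<^sup>c\<close> possibilities, so \<open>x\<close> contributes no factor \<open>m\<close> to the union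
  bound over such configurations.\<close>

lemma spanned_by_colliders_witness:
  assumes X: "X \<subseteq> U" and x: "x \<in> X" and sp: "spanned x {y \<in> X - {x}. h T y = h T x}"
  shows "\<exists>F. F \<subseteq> X - {x} \<and> F \<noteq> {} \<and> card F \<le> c \<and> independent F \<and> collide (insert x F) T \<and>
    (covers F x \<and> \<not> spanned x F \<or> 3 \<le> card F \<and> xsum (vec c) F = vec c x)"
proof -
  let ?Y = "{y \<in> X - {x}. h T y = h T x}"
  have finX: "finite X" by (rule finite_keys_subset) fact
  let ?ok = "\<lambda>D. D \<subseteq> ?Y \<and> xsum (vec c) D = vec c x"
  obtain D0 where "?ok D0" using sp unfolding spanned_def by (elim exE)
  from ex_has_least_nat[where P = ?ok and m = card, OF this]
  obtain D where least: "?ok D \<and> (\<forall>E. ?ok E \<longrightarrow> card D \<le> card E)" by (elim exE)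
  then have D: "D \<subseteq> ?Y" "xsum (vec c) D = vec c x" by simp_all
  have min: "card D \<le> card E" if "E \<subseteq> ?Y" "xsum (vec c) E = vec c x" for E
    using least that by simp
  have finD: "finite D" by (rule finite_subset[OF _ finX]) (use D in auto)
  have proper: "xsum (vec c) E \<noteq> vec c x" if "E \<subset> D" for E
    using min[of E] D(1) that psubset_card_mono[OF finD that] by auto
  \<comment> \<open>Exchange: if \<open>y\<close> were a sum over the rest of \<open>D\<close>,
    substituting that sum for \<open>y\<close> would represent \<open>x\<close> by a proper subset
    of \<open>D\<close>, against minimality.\<close>
  have ind: "independent D"
    unfolding independent_def
  proof (intro ballI notI)
    fix y assume y: "y \<in> D" and "spanned y (D - {y})"
    then obtain E where E: "E \<subseteq> D - {y}" "xsum (vec c) E = vec c y" unfolding spanned_def by blast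
    have finE: "finite E" using E finD finite_subset by blast
    have "xsum (vec c) (sym_diff (D - {y}) E) = sym_diff (xsum (vec c) (D - {y})) (vec c y)"
      using xsum_sym_diff[of "D - {y}" E "vec c"] finD finE E(2) by simp
    also have "\<dots> = xsum (vec c) (insert y (D - {y}))"
      using xsum_insert[of "D - {y}" y "vec c"] finD by simp
    also have "\<dots> = vec c x" using y D by (simp add: insert_absorb)
    finally have "xsum (vec c) (sym_diff (D - {y}) E) = vec c x" .
    moreover have "sym_diff (D - {y}) E \<subset> D" using E y by blast
    ultimately show False using proper by blast
  qed
  \<comment> \<open>One key of \<open>D\<close> for each character of \<open>x\<close>, which makes
    \<open>F\<close> of size at most \<open>c\<close> and covering.\<close>
  define w where "w i = (SOME y. y \<in> D \<and> y i = x i)" for i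
  have w: "w i \<in> D \<and> w i i = x i" if "i < c" for i
    unfolding w_def by (rule someI_ex[OF xsum_covers[OF D(2) that, unfolded Bex_def]])
  define F where "F = w ` {0..<c}"
  have FD: "F \<subseteq> D" using w by (auto simp: F_def)
  have Fc: "card F \<le> c" unfolding F_def using card_image_le[of "{0..<c}" w] by simp
  have Fne: "F \<noteq> {}" using c_pos by (auto simp: F_def)
  have Fcov: "covers F x" unfolding covers_def F_def using w by force
  have Findep: "independent F" using ind FD by (rule independent_subset)
  have FX: "F \<subseteq> X - {x}" using FD D by auto
  have hF: "h T y = h T x" if "y \<in> insert x F" for y using that FD D by auto
  have Fcol: "collide (insert x F) T"
    unfolding collide_def
  proof (intro ballI)
    fix y z assume "y \<in> insert x F" "z \<in> insert x F"
    from hF[OF this(1)] hF[OF this(2)] show "h T y = h T z" by presburger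
  qed
  \<comment> \<open>If \<open>F\<close> is proper in \<open>D\<close>, minimality puts
    \<open>x\<close> outside its span and colliding with \<open>F\<close> costs another factor
    \<open>1 / n\<close>. If \<open>F = D\<close> that factor is missing, but
    \<open>insert x F\<close> is zero-sum and such sets are rare.\<close>
  have "\<not> spanned x F \<or> 3 \<le> card F \<and> xsum (vec c) F = vec c x"
  proof (cases "F = D")
    case True
    have "3 \<le> card F"
      using xsum_eq_vec_cases[of F x] FX X x D(2) True by auto
    then show ?thesis using True D by simp
  next
    case False
    have "\<not> spanned x F"
    proof
      assume "spanned x F"
      then obtain E where E: "E \<subseteq> F" "xsum (vec c) E = vec c x"
        unfolding spanned_def by (elim exE conjE)
      have "E \<subset> D" using E(1) FD False by blast
      from proper[OF this] E(2) show False by (rule notE)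
    qed
    then show ?thesis by (rule disjI1)
  qed
  then have "covers F x \<and> \<not> spanned x F \<or> 3 \<le> card F \<and> xsum (vec c) F = vec c x"
    using Fcov by (elim disjE) simp_all
  then show ?thesis using FX Fne Fc Findep Fcol by (intro exI[of _ F] conjI)
qed

text \<open>With \<rho> = m / n, covering witnesses of size k number at most \<open>c ^ c\<close>
  times the k-th power of m and have probability at most the k-th power of 1 / n. Witnesses
  completing a zero-sum set of size 2j number O(m^j) at probability at most n^-(2j - 2). As \<rho>
  is at most 1 and j is at least 2, both kinds contribute O(\<rho>).\<close>

lemma sum_spanned_by_colliders_le:
  assumes X: "X \<subseteq> U" and m: "card X \<le> n"
  shows "(\<Sum>x\<in>X. spanned_by_colliders x X) \<le>
    (real c * real c ^ c + real c * (2 * real c * (6 * fact (2 * c)) ^ c)) * (card X / n)"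
proof -
  have finX: "finite X" by (rule finite_keys_subset) fact
  define \<rho> where "\<rho> = card X / real n"
  have \<rho>: "0 \<le> \<rho>" "\<rho> \<le> 1" "card X = \<rho> * n"
    using m by (simp_all add: \<rho>_def of_nat_le_iff[symmetric] del: of_nat_le_iff)
  have \<rho>pow: "\<rho> ^ k \<le> \<rho>" if "1 \<le> k" for k
    using power_decreasing[OF that \<rho>(1,2)] by simp
  define A1 where "A1 x = {F. F \<subseteq> X - {x} \<and> F \<noteq> {} \<and> card F \<le> c \<and> independent F \<and> covers F x \<and> \<not> spanned x F}" for x
  define A2 where "A2 x = {F. F \<subseteq> X - {x} \<and> card F \<le> c \<and> independent F \<and> 3 \<le> card F \<and> xsum (vec c) F = vec c x}" for x
  have finA: "finite (A1 x)" "finite (A2 x)" for x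
    using finX by (auto simp: A1_def A2_def intro: rev_finite_subset[OF finite_Pow_iff[THEN iffD2, OF finX]])
  have finF: "finite F" if "F \<subseteq> X" for F using that finX finite_subset by blast
  have one: "spanned_by_colliders x X \<le>
      (\<Sum>F\<in>A1 x. 1 / real n ^ card F) + (\<Sum>F\<in>A2 x. 1 / real n ^ (card F - 1))" if x: "x \<in> X" for x
  proof -
    have "spanned_by_colliders x X \<le>
        P (\<lambda>T. (\<exists>F\<in>A1 x. collide (insert x F) T) \<or> (\<exists>F\<in>A2 x. collide (insert x F) T))"
      unfolding spanned_by_colliders_def
    proof (rule P_mono)
      fix T assume "spanned x {y \<in> X - {x}. h T y = h T x}"
      from spanned_by_colliders_witness[OF X x this]
      show "(\<exists>F\<in>A1 x. collide (insert x F) T) \<or> (\<exists>F\<in>A2 x. collide (insert x F) T)"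
        unfolding A1_def A2_def by blast
    qed
    also have "\<dots> \<le> P (\<lambda>T. \<exists>F\<in>A1 x. collide (insert x F) T) + P (\<lambda>T. \<exists>F\<in>A2 x. collide (insert x F) T)"
      by (rule P_disj)
    also have "\<dots> \<le> (\<Sum>F\<in>A1 x. P (collide (insert x F))) + (\<Sum>F\<in>A2 x. P (collide (insert x F)))"
      by (intro add_mono P_bex_le finA)
    also have "\<dots> \<le> (\<Sum>F\<in>A1 x. 1 / real n ^ card F) + (\<Sum>F\<in>A2 x. 1 / real n ^ (card F - 1))"
    proof (intro add_mono sum_mono)
      fix F assume F: "F \<in> A1 x"
      then have FX: "F \<subseteq> X" "F \<noteq> {}" "\<not> spanned x F" by (auto simp: A1_def)
      have "P (collide (insert x F)) = P (collide F) / n"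
        by (rule P_collide_insert) (use FX X x in auto)
      also have "\<dots> \<le> 1 / real n ^ (card F - 1) / n"
        using P_collide_independent[of F] finF[OF FX(1)] FX X F
        by (intro divide_right_mono) (auto simp: A1_def)
      also have "\<dots> = 1 / real n ^ Suc (card F - 1)" by simp
      also have "Suc (card F - 1) = card F" using FX finF by (simp add: card_gt_0_iff)
      finally show "P (collide (insert x F)) \<le> 1 / real n ^ card F" .
    next
      fix F assume F: "F \<in> A2 x"
      then have FX: "F \<subseteq> X" "F \<noteq> {}" "independent F" by (auto simp: A2_def)
      have "P (collide (insert x F)) \<le> P (collide F)"
        by (rule P_mono) (unfold collide_def, blast)
      also have "\<dots> \<le> 1 / real n ^ (card F - 1)"
        using FX X finF by (intro P_collide_independent) auto
      finally show "P (collide (insert x F)) \<le> 1 / real n ^ (card F - 1)" .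
    qed
    finally show ?thesis .
  qed
  define S1 where "S1 k = {(x, F). x \<in> X \<and> F \<in> A1 x \<and> card F = k}" for k
  \<comment> \<open>Indexed by half the size of the zero-sum set \<open>insert x F\<close>, hence
    the successor.\<close>
  define S2 where "S2 j = {(x, F). x \<in> X \<and> F \<in> A2 x \<and> Suc (card F) = 2 * j}" for j
  have part1: "(\<Sum>x\<in>X. \<Sum>F\<in>A1 x. 1 / real n ^ card F) = (\<Sum>k\<in>{1..c}. card (S1 k) / real n ^ k)"
  proof -
    have "(\<Sum>x\<in>X. \<Sum>F\<in>A1 x. 1 / real n ^ card F) = (\<Sum>p\<in>Sigma X A1. 1 / real n ^ card (snd p))"
      using finX finA by (simp add: sum.Sigma case_prod_unfold)
    also have "\<dots> = (\<Sum>k\<in>{1..c}. \<Sum>p | p \<in> Sigma X A1 \<and> card (snd p) = k. 1 / real n ^ card (snd p))"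
    proof (rule sum.group[symmetric])
      show "(\<lambda>p. card (snd p)) ` Sigma X A1 \<subseteq> {1..c}"
      proof
        fix k assume "k \<in> (\<lambda>p. card (snd p)) ` Sigma X A1"
        then obtain x F where F: "F \<in> A1 x" "k = card F" by auto
        then have "F \<subseteq> X" "F \<noteq> {}" "card F \<le> c" by (auto simp: A1_def)
        then show "k \<in> {1..c}" using finF[of F] F(2) by (simp add: Suc_le_eq card_gt_0_iff)
      qed
    qed (use finX finA in auto)
    also have "\<dots> = (\<Sum>k\<in>{1..c}. card (S1 k) / real n ^ k)"
    proof (rule sum.cong[OF refl])
      fix k
      have "{p. p \<in> Sigma X A1 \<and> card (snd p) = k} = S1 k" by (auto simp: S1_def)
      then show "(\<Sum>p | p \<in> Sigma X A1 \<and> card (snd p) = k. 1 / real n ^ card (snd p)) = card (S1 k) / real n ^ k"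
        by (simp add: S1_def case_prod_unfold)
    qed
    finally show ?thesis .
  qed
  have part2: "(\<Sum>x\<in>X. \<Sum>F\<in>A2 x. 1 / real n ^ (card F - 1)) = (\<Sum>j\<in>{2..c}. card (S2 j) / real n ^ (2 * j - 2))"
  proof -
    have even: "Suc (card F) = 2 * (Suc (card F) div 2)" if "F \<in> A2 x" for x F
    proof -
      have "odd (card F)" using that by (intro odd_card_if_xsum_eq_vec[of F x] finF) (auto simp: A2_def)
      then show ?thesis by simp
    qed
    have "(\<Sum>x\<in>X. \<Sum>F\<in>A2 x. 1 / real n ^ (card F - 1)) = (\<Sum>p\<in>Sigma X A2. 1 / real n ^ (card (snd p) - 1))"
      using finX finA by (simp add: sum.Sigma case_prod_unfold)
    also have "\<dots> = (\<Sum>j\<in>{2..c}. \<Sum>p | p \<in> Sigma X A2 \<and> Suc (card (snd p)) div 2 = j. 1 / real n ^ (card (snd p) - 1))"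
    proof (rule sum.group[symmetric])
      show "(\<lambda>p. Suc (card (snd p)) div 2) ` Sigma X A2 \<subseteq> {2..c}"
        by (auto simp: A2_def)
    qed (use finX finA in auto)
    also have "\<dots> = (\<Sum>j\<in>{2..c}. card (S2 j) / real n ^ (2 * j - 2))"
    proof (rule sum.cong[OF refl])
      fix j
      have "{p. p \<in> Sigma X A2 \<and> Suc (card (snd p)) div 2 = j} = S2 j"
        using even by (auto simp: S2_def)
      moreover have "card (snd p) - 1 = 2 * j - 2" if "p \<in> S2 j" for p using that by (auto simp: S2_def)
      ultimately show "(\<Sum>p | p \<in> Sigma X A2 \<and> Suc (card (snd p)) div 2 = j. 1 / real n ^ (card (snd p) - 1)) =
          card (S2 j) / real n ^ (2 * j - 2)" by simp
    qed
    finally show ?thesis .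
  qed
  have b1: "card (S1 k) / real n ^ k \<le> real c ^ c * \<rho>" if k: "k \<in> {1..c}" for k
  proof -
    let ?B = "{F. F \<subseteq> X \<and> card F = k}"
    have finB: "finite ?B" using finX by (simp add: rev_finite_subset[OF finite_Pow_iff[THEN iffD2, OF finX]] subset_eq)
    have "card (S1 k) \<le> card (SIGMA F:?B. {x \<in> U. covers F x})"
    proof (rule card_inj_on_le[where f = "\<lambda>(x, F). (F, x)"])
      show "inj_on (\<lambda>(x, F). (F, x)) (S1 k)" by (auto simp: inj_on_def)
      show "(\<lambda>(x, F). (F, x)) ` S1 k \<subseteq> (SIGMA F:?B. {x \<in> U. covers F x})"
        using X by (auto simp: S1_def A1_def)
      show "finite (SIGMA F:?B. {x \<in> U. covers F x})" using finB by auto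
    qed
    also have "\<dots> = (\<Sum>F\<in>?B. card {x \<in> U. covers F x})" using finB by (simp add: card_SigmaI)
    also have "\<dots> \<le> (\<Sum>F\<in>?B. c ^ c)" using finF k by (intro sum_mono card_covered_le) auto
    also have "\<dots> = (card X choose k) * c ^ c" using n_subsets[OF finX, of k] by simp
    also have "\<dots> \<le> card X ^ k * c ^ c"
      by (rule mult_right_mono, cases "k \<le> card X") (auto intro: binomial_le_pow simp: binomial_eq_0)
    finally have "real (card (S1 k)) \<le> real (card X ^ k * c ^ c)" by (rule of_nat_mono)
    also have "\<dots> = (\<rho> ^ k * real c ^ c) * real n ^ k" by (simp add: \<rho>(3) power_mult_distrib)
    finally have "card (S1 k) / real n ^ k \<le> \<rho> ^ k * real c ^ c" by (simp add: divide_le_eq)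
    also have "\<dots> \<le> \<rho> * real c ^ c" using k \<rho>pow by (intro mult_right_mono) auto
    finally show ?thesis by (simp add: mult.commute)
  qed
  have b2: "card (S2 j) / real n ^ (2 * j - 2) \<le> 2 * real c * (6 * fact (2 * c)) ^ c * \<rho>" if j: "j \<in> {2..c}" for j
  proof -
    let ?Z = "{G. G \<subseteq> X \<and> card G = 2 * j \<and> xsum (vec c) G = {}}"
    have finZ: "finite ?Z" by (rule finite_subset[of _ "Pow X"]) (use finX in auto)
    \<comment> \<open>Each configuration is a zero-sum set with one marked key, which recovers both
      \<open>x\<close> and \<open>F\<close>.\<close>
    have "card (S2 j) \<le> card (SIGMA G:?Z. G)"
    proof (rule card_inj_on_le[where f = "\<lambda>(x, F). (insert x F, x)"])
      show "inj_on (\<lambda>(x, F). (insert x F, x)) (S2 j)"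
      proof (rule inj_onI)
        fix p q assume pq: "p \<in> S2 j" "q \<in> S2 j" "(case p of (x, F) \<Rightarrow> (insert x F, x)) = (case q of (x, F) \<Rightarrow> (insert x F, x))"
        obtain x F y G where eq: "p = (x, F)" "q = (y, G)" by (metis surj_pair)
        have "x \<notin> F" "y \<notin> G" using pq eq by (auto simp: S2_def A2_def)
        then show "p = q" using pq(3) eq by (auto simp: insert_ident)
      qed
      show "(\<lambda>(x, F). (insert x F, x)) ` S2 j \<subseteq> (SIGMA G:?Z. G)"
      proof clarify
        fix x F assume xF: "(x, F) \<in> S2 j"
        then have F: "x \<in> X" "F \<subseteq> X" "x \<notin> F" "xsum (vec c) F = vec c x" "Suc (card F) = 2 * j"
          by (auto simp: S2_def A2_def)
        then have "xsum (vec c) (insert x F) = {}" "card (insert x F) = 2 * j"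
          using finF[OF F(2)] by (auto simp: xsum_insert)
        then show "insert x F \<in> ?Z \<and> x \<in> insert x F" using F by auto
      qed
      show "finite (SIGMA G:?Z. G)" using finZ finF by auto
    qed
    also have "\<dots> = (\<Sum>G\<in>?Z. card G)" using finZ finF by (intro card_SigmaI) auto
    also have "\<dots> = card ?Z * (2 * j)" by simp
    finally have "real (card (S2 j)) \<le> card ?Z * (2 * real j)"
      by (metis (mono_tags, lifting) of_nat_mono of_nat_mult of_nat_numeral)
    also have "\<dots> \<le> ((6 * fact (2 * j)) ^ c * real (card X) ^ j) * (2 * real j)"
      using j X by (intro mult_right_mono card_zero_sum_subsets_le) auto
    also have "\<dots> \<le> ((6 * fact (2 * c)) ^ c * (\<rho> * real n ^ (2 * j - 2))) * (2 * real c)"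
    proof (intro mult_mono power_mono)
      \<comment> \<open>Here \<open>j \<le> 2 * j - 2\<close>, because nontrivial dependencies have
        at least three keys.\<close>
      show "real (card X) ^ j \<le> \<rho> * real n ^ (2 * j - 2)"
        unfolding \<rho>(3) power_mult_distrib using j \<rho> \<rho>pow[of j] by (intro mult_mono power_increasing) auto
      show "fact (2 * j) \<le> (fact (2 * c) :: real)" using j by (intro fact_mono) auto
    qed (use j \<rho> in auto)
    finally show ?thesis by (simp add: divide_le_eq mult_ac)
  qed
  have "(\<Sum>x\<in>X. spanned_by_colliders x X) \<le>
      (\<Sum>x\<in>X. (\<Sum>F\<in>A1 x. 1 / real n ^ card F) + (\<Sum>F\<in>A2 x. 1 / real n ^ (card F - 1)))"
    by (rule sum_mono) (rule one)
  also have "\<dots> = (\<Sum>k\<in>{1..c}. card (S1 k) / real n ^ k) + (\<Sum>j\<in>{2..c}. card (S2 j) / real n ^ (2 * j - 2))"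
    unfolding sum.distrib part1 part2 ..
  also have "\<dots> \<le> (\<Sum>k\<in>{1..c}. real c ^ c * \<rho>) + (\<Sum>j\<in>{2..c}. 2 * real c * (6 * fact (2 * c)) ^ c * \<rho>)"
    by (intro add_mono sum_mono b1 b2)
  also have "\<dots> \<le> real c * (real c ^ c * \<rho>) + real c * (2 * real c * (6 * fact (2 * c)) ^ c * \<rho>)"
    using \<rho> by (intro add_mono) (auto intro!: mult_right_mono)
  finally show ?thesis by (simp add: \<rho>_def algebra_simps)
qed

section \<open>Variance of the number of collisions\<close>


lemma spanned_cases:
  assumes "spanned x Y" "Y \<subseteq> U" "x \<in> U"
  shows "x \<in> Y \<or> (\<exists>D\<subseteq>Y. 3 \<le> card D \<and> xsum (vec c) D = vec c x)"
proof -
  obtain D where D: "D \<subseteq> Y" "xsum (vec c) D = vec c x"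
    using assms(1) unfolding spanned_def by (elim exE conjE)
  have "D = {x} \<or> 3 \<le> card D" by (rule xsum_eq_vec_cases) (use D assms in auto)
  then show ?thesis
  proof
    assume "3 \<le> card D"
    then show ?thesis using D by (intro disjI2 exI[of _ D] conjI)
  qed (use D in auto)
qed

lemma P_True: "P (\<lambda>_. True) = 1"
  using E_const[of 1] by (simp add: P_def)

lemma P_hash_eq:
  assumes "x \<in> U" "y \<in> U" "x \<noteq> y"
  shows "P (\<lambda>T. h T x = h T y) = 1 / n"
proof -
  have "\<not> spanned x {y}"
  proof
    assume "spanned x {y}"
    from spanned_cases[OF this] assms obtain D where "D \<subseteq> {y}" "3 \<le> card D" by blast
    then show False using card_mono[of "{y}" D] by simp
  qed
  then have "P (\<lambda>T. True \<and> h T x = h T y) = P (\<lambda>_. True) / n"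
    using assms hash_less by (intro P_hash_eq_outside_span[where Y = "{y}"]) auto
  then show ?thesis by (simp add: P_True)
qed

text \<open>The only configurations in which the collisions of two pairs of distinct keys can be
  correlated; \<open>P_two_collisions\<close> shows independence in all others.\<close>

definition dependent_pairs :: "(nat \<Rightarrow> nat) \<times> (nat \<Rightarrow> nat) \<Rightarrow> (nat \<Rightarrow> nat) \<times> (nat \<Rightarrow> nat) \<Rightarrow> bool" where
  "dependent_pairs p q \<longleftrightarrow> {fst q, snd q} \<subseteq> {fst p, snd p} \<or>
    card {fst p, snd p, fst q, snd q} = 4 \<and> xsum (vec c) {fst p, snd p, fst q, snd q} = {}"

text \<open>The key revealed last is \<open>w\<close> if it is outside the span of the other three,
  and \<open>z\<close> if \<open>w\<close> already belongs to the first pair. In the remaining case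
  \<open>w\<close> is the sum of three distinct keys, which makes a zero-sum quadruple.\<close>

lemma P_two_collisions:
  assumes U: "x \<in> U" "y \<in> U" "z \<in> U" "w \<in> U" and ne: "x \<noteq> y" "z \<noteq> w"
    and indep: "\<not> dependent_pairs (x, y) (z, w)"
  shows "P (\<lambda>T. h T x = h T y \<and> h T z = h T w) = (1 / n)\<^sup>2"
proof -
  have two: "P (\<lambda>T. h T x = h T y) / n = (1 / n)\<^sup>2"
    using P_hash_eq[OF U(1,2) ne(1)] by (simp add: power2_eq_square)
  consider "\<not> spanned w {x, y, z}" | "w \<in> {x, y}" | D where "w \<notin> {x, y}" "D \<subseteq> {x, y, z}" "3 \<le> card D" "xsum (vec c) D = vec c w"
    using spanned_cases[of w "{x, y, z}"] U ne by auto
  then show ?thesis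
  proof cases
    case 1
    have "P (\<lambda>T. h T x = h T y \<and> h T w = h T z) = P (\<lambda>T. h T x = h T y) / n"
      using 1 U hash_less by (intro P_hash_eq_outside_span[where Y = "{x, y, z}"]) auto
    then show ?thesis using two by (simp add: eq_commute[of "h _ z"])
  next
    case 2
    have "\<not> spanned z {x, y}"
    proof
      assume "spanned z {x, y}"
      moreover have "z \<notin> {x, y}" using 2 indep by (auto simp: dependent_pairs_def)
      ultimately obtain D where "D \<subseteq> {x, y}" "3 \<le> card D"
        using spanned_cases[of z "{x, y}"] U by auto
      then show False using card_mono[of "{x, y}" D] ne by simp
    qed
    then have "P (\<lambda>T. h T x = h T y \<and> h T z = h T w) = P (\<lambda>T. h T x = h T y) / n"
      using 2 U hash_less by (intro P_hash_eq_outside_span[where Y = "{x, y}"]) auto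
    then show ?thesis using two by simp
  next
    case 3
    have "card {x, y, z} \<le> 3" by (simp add: card_insert_if)
    then have D: "D = {x, y, z}" "card D = 3"
      using 3 card_mono[of "{x, y, z}" D] card_subset_eq[of "{x, y, z}" D] by auto
    have "w \<notin> D" using 3 ne D by auto
    then have "card (insert w D) = 4" "xsum (vec c) (insert w D) = {}"
      using D 3 by (auto simp: xsum_insert)
    moreover have "insert w D = {x, y, z, w}" using D by auto
    ultimately show ?thesis using indep by (simp add: dependent_pairs_def)
  qed
qed

text \<open>Given \<open>p\<close>, at most 4 choices of \<open>q\<close> stay inside it. A zero-sum
  set of 4 keys gives 4^4 = 256 ordered quadruples, and 144 is \<open>6 * fact 4\<close> from the
  count of such sets.\<close>

lemma card_dependent_pairs_le:
  assumes X: "X \<subseteq> U" and R: "R \<subseteq> {(x, y). x \<in> X \<and> y \<in> X \<and> x \<noteq> y}"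
  shows "card {(p, q). p \<in> R \<and> q \<in> R \<and> dependent_pairs p q} \<le> (4 + 256 * 144 ^ c) * (real (card X))\<^sup>2"
proof -
  have finX: "finite X" by (rule finite_keys_subset) fact
  have RX: "R \<subseteq> X \<times> X" using R by auto
  have finR: "finite R" by (rule finite_subset[OF RX]) (use finX in auto)
  let ?Z = "{F. F \<subseteq> X \<and> card F = 2 * 2 \<and> xsum (vec c) F = {}}"
  have finZ: "finite ?Z" by (rule finite_subset[of _ "Pow X"]) (use finX in auto)
  let ?A = "SIGMA p:R. {fst p, snd p} \<times> {fst p, snd p}"
  let ?B = "SIGMA F:?Z. (F \<times> F) \<times> (F \<times> F)"
  let ?B' = "snd ` ?B"
  have "{(p, q). p \<in> R \<and> q \<in> R \<and> dependent_pairs p q} \<subseteq> ?A \<union> ?B'"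
  proof
    fix pq assume pq: "pq \<in> {(p, q). p \<in> R \<and> q \<in> R \<and> dependent_pairs p q}"
    obtain x y z w where e: "pq = ((x, y), (z, w))" by (metis surj_pair)
    have inR: "(x, y) \<in> R" "(z, w) \<in> R" and dep: "dependent_pairs (x, y) (z, w)"
      using pq e by auto
    show "pq \<in> ?A \<union> ?B'"
    proof (cases "{z, w} \<subseteq> {x, y}")
      case True
      then have "pq \<in> ?A" using inR e by auto
      then show ?thesis by (rule UnI1)
    next
      case False
      then have "card {x, y, z, w} = 4" "xsum (vec c) {x, y, z, w} = {}"
        using dep[unfolded dependent_pairs_def fst_conv snd_conv] by argo+
      then have "({x, y, z, w}, pq) \<in> ?B" using inR RX e by auto
      then have "pq \<in> ?B'" by (rule image_eqI[rotated]) simp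
      then show ?thesis by (rule UnI2)
    qed
  qed
  moreover have finA: "finite ?A" using finR by auto
  moreover have finB: "finite ?B"
  proof (rule finite_SigmaI[OF finZ])
    fix F assume "F \<in> ?Z"
    then have "finite F" using finX finite_subset by blast
    then show "finite ((F \<times> F) \<times> F \<times> F)" by simp
  qed
  ultimately have "card {(p, q). p \<in> R \<and> q \<in> R \<and> dependent_pairs p q} \<le> card (?A \<union> ?B')"
    by (intro card_mono) auto
  also have "\<dots> \<le> card ?A + card ?B'" by (rule card_Un_le)
  also have "card ?B' \<le> card ?B" using finB by (rule card_image_le)
  also have "card ?B = (\<Sum>F\<in>?Z. 256)"
    using finZ by (subst card_SigmaI) (auto simp: card_cartesian_product intro: card_ge_0_finite)
  also have "card ?A \<le> (\<Sum>p\<in>R. 4)"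
  proof -
    have "card ({a, b} \<times> {a, b}) \<le> 2 * 2" for a b :: "nat \<Rightarrow> nat"
      unfolding card_cartesian_product by (intro mult_mono) (auto simp: card_insert_if)
    then have "(\<Sum>p\<in>R. card ({fst p, snd p} \<times> {fst p, snd p})) \<le> (\<Sum>p\<in>R. 2 * 2)"
      by (rule sum_mono)
    then show ?thesis using card_SigmaI[OF finR, of "\<lambda>p. {fst p, snd p} \<times> {fst p, snd p}"] by simp
  qed
  finally have "card {(p, q). p \<in> R \<and> q \<in> R \<and> dependent_pairs p q} \<le> 4 * card R + 256 * card ?Z" by simp
  then have "real (card {(p, q). p \<in> R \<and> q \<in> R \<and> dependent_pairs p q}) \<le> 4 * real (card R) + 256 * real (card ?Z)"
    by linarith
  also have "real (card R) \<le> (real (card X))\<^sup>2"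
    using card_mono[OF _ RX] finX by (simp add: card_cartesian_product power2_eq_square flip: of_nat_mult)
  also have "real (card ?Z) \<le> (6 * fact (2 * 2)) ^ c * real (card X) ^ 2"
    using X by (intro card_zero_sum_subsets_le) auto
  also have "(6 * fact (2 * 2) :: real) = 144" by (simp add: fact_numeral)
  finally show ?thesis by (simp add: algebra_simps)
qed

lemma collisions_eq_sum:
  assumes "finite R"
  shows "collisions R T = (\<Sum>p\<in>R. of_bool (h T (fst p) = h T (snd p)))"
proof -
  have "{(x, y). (x, y) \<in> R \<and> h T x = h T y} = R \<inter> {p. h T (fst p) = h T (snd p)}" by auto
  then show ?thesis using assms by (simp add: collisions_def of_bool_def sum.If_cases)
qed

text \<open>Independent pairs contribute exactly the product of their means, which cancels against
  the squared mean; each dependent pair adds at most \<open>1 / n\<close>.\<close>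

lemma
  assumes X: "X \<subseteq> U" and R: "R \<subseteq> {(x, y). x \<in> X \<and> y \<in> X \<and> x \<noteq> y}"
  shows E_collisions: "E (collisions R) = card R / n"
    and variance_collisions_le:
      "E (\<lambda>T. (collisions R T - card R / n)\<^sup>2) \<le> (4 + 256 * 144 ^ c) * (real (card X))\<^sup>2 / n"
proof -
  have finX: "finite X" by (rule finite_keys_subset) fact
  have finR: "finite R" by (rule finite_subset[of _ "X \<times> X"]) (use finX R in auto)
  let ?e = "\<lambda>p T. h T (fst p) = h T (snd p)"
  have RU: "fst p \<in> U" "snd p \<in> U" "fst p \<noteq> snd p" if "p \<in> R" for p
  proof -
    have "fst p \<in> X" "snd p \<in> X" "fst p \<noteq> snd p" using that R by auto
    then show "fst p \<in> U" "snd p \<in> U" "fst p \<noteq> snd p" using X by auto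
  qed
  have coll: "collisions R = (\<lambda>T. \<Sum>p\<in>R. of_bool (?e p T))" by (rule ext) (rule collisions_eq_sum[OF finR])
  show EY: "E (collisions R) = card R / n"
  proof -
    have "E (collisions R) = (\<Sum>p\<in>R. P (?e p))" unfolding coll P_def by (rule E_sum)
    also have "\<dots> = (\<Sum>p\<in>R. 1 / n)" using RU by (intro sum.cong refl P_hash_eq)
    finally show ?thesis by simp
  qed
  have "E (\<lambda>T. (collisions R T)\<^sup>2) = E (\<lambda>T. \<Sum>p\<in>R. \<Sum>q\<in>R. of_bool (?e p T \<and> ?e q T))"
    unfolding coll by (simp add: power2_eq_square sum_product of_bool_conj)
  also have "\<dots> = (\<Sum>p\<in>R. \<Sum>q\<in>R. P (\<lambda>T. ?e p T \<and> ?e q T))"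
    unfolding E_sum P_def ..
  also have "\<dots> \<le> (\<Sum>p\<in>R. \<Sum>q\<in>R. (1 / n)\<^sup>2 + of_bool (dependent_pairs p q) / n)"
  proof (intro sum_mono)
    fix p q assume pq: "p \<in> R" "q \<in> R"
    show "P (\<lambda>T. ?e p T \<and> ?e q T) \<le> (1 / n)\<^sup>2 + of_bool (dependent_pairs p q) / n"
    proof (cases "dependent_pairs p q")
      case True
      have "P (\<lambda>T. ?e p T \<and> ?e q T) \<le> P (?e p)" by (rule P_mono) simp
      also have "\<dots> = 1 / n" using RU[OF pq(1)] by (rule P_hash_eq)
      finally show ?thesis using True by (simp add: add_increasing)
    next
      case False
      have "P (\<lambda>T. ?e p T \<and> ?e q T) = (1 / n)\<^sup>2"
        by (rule P_two_collisions) (use RU pq False in auto)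
      then show ?thesis by simp
    qed
  qed
  also have "\<dots> = (card R / n)\<^sup>2 + (\<Sum>p\<in>R. \<Sum>q\<in>R. of_bool (dependent_pairs p q)) / n"
    by (simp add: sum.distrib sum_divide_distrib power2_eq_square)
  also have "(\<Sum>p\<in>R. \<Sum>q\<in>R. of_bool (dependent_pairs p q)) =
      real (card {(p, q). p \<in> R \<and> q \<in> R \<and> dependent_pairs p q})"
  proof -
    have "(\<Sum>p\<in>R. \<Sum>q\<in>R. of_bool (dependent_pairs p q) :: real) = (\<Sum>pq\<in>R \<times> R. of_bool (dependent_pairs (fst pq) (snd pq)))"
      by (simp add: sum.cartesian_product case_prod_unfold)
    also have "\<dots> = real (card ((R \<times> R) \<inter> {pq. dependent_pairs (fst pq) (snd pq)}))"
      using finR by (simp add: of_bool_def sum.If_cases)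
    also have "(R \<times> R) \<inter> {pq. dependent_pairs (fst pq) (snd pq)} = {(p, q). p \<in> R \<and> q \<in> R \<and> dependent_pairs p q}"
      by auto
    finally show ?thesis .
  qed
  also have "real (card {(p, q). p \<in> R \<and> q \<in> R \<and> dependent_pairs p q}) / n \<le>
      (4 + 256 * 144 ^ c) * (real (card X))\<^sup>2 / n"
    by (intro divide_right_mono card_dependent_pairs_le X R) simp
  finally have "E (\<lambda>T. (collisions R T)\<^sup>2) \<le> (card R / n)\<^sup>2 + (4 + 256 * 144 ^ c) * (real (card X))\<^sup>2 / n"
    by simp
  moreover have "E (\<lambda>T. (collisions R T - card R / n)\<^sup>2) = E (\<lambda>T. (collisions R T)\<^sup>2) - (card R / n)\<^sup>2"
  proof -
    have "E (\<lambda>T. (collisions R T - card R / n)\<^sup>2) =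
        E (\<lambda>T. ((collisions R T)\<^sup>2 - 2 * (card R / n) * collisions R T) + (card R / n)\<^sup>2)"
      by (rule E_cong) (simp add: power2_diff)
    also have "\<dots> = E (\<lambda>T. (collisions R T)\<^sup>2) - 2 * (card R / n) * E (collisions R) + (card R / n)\<^sup>2"
      unfolding E_add E_diff E_cmult by simp
    also have "\<dots> = E (\<lambda>T. (collisions R T)\<^sup>2) - (card R / n)\<^sup>2"
      unfolding EY by (simp add: power2_eq_square)
    finally show ?thesis .
  qed
  ultimately show "E (\<lambda>T. (collisions R T - card R / n)\<^sup>2) \<le> (4 + 256 * 144 ^ c) * (real (card X))\<^sup>2 / n"
    by linarith
qed

section \<open>Tail bounds\<close>


text \<open>Cantelli's inequality, followed by \<open>1 - z \<le> exp (- z)\<close>. Unlike the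
  two-sided form it stays nontrivial for arbitrarily small positive \<open>t\<close>. The auxiliary
  offset \<open>u = W / t\<close> minimizes the Markov bound.\<close>

lemma one_sided_chebyshev:
  assumes "0 \<le> E Q" "E (\<lambda>T. (Q T)\<^sup>2) \<le> W" "0 < W" "0 \<le> t"
  shows "P (\<lambda>T. Q T \<le> - t) \<le> exp (- (t\<^sup>2 / (W + t\<^sup>2)))"
proof (cases "t = 0")
  case True
  then show ?thesis using P_le_1 by simp
next
  case False
  then have t: "0 < t" using assms(4) by simp
  define u where "u = W / t"
  have u: "0 < u" using t assms(3) by (simp add: u_def)
  have "P (\<lambda>T. Q T \<le> - t) \<le> E (\<lambda>T. (u - Q T)\<^sup>2) / (t + u)\<^sup>2"
  proof (rule P_markov)
    fix T assume "Q T \<le> - t"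
    then show "(t + u)\<^sup>2 \<le> (u - Q T)\<^sup>2" using t u by (intro power_mono) auto
  qed (use t u in auto)
  also have "E (\<lambda>T. (u - Q T)\<^sup>2) = E (\<lambda>T. (u\<^sup>2 - 2 * u * Q T) + (Q T)\<^sup>2)"
    by (rule E_cong) (simp add: power2_diff)
  also have "\<dots> = u\<^sup>2 - 2 * u * E Q + E (\<lambda>T. (Q T)\<^sup>2)"
    unfolding E_add E_diff E_cmult by simp
  also have "(u\<^sup>2 - 2 * u * E Q + E (\<lambda>T. (Q T)\<^sup>2)) / (t + u)\<^sup>2 \<le> (u\<^sup>2 + W) / (t + u)\<^sup>2"
  proof (rule divide_right_mono)
    have "0 \<le> 2 * u * E Q" using u assms(1) by simp
    then show "u\<^sup>2 - 2 * u * E Q + E (\<lambda>T. (Q T)\<^sup>2) \<le> u\<^sup>2 + W" using assms(2) by linarith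
  qed simp
  also have "\<dots> = 1 - t\<^sup>2 / (W + t\<^sup>2)"
  proof -
    have pos: "0 < W + t\<^sup>2" using assms(3) by (simp add: add_pos_nonneg)
    have "u\<^sup>2 + W = W * (W + t\<^sup>2) / t\<^sup>2" "t + u = (W + t\<^sup>2) / t"
      using t by (simp_all add: u_def field_simps power2_eq_square)
    then have "(u\<^sup>2 + W) / (t + u)\<^sup>2 = W / (W + t\<^sup>2)"
      using t pos by (simp add: power_divide power2_eq_square)
    then show ?thesis using pos by (simp add: field_simps)
  qed
  also have "\<dots> \<le> exp (- (t\<^sup>2 / (W + t\<^sup>2)))"
    using exp_ge_add_one_self[of "- (t\<^sup>2 / (W + t\<^sup>2))"] by simp
  finally show ?thesis .
qed

lemma one_sided_chebyshev':
  assumes "0 \<le> E Q" "E (\<lambda>T. (Q T)\<^sup>2) \<le> W" "0 \<le> t" "W + t\<^sup>2 \<le> D" "0 < W"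
  shows "P (\<lambda>T. Q T \<le> - t) \<le> exp (- (t\<^sup>2 / D))"
proof -
  have pos: "0 < W + t\<^sup>2" using assms(5) by (simp add: add_pos_nonneg)
  then have "t\<^sup>2 / D \<le> t\<^sup>2 / (W + t\<^sup>2)"
    using assms(4) by (intro divide_left_mono mult_pos_pos) auto
  then have "exp (- (t\<^sup>2 / (W + t\<^sup>2))) \<le> exp (- (t\<^sup>2 / D))" by simp
  with one_sided_chebyshev[OF assms(1,2,5,3)] show ?thesis by (rule order_trans)
qed

text \<open>Chernoff's bound with the minimizer \<open>u / (2 * V)\<close> of the exponent when it
  is admissible, and with the largest admissible parameter \<open>1 / M\<close> otherwise, where
  \<open>2 * V \<le> u * M\<close> absorbs the quadratic term.\<close>

lemma bernstein_tail:
  assumes mgf: "\<And>l. \<bar>l\<bar> * M \<le> 1 \<Longrightarrow> E (\<lambda>T. exp (l * S T)) \<le> exp (l\<^sup>2 * V)"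
    and "0 < M" "0 < V" "0 \<le> u"
  shows "P (\<lambda>T. u \<le> S T) \<le> exp (- (min (u\<^sup>2 / V) (u / M) / 4))"
proof -
  have chernoff: "P (\<lambda>T. u \<le> S T) \<le> exp (l\<^sup>2 * V - l * u)" if l: "0 \<le> l" "l * M \<le> 1" for l
  proof -
    have "P (\<lambda>T. u \<le> S T) \<le> E (\<lambda>T. exp (l * S T)) / exp (l * u)"
      by (rule P_markov) (use l in \<open>auto intro: mult_left_mono\<close>)
    also have "\<dots> \<le> exp (l\<^sup>2 * V) / exp (l * u)"
      using mgf[of l] l by (intro divide_right_mono) auto
    finally show ?thesis by (simp add: exp_diff)
  qed
  show ?thesis
  proof (cases "u / (2 * V) * M \<le> 1")
    case True
    have "P (\<lambda>T. u \<le> S T) \<le> exp ((u / (2 * V))\<^sup>2 * V - u / (2 * V) * u)"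
      using assms True by (intro chernoff) auto
    also have "(u / (2 * V))\<^sup>2 * V - u / (2 * V) * u = - (u\<^sup>2 / V / 4)"
      using assms by (simp add: field_simps power2_eq_square)
    also have "exp (- (u\<^sup>2 / V / 4)) \<le> exp (- (min (u\<^sup>2 / V) (u / M) / 4))" by simp
    finally show ?thesis .
  next
    case False
    have "P (\<lambda>T. u \<le> S T) \<le> exp ((1 / M)\<^sup>2 * V - 1 / M * u)"
      using assms by (intro chernoff) auto
    also have "(1 / M)\<^sup>2 * V - 1 / M * u \<le> - (u / M / 4)"
    proof -
      have "2 * V \<le> u * M" using False assms by (simp add: field_simps)
      then have "V / M\<^sup>2 \<le> u * M / 2 / M\<^sup>2" by (intro divide_right_mono) auto
      also have "\<dots> = u / M / 2" using assms by (simp add: power2_eq_square)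
      finally have "(1 / M)\<^sup>2 * V - 1 / M * u \<le> - (u / M / 2)" by (simp add: power_divide)
      also have "\<dots> \<le> - (u / M / 4)"
      proof -
        have "- (q / 2) \<le> - (q / 4)" if "0 \<le> q" for q :: real using that by simp
        from this[of "u / M"] show ?thesis using assms by simp
      qed
      finally show ?thesis .
    qed
    also have "exp (- (u / M / 4)) \<le> exp (- (min (u\<^sup>2 / V) (u / M) / 4))" by simp
    finally show ?thesis by simp
  qed
qed

lemma min_half_bound:
  fixes t V M :: real
  assumes "0 < V" "0 < M" "0 \<le> t"
  shows "min (t\<^sup>2 / V) (t / M) / 16 \<le> min ((t / 2)\<^sup>2 / V) (t / 2 / M) / 4"
proof -
  have "min (t\<^sup>2 / V) (t / M) / 4 \<le> (t / 2)\<^sup>2 / V" by (simp add: power_divide)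
  moreover have "min (t\<^sup>2 / V) (t / M) / 4 \<le> t / 2 / M"
  proof -
    have "min a q / 4 \<le> q / 2" if "0 \<le> q" for a q :: real using that by (simp add: min_def)
    from this[of "t / M" "t\<^sup>2 / V"] show ?thesis using assms by simp
  qed
  ultimately show ?thesis by simp
qed

definition var_const :: real where
  "var_const = 4 + 256 * 144 ^ c"

definition bias_const :: real where
  "bias_const = real c * real c ^ c + real c * (2 * real c * (6 * fact (2 * c)) ^ c)"

text \<open>The slowest rate that occurs, in the recentered Cantelli bound: twice the second moment
  \<open>(15 + 3 * var_const) * V\<close>, plus 3/4 of \<open>t\<^sup>2 \<le> 16 * V\<close>, gives
  \<open>6 * var_const + 42\<close>; the 4 comes from using \<open>t / 2\<close>.\<close>

definition rate_const :: real where
  "rate_const = 1 / (4 * (6 * var_const + 42))"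

text \<open>The first summand is Chebyshev's inequality for collisions at \<open>t / 4\<close>; the
  second makes the bound trivial for \<open>t\<close> up to twice the bias of the mean.\<close>

definition poly_const :: real where
  "poly_const = 16 * var_const + 4 * bias_const\<^sup>2"

lemma E_empty_bins_bounds:
  assumes "X \<subseteq> U" "card X \<le> n"
  shows "n * (1 - 1 / n) ^ card X \<le> E (empty_bins X)"
    and "E (empty_bins X) \<le> n * (1 - 1 / n) ^ card X + bias_const * (card X / n)"
proof -
  show "n * (1 - 1 / n) ^ card X \<le> E (empty_bins X)"
    unfolding E_empty_bins[OF assms(1)] by (intro mult_left_mono avoid_bounds(1) assms) simp
  have "E (empty_bins X) \<le> n * ((1 - 1 / n) ^ card X + (\<Sum>x\<in>X. spanned_by_colliders x X) / n)"
    unfolding E_empty_bins[OF assms(1)] by (intro mult_left_mono avoid_bounds(2) assms) simp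
  also have "\<dots> = n * (1 - 1 / n) ^ card X + (\<Sum>x\<in>X. spanned_by_colliders x X)"
    by (simp add: distrib_left)
  finally show "E (empty_bins X) \<le> n * (1 - 1 / n) ^ card X + bias_const * (card X / n)"
    using sum_spanned_by_colliders_le[OF assms] unfolding bias_const_def by linarith
qed

lemma empty_bins_tails:
  fixes t :: real
  assumes X: "X \<subseteq> U" "X \<noteq> {}" "card X \<le> n" and t: "0 \<le> t"
  defines "m \<equiv> real (card X)"
  defines "M \<equiv> m powr (1 - 1 / real c)"
  defines "V \<equiv> M * m * m / n"
  defines "N0 \<equiv> n * (1 - 1 / n) ^ card X"
  defines "B \<equiv> min (t\<^sup>2 / V) (t / M)"
  shows "P (\<lambda>T. empty_bins X T \<le> N0 - t) \<le> exp (- rate_const * B)"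
    and "P (\<lambda>T. N0 + t \<le> empty_bins X T) \<le> exp (- rate_const * B) + poly_const * m\<^sup>2 / (n * t\<^sup>2)"
proof -
  let ?N = "empty_bins X"
  have finX: "finite X" using X(1) by (rule finite_keys_subset)
  have "1 \<le> card X" using X(2) finX by (simp add: Suc_le_eq card_gt_0_iff)
  then have m: "1 \<le> m" by (simp add: m_def)
  have mn: "m \<le> n" using X(3) unfolding m_def by (rule of_nat_mono)
  have n: "0 < real n" by simp
  have M1: "1 \<le> M" unfolding M_def using m c_pos by (intro ge_one_powr_ge_zero) auto
  have Mm: "M \<le> m"
  proof -
    have "M \<le> m powr 1" unfolding M_def using m by (intro powr_mono) auto
    then show ?thesis using m by simp
  qed
  have V0: "0 < V" using M1 m n unfolding V_def by simp
  have K1: "4 \<le> var_const" by (simp add: var_const_def)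
  have rate: "0 < rate_const" "rate_const \<le> 1 / 16"
    using K1 by (simp_all add: rate_const_def field_simps)
  have B0: "0 \<le> B" using t V0 M1 by (simp add: B_def)
  \<comment> \<open>Bounds both the distance from \<open>L\<close> to \<open>N0\<close> and the mean
    number \<open>e\<close> of collisions inside groups; as \<open>M \<le> n\<close>, its square is
    at most \<open>V\<close>.\<close>
  define b where "b = M * m / n"
  have bV: "b\<^sup>2 \<le> V"
  proof -
    have "b\<^sup>2 = V * (M / n)" by (simp add: b_def V_def power2_eq_square)
    also have "\<dots> \<le> V * 1" using Mm mn V0 n by (intro mult_left_mono) auto
    finally show ?thesis by simp
  qed
  have m2V: "m\<^sup>2 / n \<le> V"
  proof -
    have "1 * m\<^sup>2 / n \<le> M * m\<^sup>2 / n" using M1 by (intro divide_right_mono mult_right_mono) auto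
    then show ?thesis by (simp add: V_def power2_eq_square mult.assoc)
  qed
  obtain L S R where dec: "decomposition M (card X) X L S R"
    using martingale_decomposition[OF X(1) order_refl X(3), of M] unfolding M_def m_def by auto
  have R: "R \<subseteq> {(x, y). x \<in> X \<and> y \<in> X \<and> x \<noteq> y}" "card R \<le> M * m"
    and L: "L \<le> N0" "N0 - b \<le> L"
    and sq: "E (\<lambda>T. (S T)\<^sup>2) \<le> V"
    using dec unfolding decomposition_def N0_def b_def V_def m_def by blast+
  have N: "L - S T \<le> ?N T" "?N T \<le> L + collisions R T - S T" if "T \<in> \<Omega>" for T
    using dec that unfolding decomposition_def by blast+
  have mgf: "E (\<lambda>T. exp (l * S T)) \<le> exp (l\<^sup>2 * V)" if "\<bar>l\<bar> * M \<le> 1" for l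
    using dec that unfolding decomposition_def V_def m_def by blast
  have mgf': "E (\<lambda>T. exp (l * - S T)) \<le> exp (l\<^sup>2 * V)" if "\<bar>l\<bar> * M \<le> 1" for l
    using mgf[of "- l"] that by simp
  define e where "e = card R / real n"
  have e: "0 \<le> e" "e \<le> b" using R(2) by (auto simp: e_def b_def intro: divide_right_mono)
  have b0: "0 \<le> b" using e by simp
  let ?Y = "\<lambda>T. collisions R T - e"
  have varY: "E (\<lambda>T. (?Y T)\<^sup>2) \<le> var_const * m\<^sup>2 / n"
    using variance_collisions_le[OF X(1) R(1)] unfolding var_const_def m_def e_def .
  define W where "W = (15 + 3 * var_const) * V"
  have second_moment: "E (\<lambda>T. (?N T - N0)\<^sup>2) \<le> W"
  proof -
    have "E (\<lambda>T. (?N T - N0)\<^sup>2) \<le> E (\<lambda>T. 3 * (4 * b\<^sup>2 + ((?Y T)\<^sup>2 + (S T)\<^sup>2)))"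
    proof (rule E_mono)
      fix T assume T: "T \<in> \<Omega>"
      have "\<bar>?N T - N0\<bar> \<le> 2 * b + \<bar>?Y T\<bar> + \<bar>S T\<bar>" using N[OF T] L e by linarith
      then have "(?N T - N0)\<^sup>2 \<le> (2 * b + \<bar>?Y T\<bar> + \<bar>S T\<bar>)\<^sup>2"
        by (metis abs_ge_zero power2_abs power_mono)
      also have "\<dots> \<le> 3 * ((2 * b)\<^sup>2 + \<bar>?Y T\<bar>\<^sup>2 + \<bar>S T\<bar>\<^sup>2)"
      proof -
        have "3 * (x\<^sup>2 + y\<^sup>2 + z\<^sup>2) - (x + y + z)\<^sup>2 = (x - y)\<^sup>2 + (y - z)\<^sup>2 + (x - z)\<^sup>2" for x y z :: real
          by (simp add: power2_eq_square algebra_simps)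
        from this[of "2 * b" "\<bar>?Y T\<bar>" "\<bar>S T\<bar>"] show ?thesis
          by (smt (verit) zero_le_power2)
      qed
      finally show "(?N T - N0)\<^sup>2 \<le> 3 * (4 * b\<^sup>2 + ((?Y T)\<^sup>2 + (S T)\<^sup>2))"
        by (simp add: power_mult_distrib)
    qed
    also have "\<dots> = 3 * (4 * b\<^sup>2 + (E (\<lambda>T. (?Y T)\<^sup>2) + E (\<lambda>T. (S T)\<^sup>2)))"
      unfolding E_cmult E_add by simp
    also have "\<dots> \<le> 3 * (4 * V + (var_const * V + V))"
    proof -
      have "var_const * (m\<^sup>2 / n) \<le> var_const * V" using m2V K1 by (intro mult_left_mono) auto
      then show ?thesis using bV varY sq by simp
    qed
    also have "\<dots> = W" by (simp add: W_def algebra_simps)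
    finally show ?thesis .
  qed
  have W0: "0 < W" using V0 K1 by (simp add: W_def)
  have EN: "N0 \<le> E ?N" "E ?N \<le> N0 + bias_const * (m / n)"
    using E_empty_bins_bounds[OF X(1,3)] unfolding N0_def m_def by auto
  have rate_le: "exp (- (t\<^sup>2 / (k * V))) \<le> exp (- rate_const * B)" if k: "0 < k" "k \<le> 4 * (6 * var_const + 42)" for k
  proof -
    have "rate_const * B \<le> rate_const * (t\<^sup>2 / V)"
      using rate by (intro mult_left_mono) (auto simp: B_def)
    also have "\<dots> = t\<^sup>2 / ((4 * (6 * var_const + 42)) * V)" by (simp add: rate_const_def)
    also have "\<dots> \<le> t\<^sup>2 / (k * V)"
      using k V0 K1 by (intro divide_left_mono mult_right_mono mult_pos_pos) auto
    finally show ?thesis by simp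
  qed
  have rate_le': "exp (- (min ((t / 2)\<^sup>2 / V) (t / 2 / M) / 4)) \<le> exp (- rate_const * B)"
  proof -
    have "rate_const * B \<le> 1 / 16 * B" using rate B0 by (intro mult_right_mono)
    also have "\<dots> \<le> min ((t / 2)\<^sup>2 / V) (t / 2 / M) / 4"
      using min_half_bound[of V M t] V0 M1 t by (simp add: B_def)
    finally show ?thesis by simp
  qed
  \<comment> \<open>Beyond \<open>4 * V\<close> the offset \<open>b\<close> is at most
    \<open>t / 2\<close>, leaving \<open>t / 2\<close> to the martingale; below it,
    \<open>t\<^sup>2\<close> is comparable to the second moment and Cantelli's inequality has the
    right rate.\<close>
  show "P (\<lambda>T. ?N T \<le> N0 - t) \<le> exp (- rate_const * B)"
  proof (cases "t\<^sup>2 \<le> 4 * V")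
    case True
    have "P (\<lambda>T. ?N T \<le> N0 - t) \<le> P (\<lambda>T. ?N T - N0 \<le> - t)" by (rule P_mono) simp
    also have "\<dots> \<le> exp (- (t\<^sup>2 / ((19 + 3 * var_const) * V)))"
    proof (rule one_sided_chebyshev')
      show "0 \<le> E (\<lambda>T. ?N T - N0)" using EN by (simp add: E_diff)
      show "W + t\<^sup>2 \<le> (19 + 3 * var_const) * V" using True by (simp add: W_def algebra_simps)
    qed (fact second_moment t W0)+
    also have "\<dots> \<le> exp (- rate_const * B)" using K1 by (intro rate_le) auto
    finally show ?thesis .
  next
    case False
    have "b \<le> t / 2"
    proof (rule power2_le_imp_le)
      show "b\<^sup>2 \<le> (t / 2)\<^sup>2" using bV False by (simp add: power_divide)
    qed (use t in simp)
    then have "P (\<lambda>T. ?N T \<le> N0 - t) \<le> P (\<lambda>T. t / 2 \<le> S T)"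
      using N L by (intro P_mono) (smt (verit) field_sum_of_halves)
    also have "\<dots> \<le> exp (- (min ((t / 2)\<^sup>2 / V) (t / 2 / M) / 4))"
      by (rule bernstein_tail) (use mgf M1 V0 t in auto)
    also note rate_le'
    finally show ?thesis .
  qed
  \<comment> \<open>The threshold \<open>16 * V\<close> gives \<open>b \<le> t / 4\<close>: the
    deviation \<open>t\<close> must then pay for \<open>e\<close>, the martingale and the collision
    fluctuation.\<close>
  show "P (\<lambda>T. N0 + t \<le> ?N T) \<le> exp (- rate_const * B) + poly_const * m\<^sup>2 / (n * t\<^sup>2)"
  proof (cases "t\<^sup>2 \<le> 16 * V")
    case small: True
    show ?thesis
    proof (cases "t \<le> 2 * bias_const * (m / n)")
      case True
      \<comment> \<open>At \<open>t = 0\<close> the polynomial term is 0 by the convention for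
        division by zero, so the trivial bound 1 must come from the exponential.\<close>
      show ?thesis
      proof (cases "t = 0")
        case True
        then have "B = 0" using V0 M1 by (simp add: B_def)
        then show ?thesis using True P_le_1 by simp
      next
        case False
        then have t0: "0 < t" using t by simp
        have "n * t\<^sup>2 \<le> n * (2 * bias_const * (m / n))\<^sup>2"
          using True t by (intro mult_left_mono power_mono) auto
        also have "\<dots> = 4 * bias_const\<^sup>2 * m\<^sup>2 / n" by (simp add: power2_eq_square field_simps)
        also have "\<dots> \<le> 4 * bias_const\<^sup>2 * m\<^sup>2 / 1"
          by (intro divide_left_mono) auto
        also have "\<dots> \<le> poly_const * m\<^sup>2"
          using K1 by (auto simp: poly_const_def intro!: mult_right_mono)
        finally have "1 \<le> poly_const * m\<^sup>2 / (n * t\<^sup>2)" using t0 by simp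
        then show ?thesis using P_le_1[of "\<lambda>T. N0 + t \<le> ?N T"] exp_ge_zero[of "- rate_const * B"] by linarith
      qed
    next
      case False
      \<comment> \<open>The bias is at most \<open>t / 2\<close> here, so giving up half of
        \<open>t\<close> restores the mean condition that Cantelli's inequality requires.\<close>
      have "P (\<lambda>T. N0 + t \<le> ?N T) \<le> P (\<lambda>T. N0 + t / 2 - ?N T \<le> - (t / 2))" by (rule P_mono) simp
      also have "\<dots> \<le> exp (- ((t / 2)\<^sup>2 / ((6 * var_const + 42) * V)))"
      proof (rule one_sided_chebyshev'[where W = "2 * W + t\<^sup>2 / 2"])
        show "0 \<le> E (\<lambda>T. N0 + t / 2 - ?N T)" using EN False by (simp add: E_diff)
        have "E (\<lambda>T. (N0 + t / 2 - ?N T)\<^sup>2) \<le> E (\<lambda>T. 2 * (?N T - N0)\<^sup>2 + t\<^sup>2 / 2)"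
        proof (rule E_mono)
          fix T
          have "2 * (?N T - N0)\<^sup>2 + t\<^sup>2 / 2 - (N0 + t / 2 - ?N T)\<^sup>2 = (?N T - N0 + t / 2)\<^sup>2"
            by (simp add: power2_eq_square field_simps)
          then show "(N0 + t / 2 - ?N T)\<^sup>2 \<le> 2 * (?N T - N0)\<^sup>2 + t\<^sup>2 / 2"
            by (smt (verit) zero_le_power2)
        qed
        also have "\<dots> = 2 * E (\<lambda>T. (?N T - N0)\<^sup>2) + t\<^sup>2 / 2" unfolding E_add E_cmult by simp
        finally show "E (\<lambda>T. (N0 + t / 2 - ?N T)\<^sup>2) \<le> 2 * W + t\<^sup>2 / 2" using second_moment by simp
        show "2 * W + t\<^sup>2 / 2 + (t / 2)\<^sup>2 \<le> (6 * var_const + 42) * V"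
          using small by (simp add: W_def algebra_simps power_divide)
        show "0 < 2 * W + t\<^sup>2 / 2" using W0 by (simp add: add_pos_nonneg)
      qed (use t in simp)
      also have "\<dots> = exp (- (t\<^sup>2 / (4 * (6 * var_const + 42) * V)))" by (simp add: power_divide)
      also have "\<dots> \<le> exp (- rate_const * B)" using K1 by (intro rate_le) auto
      also have "\<dots> \<le> exp (- rate_const * B) + poly_const * m\<^sup>2 / (n * t\<^sup>2)"
        using K1 by (simp add: poly_const_def)
      finally show ?thesis .
    qed
  next
    case False
    have t0: "0 < t" using False V0 t by (cases "t = 0") auto
    have bt: "b \<le> t / 4"
    proof (rule power2_le_imp_le)
      show "b\<^sup>2 \<le> (t / 4)\<^sup>2" using bV False by (simp add: power_divide)
    qed (use t in simp)
    have "P (\<lambda>T. N0 + t \<le> ?N T) \<le> P (\<lambda>T. t / 2 \<le> - S T \<or> t / 4 \<le> ?Y T)"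
    proof (rule P_mono)
      fix T assume "T \<in> \<Omega>" "N0 + t \<le> ?N T"
      then show "t / 2 \<le> - S T \<or> t / 4 \<le> ?Y T" using N[of T] L e bt by linarith
    qed
    also have "\<dots> \<le> P (\<lambda>T. t / 2 \<le> - S T) + P (\<lambda>T. t / 4 \<le> ?Y T)" by (rule P_disj)
    also have "P (\<lambda>T. t / 2 \<le> - S T) \<le> exp (- (min ((t / 2)\<^sup>2 / V) (t / 2 / M) / 4))"
      by (rule bernstein_tail) (use mgf' M1 V0 t in auto)
    also note rate_le'
    also have "P (\<lambda>T. t / 4 \<le> ?Y T) \<le> E (\<lambda>T. (?Y T)\<^sup>2) / (t / 4)\<^sup>2"
      by (rule P_markov) (use t0 in \<open>auto intro: power_mono\<close>)
    also have "\<dots> \<le> (var_const * m\<^sup>2 / n) / (t / 4)\<^sup>2" using varY by (intro divide_right_mono) auto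
    also have "\<dots> = (16 * var_const) * (m\<^sup>2 / (n * t\<^sup>2))" by (simp add: power_divide)
    also have "\<dots> \<le> poly_const * (m\<^sup>2 / (n * t\<^sup>2))"
      by (intro mult_right_mono) (auto simp: poly_const_def)
    finally show ?thesis by simp
  qed
qed

end

theorem theorem4:
  fixes c :: nat
  assumes "c \<ge> 1"
  shows "\<exists>C K :: real. C > 0 \<and> K > 0 \<and>
    (\<forall>s r :: nat. \<forall>X :: (nat \<Rightarrow> nat) set. \<forall>t :: real.
       X \<subseteq> tab_keys c s \<longrightarrow> card X \<le> 2 ^ r \<longrightarrow> t \<ge> 0 \<longrightarrow>
       (let m = real (card X); n = real ((2::nat) ^ r);
            B = min (t\<^sup>2 / (m powr (3 - 1 / real c) / n)) (t / m powr (1 - 1 / real c))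
        in measure_pmf.prob (tab_dist c s r)
             {T. real (card (tab_hash c T ` X)) \<ge> mu0 (2 ^ r) (card X) + t}
             \<le> exp (- C * B)
         \<and> measure_pmf.prob (tab_dist c s r)
             {T. real (card (tab_hash c T ` X)) \<le> mu0 (2 ^ r) (card X) - t}
             \<le> exp (- C * B) + K * m\<^sup>2 / (n * t\<^sup>2)))"
proof -
  define C where "C = tabulation.rate_const c"
  define K where "K = tabulation.poly_const c"
  have loc: "tabulation c" using assms by unfold_locales
  have v: "4 \<le> tabulation.var_const c" using loc by (simp add: tabulation.var_const_def)
  have CK: "0 < C" "0 < K"
    using v loc by (auto simp: C_def K_def tabulation.rate_const_def tabulation.poly_const_def
        intro!: add_pos_nonneg)
  have tails: "measure_pmf.prob (tab_dist c s r)
        {T. real (card (tab_hash c T ` X)) \<ge> mu0 (2 ^ r) (card X) + t} \<le> exp (- C * B) \<and>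
      measure_pmf.prob (tab_dist c s r)
        {T. real (card (tab_hash c T ` X)) \<le> mu0 (2 ^ r) (card X) - t}
        \<le> exp (- C * B) + K * m\<^sup>2 / (n * t\<^sup>2)"
    if X: "X \<subseteq> tab_keys c s" and le: "card X \<le> 2 ^ r" and t: "0 \<le> t"
      and m: "m = real (card X)" and n: "n = real ((2::nat) ^ r)"
      and B: "B = min (t\<^sup>2 / (m powr (3 - 1 / real c) / n)) (t / m powr (1 - 1 / real c))"
    for s r X and t m n B :: real
  proof -
    interpret tab: tabulation c s r using assms by unfold_locales
    \<comment> \<open>Many occupied bins means few empty ones, so the two tails change
      roles.\<close>
    have up: "measure_pmf.prob (tab_dist c s r)
          {T. real (card (tab_hash c T ` X)) \<ge> mu0 (2 ^ r) (card X) + t}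
        = tab.P (\<lambda>T. tab.empty_bins X T \<le> tab.n * (1 - 1 / tab.n) ^ card X - t)"
      unfolding tab.prob_eq_P by (rule tab.P_cong) (auto simp: tab.empty_bins_def mu0_def algebra_simps)
    have down: "measure_pmf.prob (tab_dist c s r)
          {T. real (card (tab_hash c T ` X)) \<le> mu0 (2 ^ r) (card X) - t}
        = tab.P (\<lambda>T. tab.n * (1 - 1 / tab.n) ^ card X + t \<le> tab.empty_bins X T)"
      unfolding tab.prob_eq_P by (rule tab.P_cong) (auto simp: tab.empty_bins_def mu0_def algebra_simps)
    \<comment> \<open>For empty \<open>X\<close> both denominators in \<open>B\<close> are 0 since
      \<open>0 powr a = 0\<close>, hence \<open>B = 0\<close> and both bounds are trivial.\<close>
    show ?thesis
    proof (cases "X = {}")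
      case True
      then show ?thesis using tab.P_le_1 by (simp add: tab.prob_eq_P m B)
    next
      case False
      have "finite X" using X by (rule tab.finite_keys_subset)
      then have m0: "0 < m" using False by (simp add: m card_gt_0_iff)
      have "m powr (3 - 1 / real c) = m powr ((1 - 1 / real c) + 2)"
        by (rule arg_cong2[where f = "(powr)"]) auto
      also have "\<dots> = m powr (1 - 1 / real c) * m * m"
        using m0 unfolding powr_add by (simp add: power2_eq_square)
      finally have "m powr (3 - 1 / real c) = m powr (1 - 1 / real c) * m * m" .
      then show ?thesis
        unfolding up down C_def K_def B using tab.empty_bins_tails[OF X False le t] by (simp add: m n)
    qed
  qed
  show ?thesis
    unfolding Let_def
    by (rule exI[of _ C], rule exI[of _ K], intro conjI[OF CK(1)] conjI[OF CK(2)] allI impI)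
      (rule tails; (assumption | rule refl))
qed

end
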